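(* Assume Condition 1 (stated in the context). (a) If there exists some $\boldsymbol{p}^{(i)}$ such that $\boldsymbol{p}^{(i')}=\boldsymbol{p}^{(i)}$ for infinitely many $i'$, then $\mathcal{Z}^{(\infty)}$ is almost-surely a simple path. (b) If for some $e\in\{\pm e_j:j\in[d]\}$ with $e\neq e_1$, and all $c\in(0,\infty)$, $$\sum_{i=1}^\infty\frac{c^{(i)}(0,e_1)}{c^{(i)}(0,e)}\min\left\{1,\left(\beta_{(i)}^{c\,\delta^{(0)}\cdot\ell^{(i)}}-1\right)\beta_{(i)}^{c}\right\}<\infty,$$ then $\mathbb{P}(\mathcal{Z}^{(\infty)}\text{ is not simple})>0$, i.e. with positive probability $\mathcal{Z}^{(\infty)}$ is not a simple path.
   Context: Model. Let $d\ge 2$, $[d]=\{1,\dots,d\}$, $\mathbb{N}=\{1,2,\dots\}$, $\mathbb{Z}_+=\{0,1,2,\dots\}$, and let $e_1,\dots,e_d$ be the standard basis vectors. Let $(\boldsymbol{p}^{(i)})_{i\in\mathbb{Z}_+\cup\{\infty\}}$ be probability distributions on $\{\pm e_j:j\in[d]\}$. For such a distribution $\boldsymbol{p}$ and a connected subgraph $\mathcal{Z}$ of $\mathbb{Z}^d$ (with nearest-neighbour edges) containing $0$, a $\boldsymbol{p}$-random walk on $\mathcal{Z}$ is the discrete-time Markov chain started at $0$ which moves from $x$ to $x+e$ with probability $p(e)/\sum_{e':(x,x+e')\in\mathcal{Z}}p(e')$ if $(x,x+e)$ is an edge of $\mathcal{Z}$, and with probability $0$ otherwise. Let $\mathcal{Z}^{(0)}=\mathbb{Z}^d$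 and let $X^{(0)}$ be a $\boldsymbol{p}^{(0)}$-random walk on $\mathcal{Z}^{(0)}$. Recursively, given the walk $X^{(i)}$, $\mathcal{Z}^{(i+1)}$ is its trace, i.e. the graph with vertex set $\{X^{(i)}_n:n\in\mathbb{Z}_+\}$ and undirected edge set $\{(X^{(i)}_n,X^{(i)}_{n+1}):n\in\mathbb{Z}_+\}$; given $\mathcal{Z}^{(i+1)}$, the walk $X^{(i+1)}$ is a $\boldsymbol{p}^{(i+1)}$-random walk on $\mathcal{Z}^{(i+1)}$, conditionally independent of $X^{(j)}$, $j<i+1$. The graphs are decreasing in $i$; set $\mathcal{Z}^{(\infty)}:=\bigcap_{i\in\mathbb{Z}_+}\mathcal{Z}^{(i)}$ (intersection of vertex sets and of edge sets). All walks are defined on a probability space with probability measure $\mathbb{P}$. "Simple path" means an infinite self-avoiding path started at $0$: the graph consists of exactly the vertices and edges of an injective nearest-neighbour path $(\pi_n)_{n\ge 0}$ with $\pi_0=0$. Notation. $\delta^{(i)}=(\delta^{(i)}_j)_{j\in[d]}$ with $\delta^{(i)}_j=p^{(i)}(e_j)-p^{(i)}(-e_j)$. When $p^{(i)}(e)>0$ for every $e$, $\hat\ell^{(i)}=(\hat\ell^{(i)}_j)_{j\in[d]}$ with $\hat\ell^{(i)}_j=\log\left(p^{(i)}(e_j)/p^{(i)}(-e_j)\right)$, $\ell^{(i)}=\hat\ell^{(i)}/\|\hat\ell^{(i)}\|$ (Euclidean norm), and $\beta_{(i)}=\exp\{\|\hat\ell^{(i)}\|\}$. The conductances are, for $x,y\in\mathbb{Z}^d$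 with $\|x-y\|=1$, $$c^{(i)}(x,y)=\Big(\prod_{j=1}^d c_{(i),j}^{|y_j-x_j|}\Big)\beta_{(i)}^{(x\vee y)\cdot\ell^{(i)}},\qquad c_{(i),j}=p^{(i)}(-e_j),\qquad x\vee y=(x_j\vee y_j)_{j\in[d]}.$$ Condition 1. (a) $\delta^{(0)}_j\ge 0$ for each $j\in[d]$, and $\delta^{(0)}_1>0$; (b) $p^{(i)}(e)>0$ for all $e\in\{\pm e_j:j\in[d]\}$ and all $i\in\mathbb{Z}_+\cup\{\infty\}$; (c) for each $i\in\mathbb{N}\cup\{\infty\}$, $\delta^{(0)}\cdot\ell^{(i)}>0$. *)

theory Defs
  imports "HOL-Probability.Probability" "HOL-Library.Extended_Nat"
begin

section \<open>The lattice and its subgraphs\<close>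

definition directions :: "(int ^ 'd::finite) set" where
  "directions = {axis j 1 |j. True} \<union> {- axis j 1 |j. True}"

text \<open>A graph is a pair of a vertex set and a set of undirected edges; the edge joining
  \<open>x\<close> and \<open>y\<close> is the set \<open>{x, y}\<close>.\<close>

type_synonym 'd graph = "(int ^ 'd) set \<times> (int ^ 'd) set set"

definition lattice_graph :: "('d::finite) graph" where
  "lattice_graph = (UNIV, {{x, x + e} |x e. e \<in> directions})"

definition trace_graph :: "(nat \<Rightarrow> int ^ 'd::finite) \<Rightarrow> 'd graph" where
  "trace_graph \<pi> = (range \<pi>, range (\<lambda>n. {\<pi> n, \<pi> (Suc n)}))"

definition is_simple_path :: "('d::finite) graph \<Rightarrow> bool" where
  "is_simple_path G \<longleftrightarrow>
     (\<exists>\<pi>. inj \<pi> \<and> \<pi> 0 = 0 \<and> (\<forall>n. \<pi> (Suc n) - \<pi> n \<in> directions) \<and> G = trace_graph \<pi>)"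


section \<open>Sigma-algebras, conditional probability and conditional independence\<close>

text \<open>Vertices and edges range over countable sets, so the elementary events below generate
  the usual sigma-algebras of a random graph \<open>G\<close> and of a family \<open>Y\<close> of random sites.\<close>

definition graph_events :: "'a measure \<Rightarrow> ('a \<Rightarrow> ('d::finite) graph) \<Rightarrow> 'a set set" where
  "graph_events M G =
     {{\<omega> \<in> space M. x \<in> fst (G \<omega>)} |x. True} \<union> {{\<omega> \<in> space M. f \<in> snd (G \<omega>)} |f. True}"

definition path_events :: "'a measure \<Rightarrow> 'k set \<Rightarrow> ('k \<Rightarrow> 'a \<Rightarrow> int ^ 'd::finite) \<Rightarrow> 'a set set" where
  "path_events M K Y = {{\<omega> \<in> space M. Y k \<omega> = x} |k x. k \<in> K}"

definition cond_prob :: "'a measure \<Rightarrow> 'a measure \<Rightarrow> 'a set \<Rightarrow> 'a \<Rightarrow> real" where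
  "cond_prob M F A = real_cond_exp M F (indicator A)"

definition cond_indep :: "'a measure \<Rightarrow> 'a measure \<Rightarrow> 'a measure \<Rightarrow> 'a measure \<Rightarrow> bool" where
  "cond_indep M F A B \<longleftrightarrow>
     (\<forall>a \<in> sets A. \<forall>b \<in> sets B. AE \<omega> in M.
        cond_prob M F (a \<inter> b) \<omega> = cond_prob M F a \<omega> * cond_prob M F b \<omega>)"


section \<open>Random walks on nested traces\<close>

definition step_prob :: "(int ^ 'd::finite) pmf \<Rightarrow> 'd graph \<Rightarrow> int ^ 'd \<Rightarrow> int ^ 'd \<Rightarrow> real" where
  "step_prob p G x y =
     (if {x, y} \<in> snd G
      then pmf p (y - x) / (\<Sum>e | e \<in> directions \<and> {x, x + e} \<in> snd G. pmf p e)
      else 0)"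

text \<open>Given the random graph \<open>G\<close>, the process \<open>Y\<close> is a \<open>p\<close>-random walk on \<open>G\<close> started at the
  origin: conditionally on \<open>G\<close> and on its first \<open>n\<close> steps, the next step is chosen according to
  \<open>step_prob\<close>. For a constant \<open>G\<close> this is the usual Markov property.\<close>

definition random_walk_on ::
    "'a measure \<Rightarrow> (int ^ 'd::finite) pmf \<Rightarrow> ('a \<Rightarrow> 'd graph) \<Rightarrow> (nat \<Rightarrow> 'a \<Rightarrow> int ^ 'd) \<Rightarrow> bool" where
  "random_walk_on M p G Y \<longleftrightarrow>
     (AE \<omega> in M. Y 0 \<omega> = 0) \<and>
     (\<forall>n y. AE \<omega> in M.
        cond_prob M (sigma (space M) (graph_events M G \<union> path_events M {..n} Y))
          {\<omega> \<in> space M. Y (Suc n) \<omega> = y} \<omega>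
        = step_prob p (G \<omega>) (Y n \<omega>) y)"

fun walk_graph :: "(nat \<Rightarrow> nat \<Rightarrow> 'a \<Rightarrow> int ^ 'd::finite) \<Rightarrow> nat \<Rightarrow> 'a \<Rightarrow> 'd graph" where
  "walk_graph X 0 \<omega> = lattice_graph"
| "walk_graph X (Suc i) \<omega> = trace_graph (\<lambda>n. X i n \<omega>)"

definition limit_graph :: "(nat \<Rightarrow> nat \<Rightarrow> 'a \<Rightarrow> int ^ 'd::finite) \<Rightarrow> 'a \<Rightarrow> 'd graph" where
  "limit_graph X \<omega> = (\<Inter>i. fst (walk_graph X i \<omega>), \<Inter>i. snd (walk_graph X i \<omega>))"

text \<open>\<open>X i n\<close> is the position of the \<open>i\<close>-th walk at time \<open>n\<close>. For \<open>i = 0\<close> the conditioning in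
  \<open>walk\<close> and \<open>indep\<close> is trivial, since \<open>walk_graph X 0\<close> is deterministic and there are no
  earlier walks.\<close>

locale nested_walks = prob_space M
  for M :: "'a measure" +
  fixes p :: "enat \<Rightarrow> (int ^ 'd::finite) pmf"
    and X :: "nat \<Rightarrow> nat \<Rightarrow> 'a \<Rightarrow> int ^ 'd"
  assumes steps: "\<And>i. set_pmf (p i) \<subseteq> directions"
    and measurable_walk: "\<And>i n. random_variable (count_space UNIV) (X i n)"
    and walk: "\<And>i. random_walk_on M (p (enat i)) (walk_graph X i) (X i)"
    and indep: "\<And>i. cond_indep M (sigma (space M) (graph_events M (walk_graph X i)))
        (sigma (space M) (path_events M UNIV (X i)))
        (sigma (space M) (path_events M ({..<i} \<times> UNIV) (\<lambda>(j, n). X j n)))"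


section \<open>Drift, conductances and the standing condition\<close>

definition drift :: "(int ^ 'd::finite) pmf \<Rightarrow> real ^ 'd" where
  "drift p = (\<chi> j. pmf p (axis j 1) - pmf p (- axis j 1))"

definition ell_hat :: "(int ^ 'd::finite) pmf \<Rightarrow> real ^ 'd" where
  "ell_hat p = (\<chi> j. ln (pmf p (axis j 1) / pmf p (- axis j 1)))"

definition ell :: "(int ^ 'd::finite) pmf \<Rightarrow> real ^ 'd" where
  "ell p = ell_hat p /\<^sub>R norm (ell_hat p)"

definition beta :: "(int ^ 'd::finite) pmf \<Rightarrow> real" where
  "beta p = exp (norm (ell_hat p))"

text \<open>Only meaningful for nearest neighbours \<open>x\<close> and \<open>y\<close>.\<close>

definition conductance :: "(int ^ 'd::finite) pmf \<Rightarrow> int ^ 'd \<Rightarrow> int ^ 'd \<Rightarrow> real" where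
  "conductance p x y =
     (\<Prod>j\<in>UNIV. pmf p (- axis j 1) ^ nat \<bar>y $ j - x $ j\<bar>) *
     beta p powr ((\<chi> j. real_of_int (max (x $ j) (y $ j))) \<bullet> ell p)"

text \<open>The index \<open>k\<close> plays the role of the first coordinate. If \<open>ell_hat (p i) = 0\<close>, then
  \<open>ell (p i) = 0\<close> by the convention for division by zero, so the last clause also excludes the
  case in which the direction of \<open>ell_hat (p i)\<close> is undefined.\<close>

definition condition1 :: "(enat \<Rightarrow> (int ^ 'd::finite) pmf) \<Rightarrow> 'd \<Rightarrow> bool" where
  "condition1 p k \<longleftrightarrow>
     (\<forall>j. drift (p 0) $ j \<ge> 0) \<and> drift (p 0) $ k > 0 \<and>
     (\<forall>i. \<forall>e \<in> directions. pmf (p i) e > 0) \<and>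
     (\<forall>i. i \<noteq> 0 \<longrightarrow> drift (p 0) \<bullet> ell (p i) > 0)"

end

theory Submission
  imports Defs
begin

text \<open>
  The first walk has infinitely many cut times, at which the trace is divided by a single edge, and
  conductances grow exponentially along it, so the total resistance of the trace is finite.

  For (a), let \<open>B\<close> be the finite part of the trace before a cut edge. By the Dirichlet principle a
  \<open>q\<close>-walk on any infinite connected subgraph that has crossed this edge escapes with a probability
  that is bounded below in terms of the total resistance only. Hence at each stage with law \<open>q\<close> the
  walk crosses \<open>B\<close> along a self-avoiding path and never returns with conditional probability at least
  \<open>\<epsilon> > 0\<close>. This happens almost surely at some stage, and all later walks have to follow this path.

  For (b), with positive probability the first walk makes the excursion \<open>0, e, 0\<close>, leaves through
  \<open>e\<^sub>1\<close> and never returns. The later walks keep the dead end \<open>e\<close> if they visit it. By Thomson's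
  principle the \<open>i\<close>-th walk misses it with probability at most \<open>p(e\<^sub>1) / (p(e) Z)\<close>, where \<open>Z\<close> is the sum
  over the cut times \<open>n\<close> of \<open>exp (- l \<bullet> X\<^sub>n)\<close>. Writing \<open>Z\<^sub>n\<close> for the series that starts at the cut time \<open>n\<close>,
  the numbers \<open>- ln (1 - 1 / Z\<^sub>n) \<ge> 1 / Z\<^sub>n\<close> telescope to the displacement of the walk in direction \<open>l\<close>,
  and stationarity of the increments gives \<open>E (1 / Z) = O(\<delta> \<bullet> l)\<close>. The hypothesis for \<open>c = 1\<close> then
  makes the probabilities of a miss summable.
\<close>

section \<open>Conditional path probabilities\<close>

text \<open>The walks are given only through conditional probabilities. Each stage is therefore
  studied on a fixed graph first and then integrated: \<open>prob_follow_avoid\<close> turns bounds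
  on the deterministic quantity \<open>esc\<close> into bounds on probabilities, jointly with any
  event \<open>b\<close> of the earlier walks. Green's identity is only ever applied to finite
  vertex sets. The bounds on a fixed graph still depend on the trace of the first walk. For (a) this
  is met by restricting to countably many parameters for each of which the bound is constant. For
  (b) the bounds on a miss form a random summable series. It is cut at a stage \<open>I\<close>
  after which, with positive probability, it adds up to at most 1/2; the earlier stages are passed
  by forcing a single step each. The delicate point of (b) is a bound on \<open>E (1 / Z)\<close>
  with a constant that is the same for all stages. The additive constant in the bound for the
  logarithm of \<open>Z\<close> does depend on \<open>l\<close>, but it disappears after division by
  the number of steps.\<close>

lemma measurable_countable_fun2:
  fixes f :: "'a \<Rightarrow> 'b::countable" and g :: "'a \<Rightarrow> 'c::countable"
  assumes "f \<in> measurable N (count_space UNIV)" and "g \<in> measurable N (count_space UNIV)"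
  shows "(\<lambda>\<omega>. h (f \<omega>) (g \<omega>)) \<in> measurable N (count_space UNIV)"
  by (rule measurable_compose_countable[OF _ assms(1)], rule measurable_compose[OF assms(2)]) simp

lemma sets_walk_graph:
  assumes Y: "\<And>j n. j < i \<Longrightarrow> X j n \<in> measurable N (count_space UNIV)"
  shows sets_fst_walk_graph: "{\<omega> \<in> space N. x \<in> fst (walk_graph X i \<omega>)} \<in> sets N"
    and sets_snd_walk_graph: "{\<omega> \<in> space N. f \<in> snd (walk_graph X i \<omega>)} \<in> sets N"
proof -
  show "{\<omega> \<in> space N. x \<in> fst (walk_graph X i \<omega>)} \<in> sets N"
  proof (cases i)
    case 0
    then show ?thesis by (simp add: lattice_graph_def)
  next
    case (Suc j)
    have [measurable]: "X j n \<in> measurable N (count_space UNIV)" for n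
      using Y Suc by simp
    have "{\<omega> \<in> space N. x \<in> fst (walk_graph X i \<omega>)} = {\<omega> \<in> space N. \<exists>n. X j n \<omega> = x}"
      using Suc by (auto simp: trace_graph_def)
    also have "\<dots> \<in> sets N" by measurable
    finally show ?thesis .
  qed
  show "{\<omega> \<in> space N. f \<in> snd (walk_graph X i \<omega>)} \<in> sets N"
  proof (cases i)
    case 0
    then show ?thesis by simp
  next
    case (Suc j)
    have X: "X j n \<in> measurable N (count_space UNIV)" for n
      using Y Suc by simp
    have [measurable]: "Measurable.pred N (\<lambda>\<omega>. f = {X j n \<omega>, X j (Suc n) \<omega>})" for n
      using measurable_countable_fun2[OF X[of n] X[of "Suc n"], where h = "\<lambda>a b. f = {a, b}"] .
    have "{\<omega> \<in> space N. f \<in> snd (walk_graph X i \<omega>)} =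
        {\<omega> \<in> space N. \<exists>n. f = {X j n \<omega>, X j (Suc n) \<omega>}}"
      using Suc by (auto simp: trace_graph_def)
    also have "\<dots> \<in> sets N" by measurable
    finally show ?thesis .
  qed
qed

lemma finite_directions [simp, intro]: "finite (directions :: (int ^ 'd::finite) set)"
proof -
  have "directions = range (\<lambda>j::'d. axis j (1::int)) \<union> range (\<lambda>j::'d. - axis j (1::int))"
    by (auto simp: directions_def)
  then show ?thesis by (metis finite_UnI finite finite_imageI)
qed

lemma borel_measurable_step_prob:
  assumes snd: "\<And>f. {\<omega> \<in> space N. f \<in> snd (G \<omega>)} \<in> sets N"
  shows "(\<lambda>\<omega>. step_prob q (G \<omega>) x y) \<in> borel_measurable N"
proof -
  have [measurable]: "Measurable.pred N (\<lambda>\<omega>. f \<in> snd (G \<omega>))" for f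
    using snd[of f] by (simp add: pred_def)
  show ?thesis
    unfolding step_prob_def sum.inter_filter[OF finite_directions] by measurable
qed

lemma step_prob_nonneg: "0 \<le> step_prob q G x y"
  by (simp add: step_prob_def sum_nonneg)

lemma step_prob_le_1:
  assumes "set_pmf q \<subseteq> directions"
  shows "step_prob q G x y \<le> 1"
proof (cases "{x, y} \<in> snd G \<and> y - x \<in> directions")
  case True
  let ?D = "{e. e \<in> directions \<and> {x, x + e} \<in> snd G}"
  have "finite ?D" by (rule finite_subset[of _ directions]) auto
  then have "pmf q (y - x) \<le> (\<Sum>e\<in>?D. pmf q e)"
    using member_le_sum[of "y - x" ?D "pmf q"] True by simp
  then show ?thesis
    by (simp add: step_prob_def sum_nonneg divide_le_eq_1) (smt (verit) pmf_nonneg)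
next
  case False
  then have "pmf q (y - x) = 0" if "{x, y} \<in> snd G"
    using assms that by (auto simp: pmf_eq_0_set_pmf)
  then show ?thesis by (simp add: step_prob_def)
qed

definition path_weight :: "(int ^ 'd::finite) pmf \<Rightarrow> 'd graph \<Rightarrow> (nat \<Rightarrow> int ^ 'd) \<Rightarrow> nat \<Rightarrow> real" where
  "path_weight q G y n = (\<Prod>k<n. step_prob q G (y k) (y (Suc k)))"

lemma path_weight_nonneg: "0 \<le> path_weight q G y n"
  by (simp add: path_weight_def prod_nonneg step_prob_nonneg)

lemma path_weight_le_1: "set_pmf q \<subseteq> directions \<Longrightarrow> path_weight q G y n \<le> 1"
  by (simp add: path_weight_def prod_le_1 step_prob_nonneg step_prob_le_1)

section \<open>Conditional law of the initial steps of a walk\<close>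

context nested_walks
begin

definition past :: "nat \<Rightarrow> 'a measure" where
  "past i = sigma (space M) (path_events M ({..<i} \<times> UNIV) (\<lambda>(j, n). X j n))"

lemma X_measurable [measurable]: "X i n \<in> measurable M (count_space UNIV)"
  by (rule measurable_walk)

lemma path_events_sub: "path_events M K (\<lambda>(j, n). X j n) \<subseteq> sets M"
  by (auto simp: path_events_def)

lemma path_events_sub': "path_events M K (X i) \<subseteq> sets M"
  by (auto simp: path_events_def)

lemma graph_events_sub: "graph_events M (walk_graph X i) \<subseteq> sets M"
  using sets_walk_graph[of i X M] by (auto simp: graph_events_def)

lemma subalg_past: "subalgebra M (past i)"
  using path_events_sub[of "{..<i} \<times> UNIV"]
    finite_measure_subalgebra_axioms_def
  by (simp add: past_def subalgebra_def sets.sigma_sets_subset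
    subset_trans[OF path_events_sub sets.space_closed])

lemma space_past [simp]: "space (past i) = space M"
  using subalg_past by (simp add: subalgebra_def)

lemma past_sets: "b \<in> sets (past i) \<Longrightarrow> b \<in> sets M"
  using subalg_past by (auto simp: subalgebra_def)

lemma past_X: "j < i \<Longrightarrow> X j n \<in> measurable (past i) (count_space UNIV)"
proof (rule measurable_count_space_eq_countable[THEN iffD2])
  assume "j < i"
  have "path_events M ({..<i} \<times> UNIV) (\<lambda>(j, n). X j n) \<subseteq> Pow (space M)"
    by (auto simp: path_events_def)
  then have "{\<omega> \<in> space M. X j n \<omega> = x} \<in> sets (past i)" for x
    unfolding past_def using \<open>j < i\<close>
    by (intro in_measure_of) (auto simp: path_events_def)
  moreover have "X j n -` {x} \<inter> space (past i) = {\<omega> \<in> space M. X j n \<omega> = x}" for x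
    by auto
  ultimately show "X j n \<in> space (past i) \<rightarrow> UNIV \<and> (\<forall>a\<in>UNIV. X j n -` {a} \<inter> space (past i) \<in> sets (past i))"
    by auto
qed (simp_all)

lemma sigma_subalg: "E \<subseteq> sets M \<Longrightarrow> sigma_finite_subalgebra M (sigma (space M) E)"
proof (rule finite_measure_subalgebra_is_sigma_finite)
  assume E: "E \<subseteq> sets M"
  then have "E \<subseteq> Pow (space M)" using sets.space_closed by blast
  then have "subalgebra M (sigma (space M) E)"
    using E by (auto simp: subalgebra_def sets.sigma_sets_subset intro: sets.sigma_sets_subset[THEN subsetD])
  then show "finite_measure_subalgebra M (sigma (space M) E)"
    by (simp add: finite_measure_subalgebra_def finite_measure_subalgebra_axioms_def finite_measure_axioms)
qed

abbreviation graph_algebra :: "nat \<Rightarrow> 'a measure" where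
  "graph_algebra i \<equiv> sigma (space M) (graph_events M (walk_graph X i))"

abbreviation history_algebra :: "nat \<Rightarrow> nat \<Rightarrow> 'a measure" where
  "history_algebra i n \<equiv> sigma (space M) (graph_events M (walk_graph X i) \<union> path_events M {..n} (X i))"

lemma events_space: "graph_events M G \<subseteq> Pow (space M)" "path_events M K Z \<subseteq> Pow (space M)"
  by (auto simp: graph_events_def path_events_def)

lemma graph_algebra_snd:
  "{\<omega> \<in> space (graph_algebra i). f \<in> snd (walk_graph X i \<omega>)} \<in> sets (graph_algebra i)"
  using events_space
  by (auto simp: space_measure_of_conv graph_events_def intro!: in_measure_of)

lemma history_algebra_snd:
  "{\<omega> \<in> space (history_algebra i n). f \<in> snd (walk_graph X i \<omega>)} \<in> sets (history_algebra i n)"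
  using events_space
  by (auto simp: space_measure_of_conv graph_events_def path_events_def intro!: in_measure_of)

lemma history_algebra_X:
  "k \<le> n \<Longrightarrow> {\<omega> \<in> space M. X i k \<omega> = x} \<in> sets (history_algebra i n)"
  by (rule in_measure_of[OF Un_least[OF events_space]]) (auto simp: path_events_def)

lemma snd_walk_graph_measurable [measurable]: "Measurable.pred M (\<lambda>\<omega>. f \<in> snd (walk_graph X i \<omega>))"
  using sets_snd_walk_graph[of i X M f] by (simp add: pred_def)

lemma borel_measurable_step [measurable]:
  "(\<lambda>\<omega>. step_prob q (walk_graph X i \<omega>) x y) \<in> borel_measurable M"
  by (rule borel_measurable_step_prob) measurable

text \<open>The conditional probability \<open>step_prob\<close> vanishes where the graph has no
  edge; integrating it over the history event \<open>?A\<close> gives probability 0 for fixed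
  \<open>x\<close> and \<open>y\<close>, and the lattice is countable.\<close>

lemma AE_walk_edge: "AE \<omega> in M. \<forall>i n. {X i n \<omega>, X i (Suc n) \<omega>} \<in> snd (walk_graph X i \<omega>)"
proof -
  have "AE \<omega> in M. \<not> (X i n \<omega> = x \<and> X i (Suc n) \<omega> = y \<and> {x, y} \<notin> snd (walk_graph X i \<omega>))" for i n x y
  proof -
    let ?H = "history_algebra i n"
    let ?B = "{\<omega> \<in> space M. X i (Suc n) \<omega> = y}"
    let ?A = "{\<omega> \<in> space M. X i n \<omega> = x} \<inter> (space ?H - {\<omega> \<in> space ?H. {x, y} \<in> snd (walk_graph X i \<omega>)})"
    interpret H: sigma_finite_subalgebra M ?H
      using graph_events_sub path_events_sub' by (intro sigma_subalg) auto
    have A: "?A \<in> sets ?H"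
      by (intro sets.Int sets.Diff sets.top history_algebra_X history_algebra_snd) auto
    have A': "?A \<in> sets M" using A H.subalg by (auto simp: subalgebra_def)
    have "prob (?A \<inter> ?B) = (\<integral>\<omega>. indicator ?A \<omega> * indicator ?B \<omega> \<partial>M)"
      using A' by (subst indicator_inter_arith[symmetric]) (simp add: sets.Int[OF A'])
    also have "\<dots> = (\<integral>\<omega>. indicator ?A \<omega> * real_cond_exp M ?H (indicator ?B) \<omega> \<partial>M)"
      using A A' by (intro H.real_cond_exp_intg(2)[symmetric])
        (auto intro!: integrable_real_mult_indicator integrable_real_indicator simp: emeasure_eq_measure)
    also have "\<dots> = (\<integral>\<omega>. indicator ?A \<omega> * step_prob (p (enat i)) (walk_graph X i \<omega>) (X i n \<omega>) y \<partial>M)"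
    proof -
      have eq: "AE \<omega> in M. real_cond_exp M ?H (indicator ?B) \<omega> =
           step_prob (p (enat i)) (walk_graph X i \<omega>) (X i n \<omega>) y"
        using walk[of i] by (auto simp: random_walk_on_def cond_prob_def)
      have [measurable]: "(\<lambda>\<omega>. step_prob (p (enat i)) (walk_graph X i \<omega>) (X i n \<omega>) y) \<in> borel_measurable M"
        by (rule measurable_compose_countable[of "\<lambda>x \<omega>. step_prob (p (enat i)) (walk_graph X i \<omega>) x y"]) measurable
      show ?thesis
        using eq A' by (intro integral_cong_AE) auto
    qed
    also have "\<dots> = (\<integral>\<omega>. 0 \<partial>M)"
      by (intro Bochner_Integration.integral_cong refl) (auto simp: indicator_def step_prob_def)
    finally have "prob (?A \<inter> ?B) = 0" by simp
    then have "AE \<omega> in M. \<omega> \<notin> ?A \<inter> ?B"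
      using prob_eq_0[of "?A \<inter> ?B"] A' by simp
    then show ?thesis
      using AE_space by eventually_elim (auto simp: space_measure_of_conv)
  qed
  then have "AE \<omega> in M. \<forall>i n x y. \<not> (X i n \<omega> = x \<and> X i (Suc n) \<omega> = y \<and> {x, y} \<notin> snd (walk_graph X i \<omega>))"
    unfolding AE_all_countable by blast
  then show ?thesis by eventually_elim auto
qed

lemma AE_walk_0: "AE \<omega> in M. \<forall>i. X i 0 \<omega> = 0"
  using walk by (auto simp: AE_all_countable random_walk_on_def)


text \<open>Tower property: conditioning on the history first splits off the last
  \<open>step_prob\<close> factor, and conditioning on the graph then leaves the shorter path to the
  induction hypothesis.\<close>

lemma cond_prob_follow:
  "AE \<omega> in M. cond_prob M (graph_algebra i) {\<omega> \<in> space M. \<forall>k\<le>n. X i k \<omega> = y k} \<omega> =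
     (if y 0 = 0 then path_weight (p (enat i)) (walk_graph X i \<omega>) y n else 0)"
proof (induction n)
  case 0
  interpret G: sigma_finite_subalgebra M "graph_algebra i"
    by (intro sigma_subalg graph_events_sub)
  let ?c = "if y 0 = 0 then 1 else 0 :: real"
  have "AE \<omega> in M. indicator {\<omega> \<in> space M. \<forall>k\<le>0. X i k \<omega> = y k} \<omega> = ?c"
    using AE_walk_0 AE_space by eventually_elim (auto simp: indicator_def)
  then have "AE \<omega> in M. real_cond_exp M (graph_algebra i) (indicator {\<omega> \<in> space M. \<forall>k\<le>0. X i k \<omega> = y k}) \<omega> =
      real_cond_exp M (graph_algebra i) (\<lambda>_. ?c) \<omega>"
    by (intro G.real_cond_exp_cong) auto
  moreover have "AE \<omega> in M. real_cond_exp M (graph_algebra i) (\<lambda>_. ?c) \<omega> = ?c"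
    by (intro G.real_cond_exp_F_meas) auto
  ultimately show ?case
    by eventually_elim (auto simp: cond_prob_def path_weight_def)
next
  case (Suc n)
  let ?G = "graph_algebra i" and ?H = "history_algebra i n"
  let ?A = "{\<omega> \<in> space M. \<forall>k\<le>n. X i k \<omega> = y k}" and ?B = "{\<omega> \<in> space M. X i (Suc n) \<omega> = y (Suc n)}"
  let ?s = "\<lambda>\<omega>. step_prob (p (enat i)) (walk_graph X i \<omega>) (y n) (y (Suc n))"
  interpret G: sigma_finite_subalgebra M ?G
    by (intro sigma_subalg graph_events_sub)
  interpret H: sigma_finite_subalgebra M ?H
    using graph_events_sub path_events_sub' by (intro sigma_subalg) auto
  have A: "?A \<in> sets ?H"
  proof -
    have "?A = (\<Inter>k\<in>{..n}. {\<omega> \<in> space M. X i k \<omega> = y k})" by auto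
    also have "\<dots> \<in> sets ?H" by (intro sets.finite_INT history_algebra_X) auto
    finally show ?thesis .
  qed
  have "sigma_sets (space M) (graph_events M (walk_graph X i))
      \<subseteq> sigma_sets (space M) (graph_events M (walk_graph X i) \<union> path_events M {..n} (X i))"
    by (rule sigma_sets_subseteq) auto
  then have sub: "subalgebra ?H ?G"
    by (simp only: subalgebra_def space_measure_of_conv sets_measure_of[OF events_space(1)] sets_measure_of[OF Un_least[OF events_space]] simp_thms)
  have [measurable]: "?s \<in> borel_measurable ?G"
    by (intro borel_measurable_step_prob graph_algebra_snd)
  have int: "integrable M (\<lambda>\<omega>. indicator ?A \<omega> * indicator ?B \<omega> :: real)"
    by (intro integrable_real_mult_indicator) (auto intro!: integrable_real_indicator simp: emeasure_eq_measure)
  have 1: "AE \<omega> in M. real_cond_exp M ?G (\<lambda>\<omega>. indicator ?A \<omega> * indicator ?B \<omega>) \<omega> =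
      real_cond_exp M ?G (real_cond_exp M ?H (\<lambda>\<omega>. indicator ?A \<omega> * indicator ?B \<omega>)) \<omega>"
    by (rule AE_symmetric[OF G.real_cond_exp_nested_subalg[OF H.subalg sub int]])
  have "AE \<omega> in M. real_cond_exp M ?H (\<lambda>\<omega>. indicator ?A \<omega> * indicator ?B \<omega>) \<omega> = 
      indicator ?A \<omega> * real_cond_exp M ?H (indicator ?B) \<omega>"
    by (rule H.real_cond_exp_mult[OF borel_measurable_indicator[OF A] _ int]) simp
  moreover have "AE \<omega> in M. real_cond_exp M ?H (indicator ?B) \<omega> =
      step_prob (p (enat i)) (walk_graph X i \<omega>) (X i n \<omega>) (y (Suc n))"
    using walk[of i] unfolding random_walk_on_def cond_prob_def by blast
  \<comment> \<open>On \<open>?A\<close> the random position \<open>X i n\<close> is the fixed site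
    \<open>y n\<close>, which makes the factor a function of the graph alone.\<close>
  ultimately have 2: "AE \<omega> in M. real_cond_exp M ?H (\<lambda>\<omega>. indicator ?A \<omega> * indicator ?B \<omega>) \<omega> = ?s \<omega> * indicator ?A \<omega>"
    by eventually_elim (auto simp: indicator_def)
  have 3: "AE \<omega> in M. real_cond_exp M ?G (real_cond_exp M ?H (\<lambda>\<omega>. indicator ?A \<omega> * indicator ?B \<omega>)) \<omega> =
      real_cond_exp M ?G (\<lambda>\<omega>. ?s \<omega> * indicator ?A \<omega>) \<omega>"
    by (rule G.real_cond_exp_cong[OF 2]) simp_all
  have [simp]: "integrable M (\<lambda>\<omega>. ?s \<omega> * indicator ?A \<omega>)"
    by (rule integrable_cong_AE_imp[OF H.real_cond_exp_int(1)[OF int] _ 2]) simp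
  have 4: "AE \<omega> in M. real_cond_exp M ?G (\<lambda>\<omega>. ?s \<omega> * indicator ?A \<omega>) \<omega> =
      ?s \<omega> * real_cond_exp M ?G (indicator ?A) \<omega>"
    by (rule G.real_cond_exp_mult) simp_all
  have 5: "(\<lambda>\<omega>. indicator ?A \<omega> * indicator ?B \<omega> :: real) = indicator {\<omega> \<in> space M. \<forall>k\<le>Suc n. X i k \<omega> = y k}"
    by (auto simp: fun_eq_iff indicator_def le_Suc_eq)
  show ?case
    using 1 3 4 Suc.IH unfolding 5 cond_prob_def
    by eventually_elim (auto simp: path_weight_def)
qed

lemma path_weight_measurable [measurable]:
  "(\<lambda>\<omega>. path_weight q (walk_graph X i \<omega>) y n) \<in> borel_measurable M"
  by (simp add: path_weight_def)

text \<open>This is where conditional independence enters: given the graph, an event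
  \<open>b\<close> of the earlier walks does not affect the law of the path, so
  \<open>path_weight\<close> can be integrated over \<open>b\<close>.\<close>

lemma prob_follow:
  assumes b: "b \<in> sets (past i)" and y: "y 0 = 0"
  shows "integrable M (\<lambda>\<omega>. path_weight (p (enat i)) (walk_graph X i \<omega>) y n * indicator b \<omega>)"
    and "prob (b \<inter> {\<omega> \<in> space M. \<forall>k\<le>n. X i k \<omega> = y k}) =
      (\<integral>\<omega>. path_weight (p (enat i)) (walk_graph X i \<omega>) y n * indicator b \<omega> \<partial>M)"
proof -
  let ?G = "graph_algebra i" and ?a = "{\<omega> \<in> space M. \<forall>k\<le>n. X i k \<omega> = y k}"
  let ?w = "\<lambda>\<omega>. path_weight (p (enat i)) (walk_graph X i \<omega>) y n"
  interpret G: sigma_finite_subalgebra M ?G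
    by (intro sigma_subalg graph_events_sub)
  have [measurable]: "b \<in> sets M" using b by (rule past_sets)
  have a: "?a \<in> sets (sigma (space M) (path_events M UNIV (X i)))"
  proof -
    have "?a = (\<Inter>k\<in>{..n}. {\<omega> \<in> space M. X i k \<omega> = y k})" by auto
    also have "\<dots> \<in> sets (sigma (space M) (path_events M UNIV (X i)))"
      by (intro sets.finite_INT in_measure_of events_space) (auto simp: path_events_def)
    finally show ?thesis .
  qed
  have "AE \<omega> in M. cond_prob M ?G (?a \<inter> b) \<omega> = cond_prob M ?G ?a \<omega> * cond_prob M ?G b \<omega>"
    using indep[of i] a b unfolding cond_indep_def past_def by blast
  then have eq: "AE \<omega> in M. real_cond_exp M ?G (indicator (?a \<inter> b)) \<omega> = ?w \<omega> * real_cond_exp M ?G (indicator b) \<omega>"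
    using cond_prob_follow[of i n y] by eventually_elim (simp add: cond_prob_def y)
  have wG [measurable]: "?w \<in> borel_measurable ?G"
    unfolding path_weight_def by (intro borel_measurable_prod borel_measurable_step_prob graph_algebra_snd)
  have i1: "integrable M (indicator (?a \<inter> b) :: 'a \<Rightarrow> real)"
    by (intro integrable_real_indicator) (auto simp: emeasure_eq_measure)
  have "AE \<omega> in M. norm (?w \<omega> * indicator b \<omega>) \<le> 1"
    by (simp add: indicator_def path_weight_nonneg path_weight_le_1[OF steps])
  then show int: "integrable M (\<lambda>\<omega>. ?w \<omega> * indicator b \<omega>)"
    by (intro integrable_const_bound) auto
  have "prob (b \<inter> ?a) = (\<integral>\<omega>. indicator (?a \<inter> b) \<omega> \<partial>M)"
    by (simp add: Int_commute)
  also have "\<dots> = (\<integral>\<omega>. real_cond_exp M ?G (indicator (?a \<inter> b)) \<omega> \<partial>M)"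
    using G.real_cond_exp_int(2)[OF i1] by simp
  also have "\<dots> = (\<integral>\<omega>. ?w \<omega> * real_cond_exp M ?G (indicator b) \<omega> \<partial>M)"
    using eq by (intro integral_cong_AE) auto
  also have "\<dots> = (\<integral>\<omega>. ?w \<omega> * indicator b \<omega> \<partial>M)"
    using int by (intro G.real_cond_exp_intg(2)) auto
  finally show "prob (b \<inter> ?a) = (\<integral>\<omega>. ?w \<omega> * indicator b \<omega> \<partial>M)" .
qed

end

section \<open>Escape probabilities on electrical networks\<close>

text \<open>Swapping \<open>x\<close> and \<open>y\<close> changes the sign of the flow
  \<open>w x y * (h x - h y)\<close>. The sums run over ordered pairs, which is the source of the
  factor 2. The inner sum is the Laplacian of the whole graph only at vertices with all neighbours
  in \<open>V\<close>.\<close>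

lemma green_identity:
  fixes w :: "'v \<Rightarrow> 'v \<Rightarrow> real"
  assumes sym: "\<And>x y. w x y = w y x"
  shows "(\<Sum>x\<in>V. \<Sum>y\<in>V. w x y * (h x - h y) * (f x - f y)) =
    2 * (\<Sum>x\<in>V. f x * (\<Sum>y\<in>V. w x y * (h x - h y)))"
proof -
  have "(\<Sum>x\<in>V. \<Sum>y\<in>V. w x y * (h x - h y) * f y) = (\<Sum>x\<in>V. \<Sum>y\<in>V. w y x * (h y - h x) * f x)"
    by (rule sum.swap)
  also have "\<dots> = - (\<Sum>x\<in>V. \<Sum>y\<in>V. w x y * (h x - h y) * f x)"
    unfolding sum_negf[symmetric] by (intro sum.cong refl) (simp add: sym[of _ "_ :: 'v"] algebra_simps)
  finally have "(\<Sum>x\<in>V. \<Sum>y\<in>V. w x y * (h x - h y) * f y) = - (\<Sum>x\<in>V. \<Sum>y\<in>V. w x y * (h x - h y) * f x)" .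
  moreover have "(\<Sum>x\<in>V. \<Sum>y\<in>V. w x y * (h x - h y) * (f x - f y)) =
     (\<Sum>x\<in>V. \<Sum>y\<in>V. w x y * (h x - h y) * f x) - (\<Sum>x\<in>V. \<Sum>y\<in>V. w x y * (h x - h y) * f y)"
    by (simp only: right_diff_distrib[of "_ * _"] sum_subtractf)
  moreover have "(\<Sum>x\<in>V. \<Sum>y\<in>V. w x y * (h x - h y) * f x) = (\<Sum>x\<in>V. f x * (\<Sum>y\<in>V. w x y * (h x - h y)))"
    by (simp only: sum_distrib_left mult.commute[of "f _"])
  ultimately show ?thesis by simp
qed

text \<open>The chosen edges are no loops and are distinct as unordered pairs, so their two
  orientations are different terms of the double sum; the remaining terms are nonnegative.\<close>

lemma energy_lower_bound:
  fixes w :: "'v \<Rightarrow> 'v \<Rightarrow> real"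
  assumes fin: "finite V" "finite I" and sym: "\<And>x y. w x y = w y x" and nonneg: "\<And>x y. 0 \<le> w x y"
    and V: "\<And>i. i \<in> I \<Longrightarrow> a i \<in> V \<and> b i \<in> V \<and> a i \<noteq> b i"
    and inj: "inj_on (\<lambda>i. {a i, b i}) I"
  shows "2 * (\<Sum>i\<in>I. w (a i) (b i) * (h (a i) - h (b i))\<^sup>2) \<le>
    (\<Sum>x\<in>V. \<Sum>y\<in>V. w x y * (h x - h y) * (h x - h y))"
proof -
  let ?g = "\<lambda>(x, y). w x y * (h x - h y)\<^sup>2"
  have swap: "?g (y, x) = ?g (x, y)" for x y
    by (simp add: sym[of x y] power2_commute[of "h x"])
  have inj1: "inj_on (\<lambda>i. (a i, b i)) I" and inj2: "inj_on (\<lambda>i. (b i, a i)) I"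
    using inj by (auto simp: inj_on_def insert_commute)
  have disj: "(\<lambda>i. (a i, b i)) ` I \<inter> (\<lambda>i. (b i, a i)) ` I = {}"
  proof -
    have False if "i \<in> I" "j \<in> I" "a i = b j" "b i = a j" for i j
    proof -
      have "i = j" using inj that by (auto simp: inj_on_def insert_commute)
      then show False using V[OF that(1)] that by auto
    qed
    then show ?thesis by auto
  qed
  have "2 * (\<Sum>i\<in>I. ?g (a i, b i)) = sum ?g ((\<lambda>i. (a i, b i)) ` I) + sum ?g ((\<lambda>i. (b i, a i)) ` I)"
    unfolding sum.reindex[OF inj1] sum.reindex[OF inj2] o_def swap[of "a _"] by simp
  also have "\<dots> = sum ?g ((\<lambda>i. (a i, b i)) ` I \<union> (\<lambda>i. (b i, a i)) ` I)"
    using disj fin by (intro sum.union_disjoint[symmetric]) auto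
  also have "\<dots> \<le> sum ?g (V \<times> V)"
    using V fin nonneg by (intro sum_mono2) auto
  also have "\<dots> = (\<Sum>x\<in>V. \<Sum>y\<in>V. w x y * (h x - h y) * (h x - h y))"
    by (simp add: sum.cartesian_product power2_eq_square mult.assoc)
  finally show ?thesis by simp
qed

definition ip :: "real ^ 'd::finite \<Rightarrow> int ^ 'd \<Rightarrow> real" where
  "ip l x = (\<Sum>j\<in>UNIV. l $ j * real_of_int (x $ j))"

lemma ip_add: "ip l (x + y) = ip l x + ip l y"
  by (simp add: ip_def algebra_simps sum.distrib)

lemma ip_minus: "ip l (- x) = - ip l x"
  by (simp add: ip_def sum_negf)

lemma ip_zero [simp]: "ip l 0 = 0"
  by (simp add: ip_def)

lemma ip_axis [simp]: "ip l (axis j 1) = l $ j"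
  by (simp add: ip_def axis_def if_distrib cong: if_cong)

lemma directions_uminus [simp]: "- e \<in> directions \<longleftrightarrow> e \<in> directions"
  by (auto simp: directions_def) (metis minus_minus)+

lemma directions_diff: "x - y \<in> directions \<longleftrightarrow> y - x \<in> directions"
  using directions_uminus[of "x - y"] by simp

lemma zero_notin_directions [simp]: "0 \<notin> directions"
  by (auto simp: directions_def axis_eq_0_iff)

definition is_lattice :: "('d::finite) graph \<Rightarrow> bool" where
  "is_lattice G \<longleftrightarrow> (\<forall>x y. {x, y} \<in> snd G \<longrightarrow> y - x \<in> directions)"

text \<open>The conductance \<open>c(x, y)\<close> of the paper, read off from \<open>x\<close> instead of \<open>x \<or> y\<close>.\<close>

definition cc :: "(int ^ 'd::finite) pmf \<Rightarrow> int ^ 'd \<Rightarrow> int ^ 'd \<Rightarrow> real" where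
  "cc q x y = pmf q (y - x) * exp (ip (ell_hat q) x)"

definition gc :: "(int ^ 'd::finite) pmf \<Rightarrow> 'd graph \<Rightarrow> int ^ 'd \<Rightarrow> int ^ 'd \<Rightarrow> real" where
  "gc q G x y = (if {x, y} \<in> snd G then cc q x y else 0)"

text \<open>The probability, for the walk started at \<open>x\<close>, of avoiding \<open>U\<close> up to time \<open>n\<close>, where leaving
  \<open>A\<close> counts as a success.\<close>

fun esc :: "(int ^ 'd::finite) pmf \<Rightarrow> 'd graph \<Rightarrow> (int ^ 'd) set \<Rightarrow> (int ^ 'd) set \<Rightarrow> nat \<Rightarrow> int ^ 'd \<Rightarrow> real" where
  "esc q G A U 0 x = (if x \<in> U then 0 else 1)"
| "esc q G A U (Suc n) x = (if x \<in> U then 0 else if x \<in> A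
     then (\<Sum>e\<in>directions. step_prob q G x (x + e) * esc q G A U n (x + e)) else 1)"

definition esc_lim :: "(int ^ 'd::finite) pmf \<Rightarrow> 'd graph \<Rightarrow> (int ^ 'd) set \<Rightarrow> (int ^ 'd) set \<Rightarrow> int ^ 'd \<Rightarrow> real" where
  "esc_lim q G A U x = lim (\<lambda>n. esc q G A U n x)"

lemma sum_step_prob_le_1: "(\<Sum>e\<in>directions. step_prob q G x (x + e)) \<le> 1"
proof -
  let ?S = "\<Sum>e | e \<in> directions \<and> {x, x + e} \<in> snd G. pmf q e"
  have "(\<Sum>e\<in>directions. step_prob q G x (x + e)) =
      (\<Sum>e | e \<in> directions \<and> {x, x + e} \<in> snd G. pmf q e / ?S)"
    by (subst sum.inter_filter) (auto simp: step_prob_def intro!: sum.cong)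
  also have "\<dots> = ?S / ?S" by (simp only: sum_divide_distrib)
  finally have "(\<Sum>e\<in>directions. step_prob q G x (x + e)) = ?S / ?S" .
  then show ?thesis by simp
qed

lemma esc_nonneg: "0 \<le> esc q G A U n x"
  by (induction n arbitrary: x) (auto intro!: sum_nonneg mult_nonneg_nonneg step_prob_nonneg)

lemma esc_le_1: "esc q G A U n x \<le> 1"
proof (induction n arbitrary: x)
  case (Suc n)
  have "(\<Sum>e\<in>directions. step_prob q G x (x + e) * esc q G A U n (x + e)) \<le> (\<Sum>e\<in>directions. step_prob q G x (x + e))"
    by (intro sum_mono mult_left_le Suc step_prob_nonneg)
  then show ?case using sum_step_prob_le_1[of q G x] by simp
qed simp

lemma esc_Suc_le: "esc q G A U (Suc n) x \<le> esc q G A U n x"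
proof (induction n arbitrary: x)
  case 0
  show ?case using esc_le_1[of q G A U "Suc 0" x] by (cases "x \<in> U") (simp, simp only: esc.simps(1) if_False)
next
  case (Suc n)
  show ?case
    using Suc unfolding esc.simps(2)[of q G A U "Suc n"] esc.simps(2)[of q G A U n x]
    by (auto intro!: sum_mono mult_left_mono step_prob_nonneg)
qed

lemma esc_tendsto: "(\<lambda>n. esc q G A U n x) \<longlonglongrightarrow> esc_lim q G A U x"
proof -
  have "decseq (\<lambda>n. esc q G A U n x)" using esc_Suc_le by (intro decseq_SucI)
  then have "convergent (\<lambda>n. esc q G A U n x)"
    using decseq_convergent[of "\<lambda>n. esc q G A U n x" 0] esc_nonneg convergentI by metis
  then show ?thesis unfolding esc_lim_def by (simp add: convergent_LIMSEQ_iff)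
qed

lemma esc_lim_le: "esc_lim q G A U x \<le> esc q G A U n x"
  using esc_Suc_le by (intro decseq_ge[OF decseq_SucI esc_tendsto]) 

lemma esc_lim_nonneg: "0 \<le> esc_lim q G A U x"
  by (rule LIMSEQ_le_const[OF esc_tendsto]) (simp add: esc_nonneg)

lemma esc_lim_le_1: "esc_lim q G A U x \<le> 1"
  using esc_lim_le[of q G A U x 0] esc_le_1[of q G A U 0 x] by linarith

lemma esc_lim_eq_0: "x \<in> U \<Longrightarrow> esc_lim q G A U x = 0"
  using esc_lim_le[of q G A U x 0] esc_lim_nonneg[of q G A U x] by simp

lemma esc_lim_eq_1: "x \<notin> U \<Longrightarrow> x \<notin> A \<Longrightarrow> esc_lim q G A U x = 1"
proof -
  assume "x \<notin> U" "x \<notin> A"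
  then have "esc q G A U n x = 1" for n by (cases n) auto
  then show ?thesis using LIMSEQ_unique[OF esc_tendsto, of q G A U x 1] by simp
qed

lemma esc_lim_harmonic:
  assumes "x \<in> A" "x \<notin> U"
  shows "esc_lim q G A U x = (\<Sum>e\<in>directions. step_prob q G x (x + e) * esc_lim q G A U (x + e))"
proof (rule LIMSEQ_unique)
  show "(\<lambda>n. esc q G A U (Suc n) x) \<longlonglongrightarrow> esc_lim q G A U x"
    by (intro LIMSEQ_Suc esc_tendsto)
  show "(\<lambda>n. esc q G A U (Suc n) x) \<longlonglongrightarrow> (\<Sum>e\<in>directions. step_prob q G x (x + e) * esc_lim q G A U (x + e))"
    using assms by (auto intro!: tendsto_intros esc_tendsto)
qed

text \<open>Only finitely many sites can be reached within \<open>n\<close> steps. This reduces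
  escape up to a fixed time on an infinite graph to a finite network.\<close>

lemma esc_UNIV_eq:
  "\<exists>A0. finite A0 \<and> (\<forall>A. A0 \<subseteq> A \<longrightarrow> esc q G A U n x = esc q G UNIV U n x)"
proof (induction n arbitrary: x)
  case 0
  show ?case by auto
next
  case (Suc n)
  then obtain F where F: "finite (F y)" "F y \<subseteq> A \<Longrightarrow> esc q G A U n y = esc q G UNIV U n y" for y A
    by metis
  show ?case
  proof (intro exI conjI allI impI)
    let ?A = "insert x (\<Union>e\<in>directions. F (x + e))"
    show "finite ?A" using F by auto
    fix A assume A: "?A \<subseteq> A"
    then have "esc q G A U n (x + e) = esc q G UNIV U n (x + e)" if "e \<in> directions" for e
      using F(2)[of "x + e" A] that by auto
    then show "esc q G A U (Suc n) x = esc q G UNIV U (Suc n) x"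
      using A by simp
  qed
qed

locale step_law =
  fixes q :: "(int ^ 'd::finite) pmf"
  assumes supp: "set_pmf q \<subseteq> directions"
    and pos: "\<And>e. e \<in> directions \<Longrightarrow> 0 < pmf q e"
begin

lemma cc_nonneg: "0 \<le> cc q x y"
  by (simp add: cc_def)

lemma cc_pos: "y - x \<in> directions \<Longrightarrow> 0 < cc q x y"
  using pos by (simp add: cc_def)

lemma exp_ell_hat: "exp (ell_hat q $ j) = pmf q (axis j 1) / pmf q (- axis j 1)"
proof -
  have "axis j 1 \<in> directions" "- axis j 1 \<in> directions"
    by (auto simp: directions_def)
  then show ?thesis using pos by (simp add: ell_hat_def)
qed

lemma exp_ip_direction: "e \<in> directions \<Longrightarrow> exp (ip (ell_hat q) e) = pmf q e / pmf q (- e)"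
  by (auto simp: directions_def ip_minus exp_minus exp_ell_hat field_simps)

text \<open>Reversibility: \<open>ell_hat\<close> consists of the logarithms of the ratios of
  opposite step probabilities, so moving the base point from \<open>x\<close> to \<open>y\<close>
  exchanges \<open>pmf q (y - x)\<close> for \<open>pmf q (x - y)\<close>. For non-neighbours both
  sides are 0.\<close>

lemma cc_sym: "cc q x y = cc q y x"
proof (cases "y - x \<in> directions")
  case True
  have "exp (ip (ell_hat q) y) = exp (ip (ell_hat q) x) * exp (ip (ell_hat q) (y - x))"
    unfolding exp_add[symmetric] ip_add[symmetric] by simp
  then have "exp (ip (ell_hat q) y) = exp (ip (ell_hat q) x) * (pmf q (y - x) / pmf q (x - y))"
    using exp_ip_direction[OF True] by simp
  moreover have "pmf q (x - y) > 0"
    using pos True directions_diff by blast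
  ultimately show ?thesis by (simp add: cc_def field_simps)
next
  case False
  then have "y - x \<notin> set_pmf q" "x - y \<notin> set_pmf q"
    using supp directions_diff by blast+
  then show ?thesis by (simp add: cc_def set_pmf_iff)
qed

lemma gc_sym: "gc q G x y = gc q G y x"
  by (simp add: gc_def cc_sym[of x y] insert_commute)

lemma gc_nonneg: "0 \<le> gc q G x y"
  by (simp add: gc_def cc_nonneg)

text \<open>The factor \<open>exp (ip (ell_hat q) x)\<close> is common to all edges at
  \<open>x\<close> and cancels, so the walk is the one with conductances \<open>gc\<close>. The
  multiplied form also covers a vertex without edges.\<close>

lemma step_prob_total:
  assumes V: "finite V" "\<And>y. {x, y} \<in> snd G \<Longrightarrow> y \<in> V" and G: "is_lattice G"
  shows "gc q G x y = step_prob q G x y * (\<Sum>z\<in>V. gc q G x z)"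
    and "(\<Sum>e\<in>directions. step_prob q G x (x + e) * h (x + e)) * (\<Sum>z\<in>V. gc q G x z) = (\<Sum>z\<in>V. gc q G x z * h z)"
proof -
  let ?D = "{e. e \<in> directions \<and> {x, x + e} \<in> snd G}"
  let ?S = "\<Sum>e\<in>?D. pmf q e"
  have reindex: "(\<Sum>z\<in>V. if {x, z} \<in> snd G then f z else 0) = (\<Sum>e\<in>?D. f (x + e))" for f :: "int ^ 'd \<Rightarrow> real"
  proof -
    have "(\<Sum>z\<in>V. if {x, z} \<in> snd G then f z else 0) = (\<Sum>z\<in>{z\<in>V. {x, z} \<in> snd G}. f z)"
      by (simp add: sum.inter_filter V)
    also have "\<dots> = (\<Sum>e\<in>?D. f (x + e))"
    proof (rule sum.reindex_bij_witness[of _ "\<lambda>e. x + e" "\<lambda>z. z - x"])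
      show "z - x \<in> ?D" if "z \<in> {z \<in> V. {x, z} \<in> snd G}" for z
        using that G unfolding is_lattice_def by auto
    qed (use V(2) in auto)
    finally show ?thesis .
  qed
  have tot: "(\<Sum>z\<in>V. gc q G x z) = ?S * exp (ip (ell_hat q) x)"
    unfolding gc_def reindex by (simp add: cc_def sum_distrib_right)
  show 1: "gc q G x y = step_prob q G x y * (\<Sum>z\<in>V. gc q G x z)" for y
  proof (cases "{x, y} \<in> snd G")
    case True
    then have "y - x \<in> ?D" using G by (auto simp: is_lattice_def)
    then have "0 < ?S"
      using pos by (intro sum_pos2[of ?D "y - x"]) simp_all
    then show ?thesis unfolding tot by (simp add: gc_def cc_def step_prob_def True)
  qed (simp add: gc_def step_prob_def)
  have "(\<Sum>e\<in>directions. step_prob q G x (x + e) * h (x + e)) * (\<Sum>z\<in>V. gc q G x z) =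
      (\<Sum>e\<in>directions. gc q G x (x + e) * h (x + e))"
    unfolding sum_distrib_right[of _ directions]
  proof (intro sum.cong refl)
    fix e
    show "step_prob q G x (x + e) * h (x + e) * (\<Sum>z\<in>V. gc q G x z) = gc q G x (x + e) * h (x + e)"
      by (subst 1[of "x + e"]) (simp only: mult_ac)
  qed
  also have "\<dots> = (\<Sum>e\<in>directions. if {x, x + e} \<in> snd G then cc q x (x + e) * h (x + e) else 0)"
    by (intro sum.cong) (auto simp: gc_def)
  also have "\<dots> = (\<Sum>e\<in>?D. cc q x (x + e) * h (x + e))"
    by (simp add: sum.inter_filter)
  also have "\<dots> = (\<Sum>z\<in>V. gc q G x z * h z)"
    by (subst reindex[of "\<lambda>z. cc q x z * h z", symmetric]) (intro sum.cong, auto simp: gc_def)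
  finally show "(\<Sum>e\<in>directions. step_prob q G x (x + e) * h (x + e)) * (\<Sum>z\<in>V. gc q G x z) = (\<Sum>z\<in>V. gc q G x z * h z)" .
qed

lemma esc_lim_laplace:
  assumes V: "finite V" "\<And>y. {x, y} \<in> snd G \<Longrightarrow> y \<in> V" and G: "is_lattice G"
    and x: "x \<in> A" "x \<notin> U"
  shows "(\<Sum>y\<in>V. gc q G x y * (esc_lim q G A U x - esc_lim q G A U y)) = 0"
proof -
  have "esc_lim q G A U x * (\<Sum>z\<in>V. gc q G x z) = (\<Sum>z\<in>V. gc q G x z * esc_lim q G A U z)"
    by (subst esc_lim_harmonic[OF x]) (rule step_prob_total(2)[OF V G])
  then show ?thesis
    by (simp add: right_diff_distrib sum_subtractf flip: sum_distrib_left) (simp add: mult.commute sum_distrib_right)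
qed

text \<open>With \<open>U = - B\<close> the value \<open>esc_lim\<close> is the probability of
  staying in \<open>B\<close> for ever. It is harmonic in \<open>B\<close> and 0 outside, so its
  Dirichlet energy is 0 and it is constant along every edge at \<open>B\<close>; the path
  \<open>Y\<close>, followed up to its first exit, carries the value 0 back to
  \<open>Y 0\<close>.\<close>

lemma esc_lim_confined:
  assumes G: "is_lattice G" and B: "finite B"
    and Y: "\<And>n. {Y n, Y (Suc n)} \<in> snd G" "Y m \<notin> B"
  shows "esc_lim q G UNIV (- B) (Y 0) = 0"
proof -
  let ?h = "esc_lim q G UNIV (- B)"
  let ?V = "B \<union> (\<Union>x\<in>B. (\<lambda>e. x + e) ` directions)"
  have V: "finite ?V" using B by auto
  have nb: "y \<in> ?V" if "x \<in> B" "{x, y} \<in> snd G" for x y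
  proof -
    have "y = x + (y - x)" "y - x \<in> directions" using that G by (auto simp: is_lattice_def)
    then show ?thesis using that by blast
  qed
  have "(\<Sum>x\<in>?V. \<Sum>y\<in>?V. gc q G x y * (?h x - ?h y) * (?h x - ?h y)) =
      2 * (\<Sum>x\<in>?V. ?h x * (\<Sum>y\<in>?V. gc q G x y * (?h x - ?h y)))"
    by (rule green_identity) (rule gc_sym)
  also have "(\<Sum>x\<in>?V. ?h x * (\<Sum>y\<in>?V. gc q G x y * (?h x - ?h y))) = 0"
  proof (intro sum.neutral ballI)
    fix x assume "x \<in> ?V"
    show "?h x * (\<Sum>y\<in>?V. gc q G x y * (?h x - ?h y)) = 0"
    proof (cases "x \<in> B")
      case True
      then show ?thesis using esc_lim_laplace[OF V nb[OF True] G, where A = UNIV and U = "- B"] by simp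
    qed (simp add: esc_lim_eq_0)
  qed
  finally have 0: "(\<Sum>x\<in>?V. \<Sum>y\<in>?V. gc q G x y * (?h x - ?h y) * (?h x - ?h y)) = 0" by simp
  have "gc q G x y * (?h x - ?h y) * (?h x - ?h y) = 0" if "x \<in> ?V" "y \<in> ?V" for x y
  proof -
    have nn: "0 \<le> gc q G x y * (?h x - ?h y) * (?h x - ?h y)" for x y
      by (simp add: gc_nonneg mult.assoc)
    have "(\<Sum>y\<in>?V. gc q G x y * (?h x - ?h y) * (?h x - ?h y)) = 0"
      using 0 that V by (subst (asm) sum_nonneg_eq_0_iff) (auto intro: sum_nonneg nn)
    then show ?thesis
      using that V by (subst (asm) sum_nonneg_eq_0_iff) (auto intro: nn)
  qed
  note Z = this
  have P: "0 < gc q G x y" if "{x, y} \<in> snd G" for x y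
    using that G cc_pos by (simp add: gc_def is_lattice_def)
  have eq: "?h x = ?h y" if "x \<in> B" "{x, y} \<in> snd G" for x y
  proof -
    have "gc q G x y * (?h x - ?h y) * (?h x - ?h y) = 0" "0 < gc q G x y"
      by (rule Z[OF UnI1[OF that(1)] nb[OF that]], rule P[OF that(2)])
    then show ?thesis by simp
  qed
  define t where "t = (LEAST m. Y m \<notin> B)"
  have less: "Y k \<in> B" if "k < t" for k
    using not_less_Least[of k "\<lambda>m. Y m \<notin> B"] that by (auto simp: t_def)
  have t: "Y t \<notin> B" using LeastI[of "\<lambda>m. Y m \<notin> B" m] Y(2) by (simp add: t_def)
  have "k \<le> t \<Longrightarrow> ?h (Y k) = ?h (Y 0)" for k
  proof (induction k)
    case (Suc k)
    then show ?case using eq[OF less Y(1), of k] by simp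
  qed simp
  from this[of t] show ?thesis using t by (simp add: esc_lim_eq_0)
qed

end

section \<open>Escape probabilities and resistances\<close>

lemma sum_squares_over_weights:
  fixes a c :: "'i \<Rightarrow> real"
  assumes "finite I" "\<And>i. i \<in> I \<Longrightarrow> 0 < c i"
  shows "(\<Sum>i\<in>I. a i)\<^sup>2 \<le> (\<Sum>i\<in>I. c i * (a i)\<^sup>2) * (\<Sum>i\<in>I. 1 / c i)"
proof -
  have "(\<Sum>i\<in>I. a i) = (\<Sum>i\<in>I. (sqrt (c i) * a i) * (1 / sqrt (c i)))"
    using assms by (intro sum.cong) (auto simp: less_imp_neq[symmetric])
  then have "(\<Sum>i\<in>I. a i)\<^sup>2 \<le> (\<Sum>i\<in>I. (sqrt (c i) * a i)\<^sup>2) * (\<Sum>i\<in>I. (1 / sqrt (c i))\<^sup>2)"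
    by (metis Cauchy_Schwarz_ineq_sum)
  also have "\<dots> = (\<Sum>i\<in>I. c i * (a i)\<^sup>2) * (\<Sum>i\<in>I. 1 / c i)"
    using assms by (simp add: power_mult_distrib power_divide less_imp_le)
  finally show ?thesis .
qed

text \<open>Loop erasure, by induction along the chain: a step to a vertex already on the list
  truncates the list there. Distinct vertices give distinct edges, as
  \<open>energy_lower_bound\<close> requires.\<close>

lemma rtranclp_distinct_list:
  assumes "r\<^sup>*\<^sup>* x y"
  obtains zs where "zs \<noteq> []" "hd zs = x" "last zs = y" "distinct zs" "\<And>k. Suc k < length zs \<Longrightarrow> r (zs ! k) (zs ! Suc k)"
proof -
  have "\<exists>zs. zs \<noteq> [] \<and> hd zs = x \<and> last zs = y \<and> distinct zs \<and> (\<forall>k. Suc k < length zs \<longrightarrow> r (zs ! k) (zs ! Suc k))"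
    using assms
  proof induction
    case base
    show ?case by (intro exI[of _ "[x]"]) auto
  next
    case (step y z)
    then obtain zs where zs: "zs \<noteq> []" "hd zs = x" "last zs = y" "distinct zs" 
      "\<And>k. Suc k < length zs \<Longrightarrow> r (zs ! k) (zs ! Suc k)" by blast
    show ?case
    proof (cases "z \<in> set zs")
      case True
      then obtain m where m: "m < length zs" "zs ! m = z" by (auto simp: in_set_conv_nth)
      show ?thesis
      proof (intro exI[of _ "take (Suc m) zs"] conjI allI impI)
        show "hd (take (Suc m) zs) = x" using zs by simp
        show "last (take (Suc m) zs) = z" using m by (simp add: take_Suc_conv_app_nth)
      qed (use zs m in auto)
    next
      case False
      show ?thesis
      proof (intro exI[of _ "zs @ [z]"] conjI allI impI)
        fix k assume "Suc k < length (zs @ [z])"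
        then have "Suc k < length zs \<or> Suc k = length zs" by auto
        then show "r ((zs @ [z]) ! k) ((zs @ [z]) ! Suc k)"
        proof
          assume "Suc k = length zs"
          then have "k = length zs - 1" by simp
          then show ?thesis using step(2) zs(1,3) by (simp add: nth_append last_conv_nth)
        qed (use zs(5)[of k] in \<open>simp add: nth_append\<close>)
      qed (use zs False in auto)
    qed
  qed
  then show ?thesis using that by blast
qed

text \<open>It is not demanded that \<open>{u, v}\<close> is an edge, so the property passes to
  every subgraph. That the edge is still there is shown separately in
  \<open>crossing_path\<close>.\<close>

definition boundary_edge :: "('d::finite) graph \<Rightarrow> (int ^ 'd) set \<Rightarrow> int ^ 'd \<Rightarrow> int ^ 'd \<Rightarrow> bool" where
  "boundary_edge G B u v \<longleftrightarrow> u \<in> B \<and> v \<notin> B \<and> (\<forall>a b. {a, b} \<in> snd G \<longrightarrow> a \<in> B \<longrightarrow> b \<notin> B \<longrightarrow> a = u \<and> b = v)"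

context step_law
begin

lemma finite_neighbours:
  assumes "is_lattice G" "finite A"
  obtains V where "finite V" "A \<subseteq> V" "\<And>x y. x \<in> A \<Longrightarrow> {x, y} \<in> snd G \<Longrightarrow> y \<in> V"
proof -
  let ?V = "A \<union> (\<Union>x\<in>A. (\<lambda>e. x + e) ` directions)"
  have "y \<in> ?V" if "x \<in> A" "{x, y} \<in> snd G" for x y
  proof -
    have "y = x + (y - x)" "y - x \<in> directions" using that assms by (auto simp: is_lattice_def)
    then show ?thesis using that by blast
  qed
  then show ?thesis using assms by (intro that[of ?V]) auto
qed

text \<open>Let \<open>h\<close> be the escape probability in a finite part \<open>A\<close> of the
  graph. Without the edges inside \<open>B\<close>, the energy of \<open>f = 1 - h\<close> is the
  flow \<open>cc q u v * h v\<close> through the cut edge. Along a self-avoiding path from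
  \<open>u\<close> out of \<open>A\<close> the value of \<open>f\<close> falls from 1 to 0, so by
  Cauchy-Schwarz this energy times the resistance of the path is at least 1. The path consists of
  distinct edges of the trace of \<open>x\<close>, hence its resistance is at most \<open>K\<close>,
  whichever subgraph \<open>G\<close> is.\<close>

lemma esc_lower_bound:
  assumes G: "is_lattice G" and B: "finite B" "boundary_edge G B u v" and uv: "{u, v} \<in> snd G"
    and Y: "\<And>n. {Y n, Y (Suc n)} \<in> snd G" "Y 0 \<in> B" "infinite (range Y)"
    and x: "snd G \<subseteq> range (\<lambda>n. {x n, x (Suc n)})" "\<And>n. x (Suc n) - x n \<in> directions"
    and K: "summable (\<lambda>n. 1 / cc q (x n) (x (Suc n)))" "(\<Sum>n. 1 / cc q (x n) (x (Suc n))) \<le> K"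
  shows "1 / (K * cc q u v) \<le> esc q G UNIV {u} n v"
proof -
  have uvB: "u \<in> B" "v \<notin> B" using B(2) by (auto simp: boundary_edge_def)
  have out: "a = u \<and> b = v" if "{a, b} \<in> snd G" "a \<in> B" "b \<notin> B" for a b
    using B(2) that by (auto simp: boundary_edge_def)
  obtain A where A: "finite A" "esc q G A {u} n v = esc q G UNIV {u} n v"
    using esc_UNIV_eq[of q G "{u}" n v] by blast
  define h where "h = esc_lim q G A {u}"
  have h0: "h u = 0" and h1: "z \<notin> A \<Longrightarrow> z \<noteq> u \<Longrightarrow> h z = 1" for z
    by (simp_all add: h_def esc_lim_eq_0 esc_lim_eq_1)
  have hv: "h v \<le> esc q G UNIV {u} n v"
    using esc_lim_le[of q G A "{u}" v n] A by (simp add: h_def)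
  let ?r = "\<lambda>a b. {a, b} \<in> snd G \<and> b \<notin> B"
  obtain t where t: "Y t \<notin> A \<union> B"
    using Y(3) A B finite_subset[of "range Y" "A \<union> B"] by auto
  \<comment> \<open>The last visit to \<open>B\<close> up to time \<open>t\<close>. It takes place
    at \<open>u\<close>, and from there on the path avoids \<open>B\<close>.\<close>
  define s where "s = (GREATEST k. k \<le> t \<and> Y k \<in> B)"
  have s: "s \<le> t \<and> Y s \<in> B" and gr: "k \<le> t \<Longrightarrow> Y k \<in> B \<Longrightarrow> k \<le> s" for k
    using GreatestI_nat[of "\<lambda>k. k \<le> t \<and> Y k \<in> B" 0 t] Greatest_le_nat[of "\<lambda>k. k \<le> t \<and> Y k \<in> B" k t] Y(2)
    by (auto simp: s_def)
  have "?r\<^sup>*\<^sup>* u (Y k)" if "s \<le> k" "k \<le> t" for k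
    using that
  proof (induction k rule: dec_induct)
    case base
    have "s \<noteq> t" using s t by auto
    then have "Y s = u" using out[OF Y(1)[of s]] s gr[of "Suc s"] by force
    then show ?case by simp
  next
    case (step k)
    then have "Y (Suc k) \<notin> B" using gr[of "Suc k"] by auto
    then show ?case using step Y(1)[of k] by (auto intro: rtranclp.rtrancl_into_rtrancl)
  qed
  then have "?r\<^sup>*\<^sup>* u (Y t)" using s by simp
  then obtain zs where zs: "zs \<noteq> []" "hd zs = u" "last zs = Y t" "distinct zs"
    "\<And>k. Suc k < length zs \<Longrightarrow> ?r (zs ! k) (zs ! Suc k)"
    by (rule rtranclp_distinct_list) blast
  define I where "I = {k. Suc k < length zs}"
  have I': "I = {..<length zs - 1}" by (auto simp: I_def)
  then have I: "finite I" by simp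
  have zB: "zs ! Suc k \<notin> B" "{zs ! k, zs ! Suc k} \<in> snd G" if "k \<in> I" for k
    using zs(5)[of k] that by (auto simp: I_def)
  obtain V0 where V0: "finite V0" "A \<subseteq> V0" "\<And>x y. x \<in> A \<Longrightarrow> {x, y} \<in> snd G \<Longrightarrow> y \<in> V0"
    using finite_neighbours[OF G A(1)] by blast
  define V where "V = V0 \<union> {u, v} \<union> set zs"
  have V: "finite V" "A \<subseteq> V" "u \<in> V" "v \<in> V" "set zs \<subseteq> V" "\<And>x y. x \<in> A \<Longrightarrow> {x, y} \<in> snd G \<Longrightarrow> y \<in> V"
    using V0 by (auto simp: V_def)
  \<comment> \<open>Once the edges inside \<open>B\<close> are deleted, \<open>{u, v}\<close> is the
    only edge left at \<open>u\<close>.\<close>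
  define w where "w = (\<lambda>a b. if a \<in> B \<and> b \<in> B then 0 else gc q G a b)"
  have w_sym: "w a b = w b a" and w_nonneg: "0 \<le> w a b" for a b
    using gc_sym gc_nonneg by (auto simp: w_def)
  \<comment> \<open>Apart from \<open>u\<close>, the function \<open>f\<close> vanishes off
    \<open>A\<close>, where \<open>h\<close> need not be harmonic; so \<open>u\<close> alone
    contributes to Green's identity.\<close>
  define f where "f = (\<lambda>z. 1 - h z)"
  have lap: "f z * (\<Sum>y\<in>V. w z y * (f z - f y)) = (if z = u then cc q u v * h v else 0)" if "z \<in> V" for z
  proof -
    consider "z = u" | "z \<noteq> u" "z \<notin> A" | "z \<noteq> u" "z \<in> A" "z \<in> B" | "z \<noteq> u" "z \<in> A" "z \<notin> B" by blast
    then show ?thesis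
    proof cases
      case 1
      have "(\<Sum>y\<in>V. w u y * (f u - f y)) = (\<Sum>y\<in>{v}. w u y * (f u - f y))"
      proof (rule sum.mono_neutral_right)
        have "w u y = 0" if "y \<noteq> v" for y
          using out[of u y] uvB that by (simp add: w_def gc_def) blast
        then show "\<forall>y\<in>V - {v}. w u y * (f u - f y) = 0" by simp
      qed (use V in auto)
      then show ?thesis using 1 h0 uvB uv by (simp add: f_def w_def gc_def)
    next
      case 2
      then show ?thesis using h1 by (simp add: f_def)
    next
      case 3
      then have "w z y = 0" for y
        using out[of z y] by (auto simp: w_def gc_def)
      then show ?thesis using 3 by simp
    next
      case 4
      have "(\<Sum>y\<in>V. w z y * (f z - f y)) = - (\<Sum>y\<in>V. gc q G z y * (h z - h y))"
        using 4 unfolding sum_negf[symmetric] by (intro sum.cong) (auto simp: w_def f_def algebra_simps)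
      also have "\<dots> = 0"
        unfolding h_def using 4 V by (subst esc_lim_laplace) (auto intro: G)
      finally show ?thesis using 4 by simp
    qed
  qed
  have "2 * (\<Sum>k\<in>I. w (zs ! k) (zs ! Suc k) * (f (zs ! k) - f (zs ! Suc k))\<^sup>2) \<le>
     (\<Sum>x\<in>V. \<Sum>y\<in>V. w x y * (f x - f y) * (f x - f y))"
  proof (rule energy_lower_bound[OF V(1) I w_sym w_nonneg])
    show "zs ! k \<in> V \<and> zs ! Suc k \<in> V \<and> zs ! k \<noteq> zs ! Suc k" if "k \<in> I" for k
      using that V(5) zs(4) by (auto simp: I_def nth_eq_iff_index_eq subset_iff)
    show inj: "inj_on (\<lambda>k. {zs ! k, zs ! Suc k}) I"
      using zs(4) by (auto simp: inj_on_def I_def doubleton_eq_iff nth_eq_iff_index_eq)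
  qed
  also have "\<dots> = 2 * (\<Sum>x\<in>V. f x * (\<Sum>y\<in>V. w x y * (f x - f y)))"
    by (rule green_identity) (rule w_sym)
  also have "(\<Sum>x\<in>V. f x * (\<Sum>y\<in>V. w x y * (f x - f y))) = cc q u v * h v"
    using V by (simp add: lap)
  finally have energy: "(\<Sum>k\<in>I. w (zs ! k) (zs ! Suc k) * (f (zs ! k) - f (zs ! Suc k))\<^sup>2) \<le> cc q u v * h v"
    by simp
  have w_eq: "w (zs ! k) (zs ! Suc k) = cc q (zs ! k) (zs ! Suc k)" if "k \<in> I" for k
    using zB[OF that] by (simp add: w_def gc_def)
  have w_pos: "0 < w (zs ! k) (zs ! Suc k)" if "k \<in> I" for k
    using w_eq[OF that] zB[OF that] G cc_pos by (simp add: is_lattice_def)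
  have "(\<Sum>k\<in>I. f (zs ! k) - f (zs ! Suc k)) = f (zs ! 0) - f (zs ! (length zs - 1))"
    unfolding I' by (rule sum_lessThan_telescope')
  also have "\<dots> = 1"
  proof -
    have "h (Y t) = 1" using t uvB by (intro h1) auto
    then show ?thesis
      using zs(1-3) h0 by (simp add: f_def hd_conv_nth last_conv_nth)
  qed
  finally have "1 \<le> (\<Sum>k\<in>I. w (zs ! k) (zs ! Suc k) * (f (zs ! k) - f (zs ! Suc k))\<^sup>2) * (\<Sum>k\<in>I. 1 / w (zs ! k) (zs ! Suc k))"
    using sum_squares_over_weights[OF I w_pos, where a = "\<lambda>k. f (zs ! k) - f (zs ! Suc k)"] by simp
  also have "\<dots> \<le> cc q u v * h v * K"
  proof (intro mult_mono energy)
    \<comment> \<open>Each edge of the path is charged to one index at which \<open>x\<close>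
      traverses it, and different edges get different indices. The resistance of the path is thus a
      partial sum of the series bounded by \<open>K\<close>.\<close>
    define E where "E = (\<lambda>n. {x n, x (Suc n)})"
    let ?g = "\<lambda>k. inv E {zs ! k, zs ! Suc k}"
    have gE: "E (?g k) = {zs ! k, zs ! Suc k}" if "k \<in> I" for k
    proof (rule f_inv_into_f)
      show "{zs ! k, zs ! Suc k} \<in> range E" using subsetD[OF x(1) zB(2)[OF that]] unfolding E_def .
    qed
    have g: "{x (?g k), x (Suc (?g k))} = {zs ! k, zs ! Suc k}" if "k \<in> I" for k
      using gE[OF that] unfolding E_def .
    have "inj_on ?g I"
    proof (rule inj_onI)
      fix j k assume jk: "j \<in> I" "k \<in> I" "?g j = ?g k"
      have "{zs ! j, zs ! Suc j} = {zs ! k, zs ! Suc k}" using gE[OF jk(1)] gE[OF jk(2)] unfolding jk(3) by (simp only:)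
      then show "j = k" using zs(4) jk(1,2)
        by (auto simp: inj_on_def I_def doubleton_eq_iff nth_eq_iff_index_eq)
    qed
    then have "(\<Sum>k\<in>I. 1 / w (zs ! k) (zs ! Suc k)) = (\<Sum>n\<in>?g ` I. 1 / cc q (x n) (x (Suc n)))"
    proof (subst sum.reindex, simp, intro sum.cong refl)
      fix k assume k: "k \<in> I"
      have "cc q (x (?g k)) (x (Suc (?g k))) = cc q (zs ! k) (zs ! Suc k)"
        using g[OF k] unfolding doubleton_eq_iff
      proof (elim disjE conjE)
        assume "x (?g k) = zs ! Suc k" "x (Suc (?g k)) = zs ! k"
        then show ?thesis by (simp only: cc_sym[of "zs ! k"])
      qed (simp only:)
      then show "1 / w (zs ! k) (zs ! Suc k) = ((\<lambda>n. 1 / cc q (x n) (x (Suc n))) \<circ> ?g) k"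
        by (simp only: w_eq[OF k] o_def)
    qed
    also have "\<dots> \<le> (\<Sum>n. 1 / cc q (x n) (x (Suc n)))"
      by (intro sum_le_suminf K(1)) (auto simp: I cc_nonneg)
    finally show "(\<Sum>k\<in>I. 1 / w (zs ! k) (zs ! Suc k)) \<le> K" using K(2) by simp
  qed (auto intro!: mult_nonneg_nonneg sum_nonneg simp: cc_nonneg h_def esc_lim_nonneg w_nonneg)
  finally have 1: "1 \<le> cc q u v * h v * K" .
  have c: "0 < cc q u v" using uv G cc_pos by (simp add: is_lattice_def)
  have "0 \<le> K"
    using suminf_nonneg[OF K(1)] K(2) cc_nonneg by (simp add: order_trans)
  then have "0 < K" using 1 by (cases "K = 0") auto
  then have "1 / (K * cc q u v) \<le> h v"
    using 1 c by (simp add: divide_le_eq mult_ac)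
  then show ?thesis using hv by simp
qed

text \<open>Kirchhoff's law: the only edge at \<open>e\<close> leads to 0, so the current
  \<open>J = cc q 0 e * h 0\<close> of the potential \<open>h\<close> passes unchanged through every
  cut edge. The energies of these edges add up to \<open>J\<^sup>2\<close> times their resistance,
  and the total energy in \<open>V\<close> is \<open>h (b m) * J\<close>, which is at most
  \<open>J\<close> because \<open>h\<close> is a probability.\<close>

lemma esc_upper_bound:
  assumes G: "is_lattice G" and e: "{e, 0} \<in> snd G" "\<And>z. {e, z} \<in> snd G \<Longrightarrow> z = 0"
    and I: "finite I" "m \<in> I"
    and B: "\<And>l. l \<in> I \<Longrightarrow> finite (B l) \<and> e \<in> B l \<and> boundary_edge G (B l) (a l) (b l) \<and> b l - a l \<in> directions"
    and Bm: "\<And>l. l \<in> I \<Longrightarrow> B l \<subseteq> B m" "\<And>l. l \<in> I \<Longrightarrow> b l \<in> insert (b m) (B m)" "0 \<in> B m"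
    and inj: "inj_on (\<lambda>l. {a l, b l}) I"
  shows "cc q 0 e * esc_lim q G UNIV {e} 0 \<le> 1 / (\<Sum>l\<in>I. 1 / cc q (a l) (b l))"
proof -
  define h where "h = esc_lim q G UNIV {e}"
  have h: "h e = 0" "0 \<le> h z" "h z \<le> 1" for z
    by (simp_all add: h_def esc_lim_eq_0 esc_lim_nonneg esc_lim_le_1)
  \<comment> \<open>The vertex \<open>b m\<close> is added as the far end of the flow; within
    \<open>V\<close> it has edges to \<open>B m\<close> only.\<close>
  define V where "V = insert (b m) (B m)"
  have out: "x = a l \<and> y = b l" if "l \<in> I" "{x, y} \<in> snd G" "x \<in> B l" "y \<notin> B l" for l x y
    using B[of l] that by (auto simp: boundary_edge_def)
  have ab: "a l \<in> B l" "b l \<notin> B l" if "l \<in> I" for l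
    using B[OF that] by (auto simp: boundary_edge_def)
  have V: "finite V" "0 \<in> V" "e \<in> V" using B[OF I(2)] Bm(3) by (auto simp: V_def)
  have "e \<noteq> 0" using e G zero_notin_directions unfolding is_lattice_def by (metis diff_self)
  define L where "L = (\<lambda>x. \<Sum>y\<in>V. gc q G x y * (h x - h y))"
  define J where "J = cc q 0 e * h 0"
  have J: "0 \<le> J" by (simp add: J_def cc_nonneg h)
  have Le: "L e = - J"
  proof -
    have "L e = (\<Sum>y\<in>{0}. gc q G e y * (h e - h y))"
      unfolding L_def using V e(2) by (intro sum.mono_neutral_right) (auto simp: gc_def)
    also have "\<dots> = - J"
      using e(1) by (simp add: gc_def h J_def cc_sym[of e 0])
    finally show ?thesis .
  qed
  have L0: "L x = 0" if "x \<in> B m" "x \<noteq> e" for x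
    unfolding L_def h_def
    by (rule esc_lim_laplace[OF V(1) _ G]) (use out[OF I(2), of x] that in \<open>auto simp: V_def\<close>)
  have bm: "b m \<notin> B m" "b m \<noteq> e" using ab[OF I(2)] B[OF I(2)] by auto
  have split: "(\<Sum>x\<in>V. f x * L x) = f (b m) * L (b m) - f e * J" for f
  proof -
    have "(\<Sum>x\<in>V. f x * L x) = (\<Sum>x\<in>{b m, e}. f x * L x)"
      using V L0 by (intro sum.mono_neutral_right) (auto simp: V_def)
    then show ?thesis using bm by (simp add: Le)
  qed
  have green: "(\<Sum>x\<in>V. \<Sum>y\<in>V. gc q G x y * (h x - h y) * (f x - f y)) = 2 * (\<Sum>x\<in>V. f x * L x)" for f
    unfolding L_def by (rule green_identity) (rule gc_sym)
  \<comment> \<open>Testing with the constant 1 shows that the flows at the two ends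
    \<open>e\<close> and \<open>b m\<close> balance.\<close>
  have Lbm: "L (b m) = J"
    using green[of "\<lambda>_. 1"] split[of "\<lambda>_. 1"] by simp
  have flow: "gc q G (a l) (b l) * (h (b l) - h (a l)) = J" if l: "l \<in> I" for l
  proof -
    \<comment> \<open>Testing with the indicator of the complement of \<open>B l\<close> leaves only
      the two orientations of the edge that crosses the boundary of \<open>B l\<close>.\<close>
    let ?f = "\<lambda>x. if x \<in> B l then 0 else 1 :: real"
    let ?g = "\<lambda>(x, y). gc q G x y * (h x - h y) * (?f x - ?f y)"
    have "sum ?g (V \<times> V) = sum ?g {(a l, b l), (b l, a l)}"
    proof (rule sum.mono_neutral_right)
      show "{(a l, b l), (b l, a l)} \<subseteq> V \<times> V"
        using Bm(1,2)[OF l] ab[OF l] by (auto simp: V_def)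
      have z0: "gc q G x y * (h x - h y) * (?f x - ?f y) = 0" if "(x, y) \<noteq> (a l, b l)" "(x, y) \<noteq> (b l, a l)" for x y
      proof (rule ccontr)
        assume "gc q G x y * (h x - h y) * (?f x - ?f y) \<noteq> 0"
        then have "{x, y} \<in> snd G" "{y, x} \<in> snd G" "(x \<in> B l \<and> y \<notin> B l) \<or> (y \<in> B l \<and> x \<notin> B l)"
          by (auto simp: gc_def insert_commute split: if_splits)
        then show False using out[OF l] that by blast
      qed
      show "\<forall>i\<in>V \<times> V - {(a l, b l), (b l, a l)}. ?g i = 0"
      proof
        fix i assume i: "i \<in> V \<times> V - {(a l, b l), (b l, a l)}"
        obtain x y where xy: "i = (x, y)" by (cases i)
        then have "(x, y) \<noteq> (a l, b l)" "(x, y) \<noteq> (b l, a l)" using i by simp_all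
        then show "?g i = 0" unfolding xy prod.case by (rule z0)
      qed
    qed (use V in simp)
    also have "\<dots> = 2 * (gc q G (a l) (b l) * (h (b l) - h (a l)))"
    proof -
      have "a l \<noteq> b l" using ab[OF l] by auto
      then show ?thesis
        using ab[OF l] by (simp add: gc_sym[of G "b l" "a l"] algebra_simps)
    qed
    finally have "2 * (gc q G (a l) (b l) * (h (b l) - h (a l))) = 2 * (\<Sum>x\<in>V. ?f x * L x)"
      using green[of ?f] by (simp add: sum.cartesian_product)
    also have "\<dots> = 2 * J"
      using split[of ?f] Bm(1)[OF l] bm B[OF l] by (auto simp: Lbm)
    finally show ?thesis by simp
  qed
  have "2 * (\<Sum>l\<in>I. gc q G (a l) (b l) * (h (a l) - h (b l))\<^sup>2) \<le>
      (\<Sum>x\<in>V. \<Sum>y\<in>V. gc q G x y * (h x - h y) * (h x - h y))"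
  proof (rule energy_lower_bound[OF V(1) I(1) gc_sym gc_nonneg _ inj])
    show "a l \<in> V \<and> b l \<in> V \<and> a l \<noteq> b l" if "l \<in> I" for l
      using Bm(1,2)[OF that] ab[OF that] by (auto simp: V_def)
  qed
  also have "\<dots> = 2 * (h (b m) * J)"
    unfolding green split by (simp add: Lbm h)
  also have "\<dots> \<le> 2 * J"
    using mult_right_mono[OF h(3)[of "b m"] J] by simp
  finally have energy: "(\<Sum>l\<in>I. gc q G (a l) (b l) * (h (a l) - h (b l))\<^sup>2) \<le> J" by simp
  have cpos: "0 < cc q (a l) (b l)" if "l \<in> I" for l
    using B[OF that] cc_pos by blast
  have S: "0 < (\<Sum>l\<in>I. 1 / cc q (a l) (b l))"
    using cpos I by (intro sum_pos) auto
  show ?thesis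
  proof (cases "J = 0")
    case True
    then have "cc q 0 e * esc_lim q G UNIV {e} 0 = 0" by (simp only: J_def h_def)
    then show ?thesis using S by (simp only:) simp
  next
    case False
    have "gc q G (a l) (b l) * (h (a l) - h (b l))\<^sup>2 = J\<^sup>2 * (1 / cc q (a l) (b l))" if "l \<in> I" for l
    proof -
      \<comment> \<open>A nonzero flow through the cut edge proves that the edge is present in
        \<open>G\<close>.\<close>
      have "gc q G (a l) (b l) \<noteq> 0" using flow[OF that] False by auto
      then have "gc q G (a l) (b l) = cc q (a l) (b l)" by (auto simp: gc_def split: if_splits)
      then have "cc q (a l) (b l) * (h (b l) - h (a l)) = J" using flow[OF that] by simp
      then have "h (b l) - h (a l) = J / cc q (a l) (b l)" using cpos[OF that] by (simp add: field_simps)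
      then have "(h (a l) - h (b l))\<^sup>2 = (J / cc q (a l) (b l))\<^sup>2"
        by (simp only: power2_commute[of "h (a l)"])
      then show ?thesis
        using \<open>gc q G (a l) (b l) = cc q (a l) (b l)\<close> cpos[OF that]
        by (simp add: power_divide power2_eq_square)
    qed
    then have "J\<^sup>2 * (\<Sum>l\<in>I. 1 / cc q (a l) (b l)) \<le> J"
      using energy by (simp add: sum_distrib_left)
    then have "J * (\<Sum>l\<in>I. 1 / cc q (a l) (b l)) \<le> 1"
      using False J by (simp add: power2_eq_square mult.assoc)
    then have "J \<le> 1 / (\<Sum>l\<in>I. 1 / cc q (a l) (b l))"
      using S by (simp add: field_simps)
    then show ?thesis by (simp add: J_def h_def)
  qed
qed

end

lemma is_lattice_lattice_graph: "is_lattice lattice_graph"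
  using directions_diff
  by (auto simp: is_lattice_def lattice_graph_def doubleton_eq_iff)

section \<open>Transfer of escape probabilities to the walks\<close>

context nested_walks
begin

lemma esc_measurable [measurable]:
  "(\<lambda>\<omega>. esc q (walk_graph X i \<omega>) A U n x) \<in> borel_measurable M"
  by (induction n arbitrary: x) simp_all

lemma esc_lim_measurable [measurable]:
  "(\<lambda>\<omega>. esc_lim q (walk_graph X i \<omega>) A U x) \<in> borel_measurable M"
  by (rule borel_measurable_LIMSEQ_real[where u = "\<lambda>n \<omega>. esc q (walk_graph X i \<omega>) A U n x"])
    (auto simp: esc_tendsto)

lemma snd_walk_graph_antimono:
  assumes "\<forall>i n. {X i n \<omega>, X i (Suc n) \<omega>} \<in> snd (walk_graph X i \<omega>)" and "i \<le> j"
  shows "snd (walk_graph X j \<omega>) \<subseteq> snd (walk_graph X i \<omega>)"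
  using assms(2)
proof (induction j rule: dec_induct)
  case (step j)
  have "snd (walk_graph X (Suc j) \<omega>) \<subseteq> snd (walk_graph X j \<omega>)"
    using assms(1) by (auto simp: trace_graph_def)
  then show ?case using step by blast
qed simp

lemma is_lattice_walk_graph:
  assumes "\<forall>i n. {X i n \<omega>, X i (Suc n) \<omega>} \<in> snd (walk_graph X i \<omega>)"
  shows "is_lattice (walk_graph X i \<omega>)"
  using snd_walk_graph_antimono[OF assms, of 0 i] is_lattice_lattice_graph
  by (auto simp: is_lattice_def)

text \<open>Markov property, integrated over an event of the past. The induction on \<open>n\<close>
  splits according to the step at time \<open>m\<close> and absorbs it into the prescribed path,
  which is why \<open>m\<close> and \<open>y\<close> are generalised.\<close>

lemma prob_follow_avoid:
  assumes b: "b \<in> sets (past i)" and y: "y 0 = 0"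
  shows "prob (b \<inter> {\<omega> \<in> space M. (\<forall>k\<le>m. X i k \<omega> = y k) \<and> (\<forall>k\<in>{m..m + n}. X i k \<omega> \<notin> U)}) =
    (\<integral>\<omega>. path_weight (p (enat i)) (walk_graph X i \<omega>) y m * esc (p (enat i)) (walk_graph X i \<omega>) UNIV U n (y m) * indicator b \<omega> \<partial>M)"
  using y
proof (induction n arbitrary: m y)
  case 0
  show ?case
  proof (cases "y m \<in> U")
    case True
    then have E: "{\<omega> \<in> space M. (\<forall>k\<le>m. X i k \<omega> = y k) \<and> (\<forall>k\<in>{m..m + 0}. X i k \<omega> \<notin> U)} = {}" by force
    show ?thesis unfolding E using True by simp
  next
    case False
    then have "{\<omega> \<in> space M. (\<forall>k\<le>m. X i k \<omega> = y k) \<and> (\<forall>k\<in>{m..m + 0}. X i k \<omega> \<notin> U)} =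
      {\<omega> \<in> space M. \<forall>k\<le>m. X i k \<omega> = y k}" by auto
    then show ?thesis using False prob_follow(2)[OF b, of y m] 0 by simp
  qed
next
  case (Suc n)
  have [measurable]: "b \<in> sets M" by (rule past_sets[OF b])
  show ?case
  proof (cases "y m \<in> U")
    case True
    then have E: "{\<omega> \<in> space M. (\<forall>k\<le>m. X i k \<omega> = y k) \<and> (\<forall>k\<in>{m..m + Suc n}. X i k \<omega> \<notin> U)} = {}" by force
    show ?thesis unfolding E using True by simp
  next
    case False
    let ?q = "p (enat i)"
    let ?E = "\<lambda>y m n. {\<omega> \<in> space M. (\<forall>k\<le>m. X i k \<omega> = y k) \<and> (\<forall>k\<in>{m..m + n}. X i k \<omega> \<notin> U)}"
    let ?y = "\<lambda>e. y(Suc m := y m + e)"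
    have E [measurable]: "?E y m n \<in> sets M" for y m n by measurable
    have E_Suc: "\<omega> \<in> ?E (?y e) (Suc m) n \<longleftrightarrow> \<omega> \<in> ?E y m (Suc n) \<and> X i (Suc m) \<omega> = y m + e" for e \<omega>
    proof -
      have "(\<forall>k\<le>Suc m. X i k \<omega> = ?y e k) \<longleftrightarrow> (\<forall>k\<le>m. X i k \<omega> = y k) \<and> X i (Suc m) \<omega> = y m + e"
        by (auto simp: le_Suc_eq)
      moreover have "{m..m + Suc n} = insert m {Suc m..Suc m + n}" by auto
      ultimately show ?thesis using False by auto
    qed
    have "AE \<omega> in M. \<omega> \<in> b \<inter> ?E y m (Suc n) \<longleftrightarrow> \<omega> \<in> (\<Union>e\<in>directions. b \<inter> ?E (?y e) (Suc m) n)"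
      using AE_walk_edge
    proof eventually_elim
      case (elim \<omega>)
      have "X i (Suc m) \<omega> - X i m \<omega> \<in> directions"
        using is_lattice_walk_graph[OF elim, of i] elim by (auto simp: is_lattice_def)
      then have "\<omega> \<in> ?E y m (Suc n) \<Longrightarrow> \<exists>e\<in>directions. X i (Suc m) \<omega> = y m + e"
        by (intro bexI[of _ "X i (Suc m) \<omega> - X i m \<omega>"]) auto
      then show ?case unfolding UN_iff Int_iff E_Suc by blast
    qed
    then have "prob (b \<inter> ?E y m (Suc n)) = prob (\<Union>e\<in>directions. b \<inter> ?E (?y e) (Suc m) n)"
      by (intro finite_measure_eq_AE) auto
    also have "\<dots> = (\<Sum>e\<in>directions. prob (b \<inter> ?E (?y e) (Suc m) n))"
    proof (rule finite_measure_finite_Union)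
      show "disjoint_family_on (\<lambda>e. b \<inter> ?E (?y e) (Suc m) n) directions"
        unfolding disjoint_family_on_def E_Suc[abs_def] using E_Suc by force
    qed auto
    also have "\<dots> = (\<Sum>e\<in>directions. (\<integral>\<omega>. path_weight ?q (walk_graph X i \<omega>) (?y e) (Suc m) * esc ?q (walk_graph X i \<omega>) UNIV U n (?y e (Suc m)) * indicator b \<omega> \<partial>M))"
      using Suc.prems by (intro sum.cong refl Suc.IH) simp
    also have "\<dots> = (\<integral>\<omega>. (\<Sum>e\<in>directions. path_weight ?q (walk_graph X i \<omega>) (?y e) (Suc m) * esc ?q (walk_graph X i \<omega>) UNIV U n (?y e (Suc m)) * indicator b \<omega>) \<partial>M)"
    proof (rule Bochner_Integration.integral_sum[symmetric])
      fix e
      show "integrable M (\<lambda>\<omega>. path_weight ?q (walk_graph X i \<omega>) (?y e) (Suc m) * esc ?q (walk_graph X i \<omega>) UNIV U n (?y e (Suc m)) * indicator b \<omega>)"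
        by (rule integrable_const_bound[of _ 1])
          (auto simp: abs_mult path_weight_nonneg esc_nonneg intro!: mult_le_one path_weight_le_1[OF steps] esc_le_1 mult_nonneg_nonneg)
    qed
    also have "\<dots> = (\<integral>\<omega>. path_weight ?q (walk_graph X i \<omega>) y m * esc ?q (walk_graph X i \<omega>) UNIV U (Suc n) (y m) * indicator b \<omega> \<partial>M)"
    proof (intro Bochner_Integration.integral_cong refl)
      fix \<omega>
      have "path_weight ?q (walk_graph X i \<omega>) (?y e) (Suc m) =
          path_weight ?q (walk_graph X i \<omega>) y m * step_prob ?q (walk_graph X i \<omega>) (y m) (y m + e)" for e
        by (simp add: path_weight_def)
      then show "(\<Sum>e\<in>directions. path_weight ?q (walk_graph X i \<omega>) (?y e) (Suc m) * esc ?q (walk_graph X i \<omega>) UNIV U n (?y e (Suc m)) * indicator b \<omega>) =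
         path_weight ?q (walk_graph X i \<omega>) y m * esc ?q (walk_graph X i \<omega>) UNIV U (Suc n) (y m) * indicator b \<omega>"
        using False by (simp add: sum_distrib_left sum_distrib_right mult_ac)
    qed
    finally show ?thesis .
  qed
qed

lemma prob_avoid:
  assumes b: "b \<in> sets (past i)"
  shows "prob (b \<inter> {\<omega> \<in> space M. \<forall>k\<le>n. X i k \<omega> \<notin> U}) =
    (\<integral>\<omega>. esc (p (enat i)) (walk_graph X i \<omega>) UNIV U n 0 * indicator b \<omega> \<partial>M)"
proof -
  have [measurable]: "b \<in> sets M" by (rule past_sets[OF b])
  have "prob (b \<inter> {\<omega> \<in> space M. \<forall>k\<le>n. X i k \<omega> \<notin> U}) =
      prob (b \<inter> {\<omega> \<in> space M. (\<forall>k\<le>0. X i k \<omega> = 0) \<and> (\<forall>k\<in>{0..0 + n}. X i k \<omega> \<notin> U)})"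
  proof (rule finite_measure_eq_AE)
    show "AE \<omega> in M. \<omega> \<in> b \<inter> {\<omega> \<in> space M. \<forall>k\<le>n. X i k \<omega> \<notin> U} \<longleftrightarrow>
        \<omega> \<in> b \<inter> {\<omega> \<in> space M. (\<forall>k\<le>0. X i k \<omega> = 0) \<and> (\<forall>k\<in>{0..0 + n}. X i k \<omega> \<notin> U)}"
      using AE_walk_0 by eventually_elim auto
  qed measurable
  also have "\<dots> = (\<integral>\<omega>. esc (p (enat i)) (walk_graph X i \<omega>) UNIV U n 0 * indicator b \<omega> \<partial>M)"
    by (subst prob_follow_avoid[OF b, of "\<lambda>_. 0"]) (simp_all add: path_weight_def)
  finally show ?thesis .
qed

lemma prob_avoid_forever:
  assumes b: "b \<in> sets (past i)"
  shows "prob (b \<inter> {\<omega> \<in> space M. \<forall>k. X i k \<omega> \<notin> U}) \<le>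
    (\<integral>\<omega>. esc_lim (p (enat i)) (walk_graph X i \<omega>) UNIV U 0 * indicator b \<omega> \<partial>M)"
proof (rule LIMSEQ_le_const)
  have [measurable]: "b \<in> sets M" by (rule past_sets[OF b])
  show "(\<lambda>n. \<integral>\<omega>. esc (p (enat i)) (walk_graph X i \<omega>) UNIV U n 0 * indicator b \<omega> \<partial>M) \<longlonglongrightarrow>
      (\<integral>\<omega>. esc_lim (p (enat i)) (walk_graph X i \<omega>) UNIV U 0 * indicator b \<omega> \<partial>M)"
    by (rule integral_dominated_convergence[where w = "\<lambda>_. 1"])
      (auto intro!: tendsto_intros esc_tendsto mult_le_one esc_le_1 simp: abs_mult esc_nonneg)
  have "prob (b \<inter> {\<omega> \<in> space M. \<forall>k. X i k \<omega> \<notin> U}) \<le> prob (b \<inter> {\<omega> \<in> space M. \<forall>k\<le>n. X i k \<omega> \<notin> U})" for n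
    by (intro finite_measure_mono) auto
  then show "\<exists>N. \<forall>n\<ge>N. prob (b \<inter> {\<omega> \<in> space M. \<forall>k. X i k \<omega> \<notin> U}) \<le>
      (\<integral>\<omega>. esc (p (enat i)) (walk_graph X i \<omega>) UNIV U n 0 * indicator b \<omega> \<partial>M)"
    unfolding prob_avoid[OF b] by blast
qed

definition regular :: "'a \<Rightarrow> bool" where
  "regular \<omega> \<longleftrightarrow> (\<forall>i. X i 0 \<omega> = 0) \<and> (\<forall>i n. {X i n \<omega>, X i (Suc n) \<omega>} \<in> snd (walk_graph X i \<omega>)) \<and>
     (\<forall>i. infinite (range (\<lambda>n. X i n \<omega>)))"

text \<open>A walk cannot stay in a finite set as long as its graph contains an infinite path from
  0, by \<open>esc_lim_confined\<close>. From the second walk on, the preceding walk is such a path,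
  hence the induction.\<close>

lemma AE_infinite_range:
  assumes pos: "\<And>i e. e \<in> directions \<Longrightarrow> 0 < pmf (p (enat i)) e"
  shows "AE \<omega> in M. infinite (range (\<lambda>n. X i n \<omega>))"
proof (induction i)
  have leave: "AE \<omega> in M. infinite (range (\<lambda>n. X i n \<omega>))"
    if Y: "AE \<omega> in M. \<exists>Y. Y 0 = 0 \<and> (\<forall>n. {Y n, Y (Suc n)} \<in> snd (walk_graph X i \<omega>)) \<and> infinite (range Y)" for i
  proof -
    interpret step_law "p (enat i)"
      using steps pos by unfold_locales auto
    \<comment> \<open>Finite sets are represented by lists, of which there are countably many, so
      that the null sets can be united.\<close>
    have "AE \<omega> in M. \<exists>k. X i k \<omega> \<notin> set l" for l
    proof -
      have b: "space M \<in> sets (past i)" using sets.top[of "past i"] by simp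
      have "AE \<omega> in M. esc_lim (p (enat i)) (walk_graph X i \<omega>) UNIV (- set l) 0 * indicator (space M) \<omega> = 0"
        using Y AE_walk_edge
      proof eventually_elim
        case (elim \<omega>)
        then obtain Y where Y: "Y 0 = 0" "\<And>n. {Y n, Y (Suc n)} \<in> snd (walk_graph X i \<omega>)" "infinite (range Y)"
          by blast
        then obtain m where m: "Y m \<notin> set l"
          using finite_subset[of "range Y" "set l"] by auto
        have "esc_lim (p (enat i)) (walk_graph X i \<omega>) UNIV (- set l) (Y 0) = 0"
          by (rule esc_lim_confined[where Y = Y and m = m])
            (use Y \<open>Y m \<notin> set l\<close> is_lattice_walk_graph[OF elim(2)] in simp_all)
        then show ?case by (simp add: Y(1))
      qed
      then have "(\<integral>\<omega>. esc_lim (p (enat i)) (walk_graph X i \<omega>) UNIV (- set l) 0 * indicator (space M) \<omega> \<partial>M) = 0"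
        by (rule integral_eq_zero_AE)
      then have "prob (space M \<inter> {\<omega> \<in> space M. \<forall>k. X i k \<omega> \<notin> - set l}) \<le> 0"
        using prob_avoid_forever[OF b, of "- set l"] by simp
      then have "prob {\<omega> \<in> space M. \<forall>k. X i k \<omega> \<in> set l} = 0"
        using measure_nonneg[of M "{\<omega> \<in> space M. \<forall>k. X i k \<omega> \<in> set l}"] 
        by (simp add: Int_absorb1 Collect_restrict)
      then have "AE \<omega> in M. \<omega> \<notin> {\<omega> \<in> space M. \<forall>k. X i k \<omega> \<in> set l}"
        by (subst (asm) prob_eq_0) auto
      then show ?thesis using AE_space by eventually_elim auto
    qed
    then have "AE \<omega> in M. \<forall>l. \<exists>k. X i k \<omega> \<notin> set l"
      by (simp add: AE_all_countable)
    then show ?thesis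
    proof eventually_elim
      case (elim \<omega>)
      show ?case
      proof
        assume "finite (range (\<lambda>n. X i n \<omega>))"
        then obtain l where "set l = range (\<lambda>n. X i n \<omega>)" using finite_list by blast
        then show False using elim by blast
      qed
    qed
  qed
  {
    case 0
    \<comment> \<open>On the full lattice a half-line along an arbitrary axis serves as the infinite
      path.\<close>
    let ?Y = "\<lambda>n. axis undefined (int n) :: int ^ 'd"
    have "{?Y n, ?Y (Suc n)} \<in> snd lattice_graph" for n
    proof -
      have "?Y (Suc n) = ?Y n + axis undefined 1" by (simp add: vec_eq_iff axis_def)
      then show ?thesis by (auto simp: lattice_graph_def directions_def)
    qed
    moreover have "inj ?Y" by (auto simp: inj_on_def axis_eq_axis)
    then have "infinite (range ?Y)" using finite_imageD by blast
    ultimately show ?case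
      by (intro leave AE_I2 exI[of _ ?Y]) (auto simp: axis_eq_0_iff)
  next
    case (Suc i)
    then have "AE \<omega> in M. \<exists>Y. Y 0 = 0 \<and> (\<forall>n. {Y n, Y (Suc n)} \<in> snd (walk_graph X (Suc i) \<omega>)) \<and> infinite (range Y)"
      using AE_walk_0
    proof eventually_elim
      case (elim \<omega>)
      then show ?case by (intro exI[of _ "\<lambda>n. X i n \<omega>"]) (auto simp: trace_graph_def)
    qed
    then show ?case by (rule leave)
  }
qed

lemma AE_regular:
  assumes pos: "\<And>i e. e \<in> directions \<Longrightarrow> 0 < pmf (p (enat i)) e"
  shows "AE \<omega> in M. regular \<omega>"
proof -
  have "AE \<omega> in M. \<forall>i. infinite (range (\<lambda>n. X i n \<omega>))"
    unfolding AE_all_countable by (intro allI AE_infinite_range pos)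
  then show ?thesis
    using AE_walk_0 AE_walk_edge by eventually_elim (simp add: regular_def)
qed

lemma regularD:
  assumes "regular \<omega>"
  shows "X i 0 \<omega> = 0" "{X i n \<omega>, X i (Suc n) \<omega>} \<in> snd (walk_graph X i \<omega>)" "infinite (range (\<lambda>n. X i n \<omega>))"
    "is_lattice (walk_graph X i \<omega>)" "X i (Suc n) \<omega> - X i n \<omega> \<in> directions"
    "i \<le> j \<Longrightarrow> snd (walk_graph X j \<omega>) \<subseteq> snd (walk_graph X i \<omega>)"
proof -
  show 1: "X i 0 \<omega> = 0" "{X i n \<omega>, X i (Suc n) \<omega>} \<in> snd (walk_graph X i \<omega>)" "infinite (range (\<lambda>n. X i n \<omega>))"
    using assms unfolding regular_def by blast+
  show 2: "is_lattice (walk_graph X i \<omega>)"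
    using assms unfolding regular_def by (intro is_lattice_walk_graph) blast
  show "X i (Suc n) \<omega> - X i n \<omega> \<in> directions"
    using 1(2) 2 unfolding is_lattice_def by blast
  show "i \<le> j \<Longrightarrow> snd (walk_graph X j \<omega>) \<subseteq> snd (walk_graph X i \<omega>)"
    using assms unfolding regular_def by (intro snd_walk_graph_antimono) blast+
qed

end

section \<open>Telescoping of the resistance of the cut edges\<close>

text \<open>The expectation of \<open>f\<close> over a list of \<open>n\<close> independent steps with law \<open>q\<close>.\<close>

fun avg :: "(int ^ 'd::finite) pmf \<Rightarrow> nat \<Rightarrow> ((int ^ 'd) list \<Rightarrow> real) \<Rightarrow> real" where
  "avg q 0 f = f []"
| "avg q (Suc n) f = (\<Sum>e\<in>directions. pmf q e * avg q n (\<lambda>w. f (e # w)))"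

abbreviation words :: "nat \<Rightarrow> (int ^ 'd::finite) list set" where
  "words n \<equiv> {w. set w \<subseteq> directions \<and> length w = n}"

lemma finite_words [simp]: "finite (words n)"
  by (rule finite_lists_length_eq) simp

lemma avg_eq_sum:
  fixes q :: "(int ^ 'd::finite) pmf"
  shows "avg q n f = (\<Sum>w\<in>words n. prod_list (map (pmf q) w) * f w)"
proof (induction n arbitrary: f)
  case 0
  have "words 0 = {[] :: (int ^ 'd) list}" by auto
  then show ?case by simp
next
  case (Suc n)
  have inj: "inj_on (\<lambda>(e, w). e # w) ((directions :: (int ^ 'd) set) \<times> words n)"
    by (auto simp: inj_on_def)
  have "(words (Suc n) :: (int ^ 'd) list set) = (\<lambda>(e, w). e # w) ` (directions \<times> words n)"
  proof (intro equalityI subsetI)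
    fix w :: "(int ^ 'd) list" assume "w \<in> words (Suc n)"
    then show "w \<in> (\<lambda>(e, w). e # w) ` (directions \<times> words n)"
      by (cases w) (auto intro!: image_eqI[of _ _ "(hd w, tl w)"])
  qed auto
  then have "(\<Sum>w\<in>words (Suc n). prod_list (map (pmf q) w) * f w) =
      (\<Sum>(e, w)\<in>directions \<times> words n. pmf q e * (prod_list (map (pmf q) w) * f (e # w)))"
    by (simp only: sum.reindex[OF inj]) (intro sum.cong, auto)
  then show ?case
    by (simp add: Suc sum.cartesian_product[symmetric] sum_distrib_left)
qed

lemma prod_list_pmf_nonneg: "0 \<le> prod_list (map (pmf q) w)"
  by (induction w) auto

lemma avg_cong: "(\<And>w. w \<in> words n \<Longrightarrow> f w = g w) \<Longrightarrow> avg q n f = avg q n g"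
  unfolding avg_eq_sum by (intro sum.cong) auto

lemma avg_mono: "(\<And>w. w \<in> words n \<Longrightarrow> f w \<le> g w) \<Longrightarrow> avg q n f \<le> avg q n g"
  unfolding avg_eq_sum by (intro sum_mono mult_left_mono prod_list_pmf_nonneg) auto

lemma avg_add: "avg q n (\<lambda>w. f w + g w) = avg q n f + avg q n g"
  unfolding avg_eq_sum by (simp add: distrib_left sum.distrib)

lemma avg_scale: "avg q n (\<lambda>w. c * f w) = c * avg q n f"
  unfolding avg_eq_sum by (simp add: sum_distrib_left mult_ac)

lemma avg_sum: "avg q n (\<lambda>w. \<Sum>i\<in>I. f i w) = (\<Sum>i\<in>I. avg q n (f i))"
  unfolding avg_eq_sum by (simp add: sum_distrib_left sum.swap[of _ I])

lemma avg_append: "avg q (m + n) f = avg q m (\<lambda>u. avg q n (\<lambda>v. f (u @ v)))"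
  by (induction m arbitrary: f) simp_all

text \<open>Weights of words are invariant under reversal. This will turn the condition
  \<open>bwd\<close> on the past into the survival event of \<open>gambler\<close>.\<close>

lemma avg_rev:
  fixes q :: "(int ^ 'd::finite) pmf"
  shows "avg q n (\<lambda>w. f (rev w)) = avg q n f"
proof -
  have "(\<Sum>w\<in>words n. prod_list (map (pmf q) w) * f (rev w)) =
      (\<Sum>w\<in>words n. prod_list (map (pmf q) w) * f w)"
  proof (rule sum.reindex_bij_witness[of _ rev rev])
    fix w :: "(int ^ 'd) list"
    have "prod_list (map (pmf q) (rev w)) = prod_list (map (pmf q) w)"
      by (induction w) (simp_all add: mult.commute)
    then show "prod_list (map (pmf q) (rev w)) * f (rev w) = prod_list (map (pmf q) w) * f (rev w)"
      by simp
  qed auto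
  then show ?thesis by (simp add: avg_eq_sum)
qed

lemma sum_pmf_directions: "set_pmf q \<subseteq> directions \<Longrightarrow> (\<Sum>e\<in>directions. pmf q e) = 1"
  by (rule sum_pmf_eq_1) auto

lemma avg_const: "set_pmf q \<subseteq> directions \<Longrightarrow> avg q n (\<lambda>_. c) = c"
  by (induction n) (simp_all add: sum_distrib_right[symmetric] sum_pmf_directions)

definition level :: "'d::finite \<Rightarrow> (int ^ 'd) list \<Rightarrow> int" where
  "level k w = sum_list w $ k"

text \<open>In terms of the walk with increments \<open>w\<close>: \<open>bwd\<close> means that it
  ends at a maximum of its level, \<open>fwd\<close> that it stays strictly above its starting
  level. Expressed on words, the two halves of a cut involve disjoint, hence independent, sets of
  steps.\<close>

definition bwd :: "'d::finite \<Rightarrow> (int ^ 'd) list \<Rightarrow> bool" where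
  "bwd k w \<longleftrightarrow> (\<forall>j\<le>length w. 0 \<le> level k (drop j w))"

definition fwd :: "'d::finite \<Rightarrow> (int ^ 'd) list \<Rightarrow> bool" where
  "fwd k w \<longleftrightarrow> w \<noteq> [] \<and> (\<forall>j\<in>{1..length w}. 0 < level k (take j w))"

definition lcut :: "'d::finite \<Rightarrow> (int ^ 'd) list \<Rightarrow> nat \<Rightarrow> bool" where
  "lcut k w n \<longleftrightarrow> n < length w \<and> bwd k (take n w) \<and> fwd k (drop n w)"

lemma level_append [simp]: "level k (u @ v) = level k u + level k v"
  by (simp add: level_def)

lemma level_Nil [simp]: "level k [] = 0"
  by (simp add: level_def)

lemma level_Cons [simp]: "level k (e # w) = e $ k + level k w"
  by (simp add: level_def)

text \<open>If the junction is itself a cut, the prefix cannot spoil a later cut: each suffix of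
  \<open>u\<close> has nonnegative level, and so has \<open>take m v\<close>.\<close>

lemma lcut_append:
  assumes bwd: "bwd k u" and fwd: "fwd k v"
  shows "lcut k (u @ v) (length u + m) \<longleftrightarrow> lcut k v m"
proof (cases "m < length v")
  case True
  have lev: "0 \<le> level k (take j v)" if "j \<le> length v" for j
    using fwd that by (cases "j = 0") (auto simp: fwd_def less_imp_le)
  have "bwd k (u @ take m v) \<longleftrightarrow> bwd k (take m v)"
  proof
    assume l: "bwd k (u @ take m v)"
    show "bwd k (take m v)"
      unfolding bwd_def
    proof (intro allI impI)
      fix j assume "j \<le> length (take m v)"
      then show "0 \<le> level k (drop j (take m v))"
        using l[unfolded bwd_def, rule_format, of "length u + j"] by simp
    qed
  next
    assume r: "bwd k (take m v)"
    show "bwd k (u @ take m v)"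
      unfolding bwd_def
    proof (intro allI impI)
      fix j assume j: "j \<le> length (u @ take m v)"
      show "0 \<le> level k (drop j (u @ take m v))"
      proof (cases "j \<le> length u")
        case True
        then show ?thesis using bwd lev[of m] \<open>m < length v\<close> by (auto simp: bwd_def)
      next
        case False
        moreover have "j - length u \<le> length (take m v)" using j \<open>m < length v\<close> by simp
        ultimately show ?thesis using r[unfolded bwd_def, rule_format, of "j - length u"] by simp
      qed
    qed
  qed
  then show ?thesis using True by (simp add: lcut_def)
qed (simp add: lcut_def)

text \<open>The total resistance of the cut edges from time \<open>n\<close> on, in units of a cut edge at the origin;
  the last term stands for an additional edge at the end, so that every tail is positive.\<close>

definition ztot :: "real ^ 'd::finite \<Rightarrow> 'd \<Rightarrow> (int ^ 'd) list \<Rightarrow> nat \<Rightarrow> real" where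
  "ztot l k w n = (\<Sum>m\<in>{n..<length w}. if lcut k w m then exp (- ip l (sum_list (take m w))) else 0) +
     exp (- ip l (sum_list w))"

lemma ztot_pos: "0 < ztot l k w n"
  unfolding ztot_def by (intro add_nonneg_pos sum_nonneg) auto

text \<open>At a cut the tail of the series is a translate of the whole series of \<open>v\<close>:
  the cut times shift by \<open>length u\<close> and a common exponential factors out.\<close>

lemma ztot_append:
  assumes "bwd k u" "fwd k v"
  shows "ztot l k (u @ v) (length u) = exp (- ip l (sum_list u)) * ztot l k v 0"
proof -
  have "(\<Sum>m\<in>{length u..<length (u @ v)}. if lcut k (u @ v) m then exp (- ip l (sum_list (take m (u @ v)))) else 0) =
      (\<Sum>m\<in>{0..<length v}. if lcut k (u @ v) (length u + m) then exp (- ip l (sum_list (take (length u + m) (u @ v)))) else 0)"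
    by (rule sum.reindex_bij_witness[of _ "\<lambda>m. length u + m" "\<lambda>m. m - length u"]) auto
  also have "\<dots> = (\<Sum>m\<in>{0..<length v}. exp (- ip l (sum_list u)) * (if lcut k v m then exp (- ip l (sum_list (take m v))) else 0))"
    using assms by (intro sum.cong refl) (simp add: lcut_append ip_add exp_add[symmetric])
  finally show ?thesis
    by (simp add: ztot_def sum_distrib_left[symmetric] distrib_left ip_add exp_add[symmetric])
qed

text \<open>Since \<open>fwd k v\<close> says that time 0 is a cut of \<open>v\<close>, this is the
  reciprocal resistance as seen from a cut.\<close>

definition zinv :: "real ^ 'd::finite \<Rightarrow> 'd \<Rightarrow> (int ^ 'd) list \<Rightarrow> real" where
  "zinv l k v = (if fwd k v then 1 / ztot l k v 0 else 0)"

text \<open>The logarithms of the tails of the resistance series telescope along the cut times.\<close>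

lemma sum_zinv_le:
  "(\<Sum>n<length w. (if bwd k (take n w) then 1 else 0) * zinv l k (drop n w)) \<le> ln (ztot l k w 0) + ip l (sum_list w)"
proof -
  have "(if bwd k (take n w) then 1 else 0) * zinv l k (drop n w) \<le> ln (ztot l k w n) - ln (ztot l k w (Suc n))"
    if n: "n < length w" for n
  proof -
    let ?t = "if lcut k w n then exp (- ip l (sum_list (take n w))) else 0"
    have split: "ztot l k w n = ?t + ztot l k w (Suc n)"
      using n by (simp add: ztot_def sum.atLeast_Suc_lessThan)
    show ?thesis
    proof (cases "lcut k w n")
      case True
      then have "ztot l k (take n w @ drop n w) (length (take n w)) =
          exp (- ip l (sum_list (take n w))) * ztot l k (drop n w) 0"
        by (intro ztot_append) (auto simp: lcut_def)
      then have "zinv l k (drop n w) = ?t / ztot l k w n"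
        using n True by (simp add: zinv_def lcut_def)
      also have "\<dots> = 1 - ztot l k w (Suc n) / ztot l k w n"
        using split ztot_pos[of l k w n] by (simp add: field_simps)
      also have "\<dots> \<le> - ln (ztot l k w (Suc n) / ztot l k w n)"
        using ln_le_minus_one[of "ztot l k w (Suc n) / ztot l k w n"] ztot_pos by (simp add: ztot_pos)
      also have "\<dots> = ln (ztot l k w n) - ln (ztot l k w (Suc n))"
        by (simp add: ln_div ztot_pos less_imp_neq[symmetric])
      finally show ?thesis using True by (simp add: lcut_def)
    next
      case False
      then show ?thesis using split n by (auto simp: lcut_def zinv_def)
    qed
  qed
  then have "(\<Sum>n<length w. (if bwd k (take n w) then 1 else 0) * zinv l k (drop n w)) \<le>
      (\<Sum>n<length w. ln (ztot l k w n) - ln (ztot l k w (Suc n)))"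
    by (intro sum_mono) auto
  also have "\<dots> = ln (ztot l k w 0) - ln (ztot l k w (length w))"
    by (rule sum_lessThan_telescope')
  finally show ?thesis by (simp add: ztot_def)
qed

text \<open>The \<open>r\<close>-norm is at most the 1-norm. It allows exponentials to be replaced
  by their \<open>r\<close>-th roots, whose moments are easier to control.\<close>

lemma sum_power_le:
  fixes y :: "'i \<Rightarrow> real"
  assumes "finite I" "\<And>i. i \<in> I \<Longrightarrow> 0 \<le> y i" "0 < r"
  shows "(\<Sum>i\<in>I. y i ^ r) \<le> (\<Sum>i\<in>I. y i) ^ r"
proof -
  obtain s where r: "r = Suc s" using \<open>0 < r\<close> by (cases r) auto
  have "(\<Sum>i\<in>I. y i ^ r) \<le> (\<Sum>i\<in>I. y i * (\<Sum>i\<in>I. y i) ^ s)"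
    unfolding r using assms by (intro sum_mono) (auto intro!: mult_left_mono power_mono member_le_sum)
  then show ?thesis by (simp add: r sum_distrib_right)
qed

text \<open>The exponent \<open>1 / r\<close> is chosen later so small that the exponential moment on the right-hand
  side decays geometrically.\<close>

lemma ln_ztot_le:
  assumes r: "0 < r"
  shows "ln (ztot l k w 0) \<le> real r * (\<Sum>m\<le>length w. exp (- ip l (sum_list (take m w)) / real r))"
proof -
  let ?T = "\<Sum>m\<le>length w. exp (- ip l (sum_list (take m w)) / real r)"
  have T: "0 < ?T" by (intro sum_pos) auto
  have "ztot l k w 0 \<le> (\<Sum>m\<in>{0..<length w}. exp (- ip l (sum_list (take m w)))) + exp (- ip l (sum_list (take (length w) w)))"
    unfolding ztot_def by (intro add_mono sum_mono) auto
  also have "\<dots> = (\<Sum>m\<le>length w. exp (- ip l (sum_list (take m w))))"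
    by (simp only: atLeast0LessThan lessThan_Suc_atMost[symmetric] sum.lessThan_Suc)
  also have "\<dots> = (\<Sum>m\<le>length w. exp (- ip l (sum_list (take m w)) / real r) ^ r)"
    using r by (simp add: exp_of_nat_mult[symmetric])
  also have "\<dots> \<le> ?T ^ r"
    using r by (intro sum_power_le) auto
  finally have "ln (ztot l k w 0) \<le> ln (?T ^ r)"
    using ztot_pos T by (subst ln_le_cancel_iff) auto
  also have "\<dots> = real r * ln ?T" using T by (simp add: ln_realpow)
  also have "\<dots> \<le> real r * ?T"
    using T ln_le_minus_one[OF T] by (intro mult_left_mono) auto
  finally show ?thesis .
qed

section \<open>Moment and survival estimates for independent steps\<close>

context step_law
begin

lemma avg_exp: "avg q n (\<lambda>w. exp (- c * ip l (sum_list w))) = (\<Sum>e\<in>directions. pmf q e * exp (- c * ip l e)) ^ n"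
proof (induction n)
  case (Suc n)
  have "avg q n (\<lambda>w. exp (- c * ip l (sum_list (e # w)))) =
      exp (- c * ip l e) * avg q n (\<lambda>w. exp (- c * ip l (sum_list w)))" for e
    unfolding avg_scale[symmetric] by (simp add: ip_add exp_add[symmetric] algebra_simps)
  then show ?case using Suc by (simp add: sum_distrib_right mult.assoc)
qed simp

lemma avg_take:
  assumes "m \<le> n"
  shows "avg q n (\<lambda>w. f (take m w)) = avg q m f"
proof -
  have "avg q n (\<lambda>w. f (take m w)) = avg q m (\<lambda>u. avg q (n - m) (\<lambda>v. f (take m (u @ v))))"
    using avg_append[of q m "n - m" "\<lambda>w. f (take m w)"] assms by simp
  also have "\<dots> = avg q m f"
    by (intro avg_cong) (simp add: avg_const[OF supp])
  finally show ?thesis .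
qed

definition mean :: "real ^ 'd \<Rightarrow> real" where
  "mean l = (\<Sum>e\<in>directions. pmf q e * ip l e)"

lemma avg_ip: "avg q n (\<lambda>w. ip l (sum_list w)) = real n * mean l"
proof (induction n)
  case (Suc n)
  have "avg q (Suc n) (\<lambda>w. ip l (sum_list w)) = (\<Sum>e\<in>directions. pmf q e * (ip l e + real n * mean l))"
    by (simp add: ip_add avg_add avg_const[OF supp] Suc)
  also have "\<dots> = mean l + (\<Sum>e\<in>directions. pmf q e) * (real n * mean l)"
    by (simp add: mean_def distrib_left sum.distrib sum_distrib_right)
  finally show ?case by (simp add: sum_pmf_directions[OF supp] algebra_simps)
qed simp

text \<open>The moment generating function \<open>?f\<close> has value 1 and slope
  \<open>- mean l\<close> at 0, so it is below 1 at small positive arguments. Reciprocals of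
  naturals are taken because \<open>ln_ztot_le\<close> works with \<open>r\<close>-th
  powers.\<close>

lemma exists_contraction:
  assumes "0 < mean l"
  obtains r where "0 < r" "(\<Sum>e\<in>directions. pmf q e * exp (- (1 / real r) * ip l e)) < 1"
proof -
  let ?f = "\<lambda>t. \<Sum>e\<in>directions. pmf q e * exp (- t * ip l e)"
  have "(?f has_real_derivative (\<Sum>e\<in>directions. pmf q e * (exp (- 0 * ip l e) * - ip l e))) (at 0)"
    by (auto intro!: derivative_eq_intros sum.cong)
  then have "(?f has_real_derivative - mean l) (at 0)"
    by (simp add: mean_def sum_negf)
  then obtain d where d: "0 < d" "\<And>h. 0 < h \<Longrightarrow> h < d \<Longrightarrow> ?f (0 + h) < ?f 0"
    using DERIV_neg_dec_right[of ?f "- mean l" 0] assms by auto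
  obtain r where r: "0 < r" "1 / real r < d"
    using reals_Archimedean[OF d(1)] by (auto simp: inverse_eq_divide intro: that[of "Suc _"])
  have "?f (1 / real r) < 1"
    using d(2)[of "1 / real r"] r by (simp add: sum_pmf_directions[OF supp])
  then show ?thesis using r(1) that by blast
qed

text \<open>By \<open>ln_ztot_le\<close> the average is bounded by \<open>r\<close> times a
  geometric series with ratio \<open>?m\<close>. The bound depends on \<open>l\<close> but not on
  \<open>n\<close>, which suffices for the division by \<open>n\<close> later on.\<close>

lemma avg_ln_ztot_bound:
  assumes "0 < mean l"
  shows "\<exists>K. \<forall>n. avg q n (\<lambda>w. ln (ztot l k w 0)) \<le> K"
proof -
  obtain r where r: "0 < r" "(\<Sum>e\<in>directions. pmf q e * exp (- (1 / real r) * ip l e)) < 1" (is "?m < 1")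
    using exists_contraction[OF assms] by blast
  have m0: "0 \<le> ?m" by (intro sum_nonneg) auto
  have "avg q n (\<lambda>w. ln (ztot l k w 0)) \<le> real r * (1 / (1 - ?m))" for n
  proof -
    have "avg q n (\<lambda>w. ln (ztot l k w 0)) \<le> avg q n (\<lambda>w. real r * (\<Sum>m\<le>n. exp (- (1 / real r) * ip l (sum_list (take m w)))))"
      using ln_ztot_le[OF r(1)] by (intro avg_mono) auto
    also have "\<dots> = real r * (\<Sum>m\<le>n. avg q n (\<lambda>w. exp (- (1 / real r) * ip l (sum_list (take m w)))))"
      by (simp only: avg_scale avg_sum)
    also have "\<dots> = real r * (\<Sum>m\<le>n. ?m ^ m)"
    proof (intro arg_cong[where f = "(*) (real r)"] sum.cong refl)
      fix m assume "m \<in> {..n}"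
      then show "avg q n (\<lambda>w. exp (- (1 / real r) * ip l (sum_list (take m w)))) = ?m ^ m"
        using avg_take[of m n "\<lambda>w. exp (- (1 / real r) * ip l (sum_list w))"] avg_exp[of m "1 / real r" l] by simp
    qed
    also have "\<dots> \<le> real r * (\<Sum>m. ?m ^ m)"
      using m0 r(2) by (intro mult_left_mono sum_le_suminf summable_geometric) auto
    also have "\<dots> = real r * (1 / (1 - ?m))"
      using m0 r(2) by (subst suminf_geometric) auto
    finally show ?thesis .
  qed
  then show ?thesis by blast
qed

text \<open>Gambler's ruin with a finite horizon: \<open>\<kappa>\<close> to the power of the level
  plus 1 is harmonic and equals 1 at the ruin level -1, which accounts for the exponent
  \<open>s + 1\<close>. The induction takes one step of the walk.\<close>

lemma gambler:
  assumes k: "pmf q (- axis k 1) < pmf q (axis k 1)"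
  defines "\<kappa> \<equiv> pmf q (- axis k 1) / pmf q (axis k 1)"
  assumes "- 1 \<le> s"
  shows "1 - \<kappa> powr (of_int s + 1) \<le> avg q n (\<lambda>w. if \<forall>j\<le>length w. 0 \<le> s + level k (take j w) then 1 else 0)"
  using \<open>- 1 \<le> s\<close>
proof (induction n arbitrary: s)
  have ax: "axis k 1 \<in> directions" "- axis k 1 \<in> directions"
    by (auto simp: directions_def)
  have \<kappa>: "0 < \<kappa>" "\<kappa> < 1"
    using k pos[OF ax(1)] pos[OF ax(2)] by (auto simp: \<kappa>_def)
  \<comment> \<open>Only the two steps along axis \<open>k\<close> change the level, and
    multiplication by \<open>\<kappa>\<close> or its inverse exchanges their weights.\<close>
  have harm: "(\<Sum>e\<in>directions. pmf q e * \<kappa> powr (of_int (e $ k))) = 1"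
  proof -
    have ne: "axis k 1 \<noteq> (- axis k 1 :: int ^ 'd)" by (auto simp: vec_eq_iff axis_def)
    have other: "e $ k = 0" if "e \<in> directions" "e \<noteq> axis k 1" "e \<noteq> - axis k 1" for e
      using that by (auto simp: directions_def axis_def)
    have "(\<Sum>e\<in>directions. pmf q e * (\<kappa> powr (of_int (e $ k)) - 1)) =
        (\<Sum>e\<in>{axis k 1, - axis k 1}. pmf q e * (\<kappa> powr (of_int (e $ k)) - 1))"
      using ax other \<kappa> by (intro sum.mono_neutral_right) auto
    also have "\<dots> = 0"
      using ne \<kappa> pos[OF ax(1)] pos[OF ax(2)] by (simp add: powr_minus \<kappa>_def field_simps)
    finally show ?thesis
      by (simp add: right_diff_distrib sum_subtractf sum_pmf_directions[OF supp])
  qed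
  case 0
  then show ?case using \<kappa> by (cases "s = - 1") auto
  case (Suc n)
  show ?case
  proof (cases "s = - 1")
    case True
    have "0 \<le> avg q (Suc n) (\<lambda>w. if \<forall>j\<le>length w. 0 \<le> s + level k (take j w) then 1 else 0)"
      unfolding avg_eq_sum by (intro sum_nonneg mult_nonneg_nonneg prod_list_pmf_nonneg) auto
    then show ?thesis using True \<kappa> by simp
  next
    case False
    then have s: "0 \<le> s" using Suc.prems by simp
    have Cons: "(\<forall>j\<le>length (e # w). 0 \<le> s + level k (take j (e # w))) \<longleftrightarrow>
        (\<forall>j\<le>length w. 0 \<le> (s + e $ k) + level k (take j w))" for e w
    proof -
      have "(\<forall>j\<le>length (e # w). 0 \<le> s + level k (take j (e # w))) \<longleftrightarrow>
        (\<forall>j\<le>length w. 0 \<le> s + level k (take (Suc j) (e # w)))"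
      proof (intro iffI allI impI)
        fix j assume "\<forall>j\<le>length w. 0 \<le> s + level k (take (Suc j) (e # w))" "j \<le> length (e # w)"
        then show "0 \<le> s + level k (take j (e # w))" using s by (cases j) auto
      next
        fix j assume "\<forall>j\<le>length (e # w). 0 \<le> s + level k (take j (e # w))" "j \<le> length w"
        then show "0 \<le> s + level k (take (Suc j) (e # w))" by (metis Suc_le_mono length_Cons)
      qed
      then show ?thesis by (simp add: add.assoc)
    qed
    have ek: "- 1 \<le> e $ k" if "e \<in> directions" for e
      using that by (auto simp: directions_def axis_def)
    have "1 - \<kappa> powr (of_int s + 1) = (\<Sum>e\<in>directions. pmf q e * (1 - \<kappa> powr (of_int (s + e $ k) + 1)))"
    proof -
      have "\<kappa> powr (of_int (s + e $ k) + 1) = \<kappa> powr (of_int s + 1) * \<kappa> powr (of_int (e $ k))" for e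
        using \<kappa> by (simp add: powr_add[symmetric] add_ac)
      then have "(\<Sum>e\<in>directions. pmf q e * (1 - \<kappa> powr (of_int (s + e $ k) + 1))) =
          (\<Sum>e\<in>directions. pmf q e) - \<kappa> powr (of_int s + 1) * (\<Sum>e\<in>directions. pmf q e * \<kappa> powr (of_int (e $ k)))"
        by (simp add: right_diff_distrib sum_subtractf sum_distrib_left mult_ac)
      then show ?thesis by (simp add: harm sum_pmf_directions[OF supp])
    qed
    also have "\<dots> \<le> (\<Sum>e\<in>directions. pmf q e * avg q n (\<lambda>w. if \<forall>j\<le>length w. 0 \<le> (s + e $ k) + level k (take j w) then 1 else 0))"
      using s ek by (intro sum_mono mult_left_mono Suc.IH) force+
    finally show ?thesis unfolding avg.simps Cons .
  qed
qed

lemma avg_bwd_ge: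
  assumes k: "pmf q (- axis k 1) < pmf q (axis k 1)"
  shows "1 - pmf q (- axis k 1) / pmf q (axis k 1) \<le> avg q n (\<lambda>w. if bwd k w then 1 else 0)"
proof -
  have rev: "bwd k (rev w) \<longleftrightarrow> (\<forall>j\<le>length w. 0 \<le> level k (take j w))" for w :: "(int ^ 'd) list"
  proof -
    have "level k (rev u) = level k u" for u :: "(int ^ 'd) list"
      by (induction u) auto
    then have "bwd k (rev w) \<longleftrightarrow> (\<forall>j\<le>length w. 0 \<le> level k (take (length w - j) w))"
      by (simp add: bwd_def drop_rev)
    also have "\<dots> \<longleftrightarrow> (\<forall>j\<le>length w. 0 \<le> level k (take j w))"
      by (metis diff_diff_cancel diff_le_self)
    finally show ?thesis .
  qed
  have "0 < pmf q (axis k 1)" by (intro pos) (auto simp: directions_def)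
  then have "1 - pmf q (- axis k 1) / pmf q (axis k 1) \<le>
      avg q n (\<lambda>w. if \<forall>j\<le>length w. 0 \<le> level k (take j w) then 1 else 0)"
    using gambler[OF k, of 0 n] by simp
  also have "\<dots> = avg q n (\<lambda>w. if bwd k (rev w) then 1 else 0)"
    by (simp add: rev)
  also have "\<dots> = avg q n (\<lambda>w. if bwd k w then 1 else 0)"
    by (rule avg_rev)
  finally show ?thesis .
qed

text \<open>Forcing the first step to be \<open>axis k 1\<close> turns strict positivity into
  survival from level 0.\<close>

lemma avg_fwd_ge:
  assumes k: "pmf q (- axis k 1) < pmf q (axis k 1)" and "0 < n"
  shows "pmf q (axis k 1) * (1 - pmf q (- axis k 1) / pmf q (axis k 1)) \<le> avg q n (\<lambda>w. if fwd k w then 1 else 0)"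
proof -
  obtain m where n: "n = Suc m" using \<open>0 < n\<close> by (cases n) auto
  have ax: "axis k 1 \<in> directions" by (auto simp: directions_def)
  have fwd: "fwd k (axis k 1 # w)" if "\<forall>j\<le>length w. 0 \<le> level k (take j w)" for w :: "(int ^ 'd) list"
    unfolding fwd_def
  proof (intro conjI ballI)
    fix j assume "j \<in> {1..length (axis k 1 # w)}"
    then obtain i where "j = Suc i" "i \<le> length w" by (cases j) auto
    then show "0 < level k (take j (axis k 1 # w))"
      using that by (simp add: axis_def add_pos_nonneg)
  qed simp
  have "1 - pmf q (- axis k 1) / pmf q (axis k 1) \<le>
      avg q m (\<lambda>w. if \<forall>j\<le>length w. 0 \<le> level k (take j w) then 1 else 0)"
    using gambler[OF k, of 0 m] pos[OF ax] by simp
  also have "\<dots> \<le> avg q m (\<lambda>w. if fwd k (axis k 1 # w) then 1 else 0)"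
    using fwd by (intro avg_mono) auto
  finally have "pmf q (axis k 1) * (1 - pmf q (- axis k 1) / pmf q (axis k 1)) \<le>
      pmf q (axis k 1) * avg q m (\<lambda>w. if fwd k (axis k 1 # w) then 1 else 0)"
    by (intro mult_left_mono) auto
  also have "\<dots> \<le> avg q n (\<lambda>w. if fwd k w then 1 else 0)"
    unfolding n avg.simps
  proof (rule member_le_sum[OF ax])
    show "0 \<le> pmf q x * avg q m (\<lambda>w. if fwd k (x # w) then 1 else 0)" for x
      unfolding avg_eq_sum by (intro mult_nonneg_nonneg sum_nonneg prod_list_pmf_nonneg) auto
  qed simp
  finally show ?thesis .
qed

text \<open>Stationarity of the increments turns the telescoping bound into a bound on the average over
  \<open>n\<close> of the expectations of \<open>zinv\<close>.\<close>

lemma sum_avg_zinv_le: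
  assumes k: "pmf q (- axis k 1) < pmf q (axis k 1)" and l: "0 < mean l"
  shows "\<exists>K. \<forall>n. (1 - pmf q (- axis k 1) / pmf q (axis k 1)) * (\<Sum>m<n. avg q (Suc m) (zinv l k)) \<le> real n * mean l + K"
proof -
  let ?\<rho> = "1 - pmf q (- axis k 1) / pmf q (axis k 1)"
  obtain K where K: "\<And>n. avg q n (\<lambda>w. ln (ztot l k w 0)) \<le> K"
    using avg_ln_ztot_bound[OF l] by blast
  have zinv: "0 \<le> zinv l k w" for w
    using ztot_pos[of l k w 0] by (simp add: zinv_def)
  have "?\<rho> * (\<Sum>m<n. avg q (Suc m) (zinv l k)) \<le> real n * mean l + K" for n
  proof -
    \<comment> \<open>Summing in reverse order pairs a prefix of length \<open>m\<close> with a
      suffix of length \<open>n - m\<close>.\<close>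
    have "?\<rho> * (\<Sum>m<n. avg q (Suc m) (zinv l k)) = (\<Sum>m<n. ?\<rho> * avg q (Suc (n - Suc m)) (zinv l k))"
      unfolding sum_distrib_left by (rule sum.nat_diff_reindex[symmetric])
    also have "\<dots> \<le> (\<Sum>m<n. avg q n (\<lambda>w. (if bwd k (take m w) then 1 else 0) * zinv l k (drop m w)))"
    proof (rule sum_mono)
      fix m assume "m \<in> {..<n}"
      then have n: "n = m + (n - m)" "Suc (n - Suc m) = n - m" by auto
      have "avg q n (\<lambda>w. (if bwd k (take m w) then 1 else 0) * zinv l k (drop m w)) =
          avg q m (\<lambda>u. avg q (n - m) (\<lambda>v. (if bwd k (take m (u @ v)) then 1 else 0) * zinv l k (drop m (u @ v))))"
        by (subst n(1)) (rule avg_append)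
      also have "\<dots> = avg q m (\<lambda>u. avg q (n - m) (zinv l k) * (if bwd k u then 1 else 0))"
        by (intro avg_cong) (simp add: avg_const[OF supp])
      also have "\<dots> = avg q (n - m) (zinv l k) * avg q m (\<lambda>u. if bwd k u then 1 else 0)"
        by (rule avg_scale)
      also have "\<dots> \<ge> avg q (n - m) (zinv l k) * ?\<rho>"
        using zinv by (intro mult_left_mono avg_bwd_ge[OF k])
          (auto simp: avg_eq_sum intro!: sum_nonneg mult_nonneg_nonneg prod_list_pmf_nonneg)
      finally show "?\<rho> * avg q (Suc (n - Suc m)) (zinv l k) \<le>
          avg q n (\<lambda>w. (if bwd k (take m w) then 1 else 0) * zinv l k (drop m w))"
        unfolding n(2) by (simp add: mult.commute)
    qed
    also have "\<dots> = avg q n (\<lambda>w. \<Sum>m<n. (if bwd k (take m w) then 1 else 0) * zinv l k (drop m w))"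
      by (rule avg_sum[symmetric])
    also have "\<dots> \<le> avg q n (\<lambda>w. ln (ztot l k w 0) + ip l (sum_list w))"
      using sum_zinv_le by (intro avg_mono) blast
    also have "\<dots> \<le> K + real n * mean l"
      unfolding avg_add avg_ip using K[of n] by simp
    finally show ?thesis by simp
  qed
  then show ?thesis by blast
qed

end

section \<open>Cut times of the first walk\<close>

definition incr :: "(nat \<Rightarrow> int ^ 'd::finite) \<Rightarrow> nat \<Rightarrow> (int ^ 'd) list" where
  "incr x n = map (\<lambda>j. x (Suc j) - x j) [0..<n]"

lemma length_incr [simp]: "length (incr x n) = n"
  by (simp add: incr_def)

lemma incr_eq_Nil [simp]: "incr x n = [] \<longleftrightarrow> n = 0"
  by (simp add: incr_def)

lemma nth_incr [simp]: "j < n \<Longrightarrow> incr x n ! j = x (Suc j) - x j"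
  by (simp add: incr_def)

lemma sum_list_incr [simp]: "sum_list (incr x n) = x n - x 0"
  by (induction n) (simp_all add: incr_def)

lemma take_incr [simp]: "m \<le> n \<Longrightarrow> take m (incr x n) = incr x m"
  by (simp add: incr_def take_map)

lemma drop_incr: "m \<le> n \<Longrightarrow> drop m (incr x n) = incr (\<lambda>j. x (m + j)) (n - m)"
  by (intro nth_equalityI) simp_all

lemma level_incr [simp]: "level k (incr x n) = x n $ k - x 0 $ k"
  by (simp add: level_def)

text \<open>Only the coordinate \<open>k\<close> is constrained. This already divides the trace at
  time \<open>n\<close>, since a site visited later lies strictly above all sites visited up to
  \<open>n\<close>.\<close>

definition is_cut :: "'d::finite \<Rightarrow> (nat \<Rightarrow> int ^ 'd) \<Rightarrow> nat \<Rightarrow> bool" where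
  "is_cut k x n \<longleftrightarrow> (\<forall>j\<le>n. x j $ k \<le> x n $ k) \<and> (\<forall>j>n. x n $ k < x j $ k)"

lemma bwd_incr: "bwd k (incr x n) \<longleftrightarrow> (\<forall>j\<le>n. x j $ k \<le> x n $ k)"
  by (simp add: bwd_def drop_incr)

lemma fwd_incr: "fwd k (incr x n) \<longleftrightarrow> 0 < n \<and> (\<forall>j\<in>{1..n}. x 0 $ k < x j $ k)"
proof -
  have "0 < level k (take j (incr x n)) \<longleftrightarrow> x 0 $ k < x j $ k" if "j \<in> {1..n}" for j
    using that by simp
  then have "(\<forall>j\<in>{1..n}. 0 < level k (take j (incr x n))) \<longleftrightarrow> (\<forall>j\<in>{1..n}. x 0 $ k < x j $ k)"
    by blast
  then show ?thesis unfolding fwd_def length_incr incr_eq_Nil neq0_conv by blast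
qed

lemma lcut_incr:
  "lcut k (incr x N) n \<longleftrightarrow> n < N \<and> (\<forall>j\<le>n. x j $ k \<le> x n $ k) \<and> (\<forall>j\<in>{n<..N}. x n $ k < x j $ k)"
proof (cases "n < N")
  case True
  have "(\<forall>j\<in>{1..N - n}. x n $ k < x (n + j) $ k) \<longleftrightarrow> (\<forall>j\<in>{n<..N}. x n $ k < x j $ k)"
  proof (intro iffI ballI)
    fix j assume all: "\<forall>j\<in>{1..N - n}. x n $ k < x (n + j) $ k" and j: "j \<in> {n<..N}"
    have "x n $ k < x (n + (j - n)) $ k" by (rule all[rule_format]) (use j in auto)
    then show "x n $ k < x j $ k" using j by simp
  qed auto
  then show ?thesis using True by (simp add: lcut_def bwd_incr drop_incr fwd_incr)
qed (simp add: lcut_def)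

lemma is_cut_lcut: "is_cut k x n \<longleftrightarrow> (\<forall>N>n. lcut k (incr x N) n)"
proof
  show "is_cut k x n \<Longrightarrow> \<forall>N>n. lcut k (incr x N) n"
    unfolding is_cut_def lcut_incr by simp
  assume *: "\<forall>N>n. lcut k (incr x N) n"
  have "lcut k (incr x (Suc n)) n" using * by blast
  moreover have "x n $ k < x j $ k" if "n < j" for j
  proof -
    have "lcut k (incr x j) n" using * that by blast
    then show ?thesis using that unfolding lcut_incr by simp
  qed
  ultimately show "is_cut k x n"
    unfolding is_cut_def lcut_incr by blast
qed

context step_law
begin

lemma avg_prod: "avg q n (\<lambda>w. \<Prod>j<n. g j (w ! j)) = (\<Prod>j<n. \<Sum>e\<in>directions. pmf q e * g j e)"
proof (induction n arbitrary: g)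
  case (Suc n)
  have "avg q n (\<lambda>w. \<Prod>j<Suc n. g j ((e # w) ! j)) = g 0 e * avg q n (\<lambda>w. \<Prod>j<n. g (Suc j) (w ! j))" for e
    by (subst avg_scale[symmetric]) (simp only: prod.lessThan_Suc_shift nth_Cons_0 nth_Cons_Suc)
  then have "avg q (Suc n) (\<lambda>w. \<Prod>j<Suc n. g j (w ! j)) =
      (\<Sum>e\<in>directions. pmf q e * (g 0 e * avg q n (\<lambda>w. \<Prod>j<n. g (Suc j) (w ! j))))"
    unfolding avg.simps by (simp only:)
  also have "\<dots> = (\<Sum>e\<in>directions. pmf q e * g 0 e) * (\<Prod>j<n. \<Sum>e\<in>directions. pmf q e * g (Suc j) e)"
    unfolding Suc[of "\<lambda>j. g (Suc j)"] by (simp only: sum_distrib_right mult.assoc)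
  finally show ?case by (simp only: prod.lessThan_Suc_shift)
qed simp

end

section \<open>The first walk as a sum of independent steps\<close>

lemma sum_directions:
  fixes f :: "int ^ 'd::finite \<Rightarrow> real"
  shows "(\<Sum>e\<in>directions. f e) = (\<Sum>j\<in>UNIV. f (axis j 1) + f (- axis j 1))"
proof -
  have d: "directions = range (\<lambda>j::'d. axis j (1::int)) \<union> range (\<lambda>j::'d. - axis j (1::int))"
    by (auto simp: directions_def)
  have ne: "axis i (1::int) \<noteq> - axis j 1" for i j :: 'd
    by (auto simp: vec_eq_iff axis_def)
  have i1: "inj (\<lambda>j::'d. axis j (1::int))" and i2: "inj (\<lambda>j::'d. - axis j (1::int))"
    by (auto simp: inj_def axis_eq_axis)
  have "(\<Sum>e\<in>directions. f e) = sum f (range (\<lambda>j::'d. axis j (1::int))) + sum f (range (\<lambda>j::'d. - axis j (1::int)))"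
    unfolding d using ne by (intro sum.union_disjoint) auto
  then show ?thesis
    by (simp add: sum.reindex[OF i1] sum.reindex[OF i2] sum.distrib)
qed

locale directed_walks = nested_walks M p X
  for M :: "'a measure" and p :: "enat \<Rightarrow> (int ^ 'd::finite) pmf" and X +
  fixes k :: 'd
  assumes cond1: "condition1 p k"
begin

lemma pos: "e \<in> directions \<Longrightarrow> 0 < pmf (p i) e"
  using cond1 by (simp add: condition1_def)

lemma step_law: "step_law (p i)"
  using steps pos by unfold_locales auto

sublocale p0: step_law "p 0"
  by (rule step_law)

lemma k_bias: "pmf (p 0) (- axis k 1) < pmf (p 0) (axis k 1)"
  using cond1 by (simp add: condition1_def drift_def)

lemma mean_eq: "p0.mean l = drift (p 0) \<bullet> l"
  by (simp add: p0.mean_def sum_directions ip_minus drift_def inner_vec_def algebra_simps)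

lemma mean_axis: "0 < p0.mean (axis k 1)"
  unfolding mean_eq using k_bias by (simp add: inner_axis drift_def)

lemma ip_axis_k: "ip (axis k 1) x = of_int (x $ k)"
proof -
  have "(axis k 1 :: real ^ 'd) $ j * of_int (x $ j) = (if j = k then of_int (x $ k) else 0)" for j
    by (simp add: axis_def)
  then show ?thesis by (simp add: ip_def)
qed

lemma norm_ell_hat_pos: "i \<noteq> 0 \<Longrightarrow> 0 < norm (ell_hat (p i))"
  using cond1 unfolding condition1_def ell_def by (metis inner_zero_right less_irrefl norm_le_zero_iff not_le scaleR_zero_right)

lemma mean_ell_hat: "i \<noteq> 0 \<Longrightarrow> 0 < p0.mean (ell_hat (p i))"
  using norm_ell_hat_pos[of i] cond1 by (simp add: mean_eq condition1_def ell_def zero_less_mult_iff)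

lemma AE_reg: "AE \<omega> in M. regular \<omega>"
  by (rule AE_regular) (rule pos)

abbreviation walk0 :: "'a \<Rightarrow> nat \<Rightarrow> int ^ 'd" where
  "walk0 \<omega> \<equiv> (\<lambda>n. X 0 n \<omega>)"

lemma step_prob_lattice: "step_prob (p 0) lattice_graph x y = pmf (p 0) (y - x)"
proof -
  have "{e. e \<in> directions \<and> {x, x + e} \<in> snd lattice_graph} = directions"
    by (auto simp: lattice_graph_def)
  then have "step_prob (p 0) lattice_graph x y = (if {x, y} \<in> snd lattice_graph then pmf (p 0) (y - x) else 0)"
    by (simp add: step_prob_def sum_pmf_directions[OF steps])
  moreover have "{x, y} \<in> snd lattice_graph" if "y - x \<in> directions"
    using that by (simp add: lattice_graph_def) (rule exI[of _ x], rule exI[of _ "y - x"], simp)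
  moreover have "pmf (p 0) (y - x) = 0" if "y - x \<notin> directions"
    using that steps[of 0] by (auto simp: pmf_eq_0_set_pmf)
  ultimately show ?thesis by auto
qed

lemma incr_measurable [measurable]: "(\<lambda>\<omega>. incr (walk0 \<omega>) n) \<in> measurable M (count_space UNIV)"
proof (induction n)
  case (Suc n)
  have "(\<lambda>\<omega>. X 0 (Suc n) \<omega> - X 0 n \<omega>) \<in> measurable M (count_space UNIV)"
    by (rule measurable_countable_fun2[OF X_measurable X_measurable, where h = "\<lambda>a b. a - b"])
  from measurable_countable_fun2[OF Suc this, where h = "\<lambda>w e. w @ [e]"] show ?case
    by (simp add: incr_def)
qed (simp add: incr_def)

lemma AE_incr_words: "AE \<omega> in M. incr (walk0 \<omega>) n \<in> words n"
  using AE_reg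
proof eventually_elim
  case (elim \<omega>)
  then have "set (incr (walk0 \<omega>) n) \<subseteq> directions"
    unfolding incr_def set_map using regularD(5)[OF elim] by blast
  then show ?case by simp
qed

lemma prob_incr:
  assumes w: "w \<in> words n"
  shows "prob {\<omega> \<in> space M. incr (walk0 \<omega>) n = w} = prod_list (map (pmf (p 0)) w)"
proof -
  let ?y = "\<lambda>j. sum_list (take j w)"
  have step: "?y (Suc j) = ?y j + w ! j" if "j < n" for j
    using that w by (simp add: take_Suc_conv_app_nth)
  have "AE \<omega> in M. \<omega> \<in> {\<omega> \<in> space M. incr (walk0 \<omega>) n = w} \<longleftrightarrow>
      \<omega> \<in> space M \<inter> {\<omega> \<in> space M. \<forall>j\<le>n. X 0 j \<omega> = ?y j}"
    using AE_walk_0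
  proof eventually_elim
    case (elim \<omega>)
    have "incr (walk0 \<omega>) n = w \<longleftrightarrow> (\<forall>j\<le>n. X 0 j \<omega> = ?y j)"
    proof
      assume eq: "incr (walk0 \<omega>) n = w"
      show "\<forall>j\<le>n. X 0 j \<omega> = ?y j"
      proof (intro allI impI)
        fix j assume "j \<le> n"
        then show "X 0 j \<omega> = ?y j" using elim unfolding eq[symmetric] by simp
      qed
    next
      assume eq: "\<forall>j\<le>n. X 0 j \<omega> = ?y j"
      show "incr (walk0 \<omega>) n = w"
      proof (rule nth_equalityI)
        fix j assume "j < length (incr (walk0 \<omega>) n)"
        then have j: "j < n" by simp
        then show "incr (walk0 \<omega>) n ! j = w ! j"
          using eq[rule_format, of j] eq[rule_format, of "Suc j"] step[OF j] by simp
      qed (use w in simp)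
    qed
    then show ?case by auto
  qed
  then have "prob {\<omega> \<in> space M. incr (walk0 \<omega>) n = w} = prob (space M \<inter> {\<omega> \<in> space M. \<forall>j\<le>n. X 0 j \<omega> = ?y j})"
    by (rule finite_measure_eq_AE) measurable
  also have "\<dots> = (\<integral>\<omega>. path_weight (p (enat 0)) (walk_graph X 0 \<omega>) ?y n * indicator (space M) \<omega> \<partial>M)"
    using sets.top[of "past 0"] by (intro prob_follow(2)) simp_all
  also have "\<dots> = (\<integral>\<omega>. prod_list (map (pmf (p 0)) w) \<partial>M)"
  proof (intro Bochner_Integration.integral_cong refl)
    fix \<omega> assume "\<omega> \<in> space M"
    have "path_weight (p 0) lattice_graph ?y n = (\<Prod>j<n. pmf (p 0) (w ! j))"
      unfolding path_weight_def using step by (intro prod.cong refl) (simp add: step_prob_lattice)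
    also have "\<dots> = prod_list (map (pmf (p 0)) w)"
      using w by (simp add: prod.list_conv_set_nth atLeast0LessThan)
    finally show "path_weight (p (enat 0)) (walk_graph X 0 \<omega>) ?y n * indicator (space M) \<omega> = prod_list (map (pmf (p 0)) w)"
      using \<open>\<omega> \<in> space M\<close> by (simp add: zero_enat_def)
  qed
  finally show ?thesis by (simp add: prob_space)
qed

lemma incr_fun_measurable [measurable]: "(\<lambda>\<omega>. f (incr (walk0 \<omega>) n) :: real) \<in> borel_measurable M"
  using measurable_compose[OF incr_measurable, of f borel] by simp

text \<open>Off a null set the increments form one of finitely many words with the weights of
  \<open>prob_incr\<close>, so the expectation is the finite sum \<open>avg\<close>.\<close>

lemma expectation_incr:
  "integrable M (\<lambda>\<omega>. f (incr (walk0 \<omega>) n))"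
  "expectation (\<lambda>\<omega>. f (incr (walk0 \<omega>) n)) = avg (p 0) n f"
proof -
  let ?g = "\<lambda>\<omega>. \<Sum>w\<in>words n. indicator {\<omega> \<in> space M. incr (walk0 \<omega>) n = w} \<omega> * f w"
  have ae: "AE \<omega> in M. ?g \<omega> = f (incr (walk0 \<omega>) n)"
    using AE_incr_words[of n] AE_space
  proof eventually_elim
    case (elim \<omega>)
    have "?g \<omega> = (\<Sum>w\<in>{incr (walk0 \<omega>) n}. indicator {\<omega> \<in> space M. incr (walk0 \<omega>) n = w} \<omega> * f w)"
      using elim by (intro sum.mono_neutral_right) (auto simp: indicator_def)
    then show ?case using elim by simp
  qed
  have g: "integrable M ?g"
    by (intro Bochner_Integration.integrable_sum integrable_mult_left integrable_real_indicator) (auto simp: emeasure_eq_measure)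
  show "integrable M (\<lambda>\<omega>. f (incr (walk0 \<omega>) n))"
    by (rule integrable_cong_AE_imp[OF g _ ae]) simp
  have "expectation (\<lambda>\<omega>. f (incr (walk0 \<omega>) n)) = expectation ?g"
    using AE_symmetric[OF ae] by (intro integral_cong_AE) simp_all
  also have "\<dots> = (\<Sum>w\<in>words n. prob {\<omega> \<in> space M. incr (walk0 \<omega>) n = w} * f w)"
    by (subst Bochner_Integration.integral_sum) (auto intro!: integrable_mult_left integrable_real_indicator simp: emeasure_eq_measure)
  also have "\<dots> = avg (p 0) n f"
    by (simp add: avg_eq_sum prob_incr)
  finally show "expectation (\<lambda>\<omega>. f (incr (walk0 \<omega>) n)) = avg (p 0) n f" .
qed

lemma prob_incr_pred: "prob {\<omega> \<in> space M. P (incr (walk0 \<omega>) n)} = avg (p 0) n (\<lambda>w. if P w then 1 else 0)"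
proof -
  have "prob {\<omega> \<in> space M. P (incr (walk0 \<omega>) n)} = expectation (indicator {\<omega> \<in> space M. P (incr (walk0 \<omega>) n)})"
    by simp
  also have "\<dots> = expectation (\<lambda>\<omega>. if P (incr (walk0 \<omega>) n) then 1 else 0)"
    by (intro Bochner_Integration.integral_cong) (auto simp: indicator_def)
  finally show ?thesis by (simp only: expectation_incr(2)[of "\<lambda>w. if P w then 1 else 0" n])
qed

text \<open>For the small exponent \<open>1 / r\<close> the expectations decay geometrically, so
  that series converges almost surely. Its terms are eventually below 1, and then their
  \<open>r\<close>-th powers are smaller still.\<close>

lemma AE_summable_exp:
  assumes "0 < p0.mean l"
  shows "AE \<omega> in M. summable (\<lambda>n. exp (- ip l (X 0 n \<omega>)))"
proof -
  obtain r where r: "0 < r" "(\<Sum>e\<in>directions. pmf (p 0) e * exp (- (1 / real r) * ip l e)) < 1" (is "?m < 1")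
    using p0.exists_contraction[OF assms] by blast
  have m0: "0 \<le> ?m" by (intro sum_nonneg) auto
  let ?y = "\<lambda>n \<omega>. exp (- (1 / real r) * ip l (sum_list (incr (walk0 \<omega>) n)))"
  have "(\<integral>\<^sup>+\<omega>. (\<Sum>n. ennreal (?y n \<omega>)) \<partial>M) = (\<Sum>n. \<integral>\<^sup>+\<omega>. ennreal (?y n \<omega>) \<partial>M)"
    by (rule nn_integral_suminf) measurable
  also have "\<dots> = (\<Sum>n. ennreal (?m ^ n))"
  proof (rule suminf_cong)
    fix n
    note E = expectation_incr[of "\<lambda>w. exp (- (1 / real r) * ip l (sum_list w))" n]
    have "(\<integral>\<^sup>+\<omega>. ennreal (?y n \<omega>) \<partial>M) = ennreal (expectation (?y n))"
      by (rule nn_integral_eq_integral[OF E(1)]) simp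
    also have "expectation (?y n) = ?m ^ n" unfolding E(2) by (rule p0.avg_exp)
    finally show "(\<integral>\<^sup>+\<omega>. ennreal (?y n \<omega>) \<partial>M) = ennreal (?m ^ n)" .
  qed
  also have "\<dots> < \<infinity>"
    using m0 r(2) by (subst suminf_ennreal2) (auto intro!: summable_geometric)
  finally have "AE \<omega> in M. (\<Sum>n. ennreal (?y n \<omega>)) \<noteq> \<infinity>"
    by (intro nn_integral_PInf_AE) auto
  then show ?thesis
    using AE_walk_0
  proof eventually_elim
    case (elim \<omega>)
    then have s: "summable (\<lambda>n. ?y n \<omega>)"
      by (intro summable_suminf_not_top) auto
    have eq: "exp (- ip l (X 0 n \<omega>)) = ?y n \<omega> ^ r" for n
      using r(1) elim by (simp add: exp_of_nat_mult[symmetric])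
    have "eventually (\<lambda>n. ?y n \<omega> < 1) sequentially"
      using summable_LIMSEQ_zero[OF s] by (rule order_tendstoD) simp
    then have "eventually (\<lambda>n. norm (exp (- ip l (X 0 n \<omega>))) \<le> ?y n \<omega>) sequentially"
    proof eventually_elim
      case (elim n)
      then show ?case unfolding eq using r(1)
        by (cases r) (auto intro!: mult_left_le power_le_one simp: less_imp_le simp del: exp_le_one_iff exp_less_one_iff)
    qed
    then show ?case by (rule summable_comparison_test_ev[OF _ s])
  qed
qed

text \<open>Transience in direction \<open>k\<close>: along \<open>axis k 1\<close> the terms of the
  convergent series of \<open>AE_summable_exp\<close> tend to 0.\<close>

lemma AE_level_at_top: "AE \<omega> in M. filterlim (\<lambda>n. real_of_int (X 0 n \<omega> $ k)) at_top sequentially"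
  using AE_summable_exp[OF mean_axis]
proof eventually_elim
  case (elim \<omega>)
  have "(\<lambda>n. exp (- real_of_int (X 0 n \<omega> $ k))) \<longlonglongrightarrow> 0"
    using summable_LIMSEQ_zero[OF elim] by (simp add: ip_axis_k)
  then have "filterlim (\<lambda>n. exp (- real_of_int (X 0 n \<omega> $ k))) (at_right 0) sequentially"
    by (intro tendsto_imp_filterlim_at_right) auto
  then have "filterlim (\<lambda>n. ln (exp (- real_of_int (X 0 n \<omega> $ k)))) at_bot sequentially"
    by (rule filterlim_compose[OF ln_at_0])
  then show ?case by (simp add: filterlim_uminus_at_bot)
qed

end

context directed_walks
begin

text \<open>The product of the bounds of \<open>avg_bwd_ge\<close> and \<open>avg_fwd_ge\<close>,
  for the two independent halves of a cut.\<close>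

definition cut_bound :: real where
  "cut_bound = (1 - pmf (p 0) (- axis k 1) / pmf (p 0) (axis k 1)) *
     (pmf (p 0) (axis k 1) * (1 - pmf (p 0) (- axis k 1) / pmf (p 0) (axis k 1)))"

lemma axis_direction: "axis j 1 \<in> directions" "- axis j 1 \<in> directions"
  by (auto simp: directions_def)

lemma bias_pos: "0 < 1 - pmf (p 0) (- axis k 1) / pmf (p 0) (axis k 1)"
  using k_bias pos[OF axis_direction(1)[of k], of 0] by simp

lemma cut_bound_pos: "0 < cut_bound"
  unfolding cut_bound_def by (intro mult_pos_pos bias_pos pos axis_direction)

lemma level_pred:
  assumes X: "\<And>n. X 0 n \<in> measurable N (count_space UNIV)"
  shows "Measurable.pred N (\<lambda>\<omega>. X 0 i \<omega> $ k \<le> X 0 j \<omega> $ k)"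
    and "Measurable.pred N (\<lambda>\<omega>. X 0 i \<omega> $ k < X 0 j \<omega> $ k)"
  using measurable_countable_fun2[OF X X, where h = "\<lambda>a b. a $ k \<le> b $ k"]
    measurable_countable_fun2[OF X X, where h = "\<lambda>a b. a $ k < b $ k"]
  by auto

lemma is_cut_pred:
  assumes X: "\<And>n. X 0 n \<in> measurable N (count_space UNIV)"
  shows "Measurable.pred N (\<lambda>\<omega>. is_cut k (walk0 \<omega>) n)"
proof -
  note level_pred[OF X, measurable]
  show ?thesis unfolding is_cut_def by measurable
qed

declare level_pred[OF X_measurable, measurable] is_cut_pred[OF X_measurable, measurable]

lemma prob_lcut:
  "cut_bound \<le> prob {\<omega> \<in> space M. lcut k (incr (walk0 \<omega>) (n + Suc m)) n}"
proof -
  let ?\<rho> = "1 - pmf (p 0) (- axis k 1) / pmf (p 0) (axis k 1)"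
  have "cut_bound \<le> avg (p 0) n (\<lambda>w. if bwd k w then 1 else 0) * avg (p 0) (Suc m) (\<lambda>w. if fwd k w then 1 else 0)"
    unfolding cut_bound_def
    using pos[OF axis_direction(1)[of k], of 0]
    by (intro mult_mono p0.avg_bwd_ge p0.avg_fwd_ge k_bias mult_nonneg_nonneg less_imp_le[OF bias_pos]
      order_trans[OF less_imp_le[OF bias_pos] p0.avg_bwd_ge[OF k_bias]]) auto
  also have "\<dots> = avg (p 0) n (\<lambda>u. avg (p 0) (Suc m) (\<lambda>w. if fwd k w then 1 else 0) * (if bwd k u then 1 else 0))"
    unfolding avg_scale by (rule mult.commute)
  also have "\<dots> = avg (p 0) (n + Suc m) (\<lambda>w. if lcut k w n then 1 else 0)"
  proof -
    have "avg (p 0) (Suc m) (\<lambda>w. if fwd k w then 1 else 0) * (if bwd k u then 1 else 0) =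
        avg (p 0) (Suc m) (\<lambda>v. if lcut k (u @ v) n then 1 else 0)" if u: "u \<in> words n" for u
    proof -
      have "avg (p 0) (Suc m) (\<lambda>v. if lcut k (u @ v) n then 1 else 0) =
          avg (p 0) (Suc m) (\<lambda>v. (if bwd k u then 1 else 0) * (if fwd k v then 1 else 0))"
      proof (rule avg_cong)
        fix v :: "(int ^ 'd) list" assume "v \<in> words (Suc m)"
        then show "(if lcut k (u @ v) n then 1 else 0) = (if bwd k u then 1 else 0) * (if fwd k v then 1 else 0 :: real)"
          using u by (simp add: lcut_def)
      qed
      then show ?thesis unfolding avg_scale by simp
    qed
    then show ?thesis
      by (subst avg_append) (rule avg_cong, blast)
  qed
  also have "\<dots> = prob {\<omega> \<in> space M. lcut k (incr (walk0 \<omega>) (n + Suc m)) n}"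
    by (rule prob_incr_pred[symmetric])
  finally show ?thesis .
qed

text \<open>The events with finite horizon decrease to the cut event, and their lower bound does not
  depend on the horizon.\<close>

lemma prob_is_cut: "cut_bound \<le> prob {\<omega> \<in> space M. is_cut k (walk0 \<omega>) n}"
proof -
  let ?A = "\<lambda>m. {\<omega> \<in> space M. lcut k (incr (walk0 \<omega>) (n + Suc m)) n}"
  have meas: "?A m \<in> sets M" for m
    unfolding lcut_incr by measurable
  have "decseq ?A"
    unfolding decseq_Suc_iff lcut_incr by auto
  then have "(\<lambda>m. prob (?A m)) \<longlonglongrightarrow> prob (\<Inter>m. ?A m)"
    using meas by (intro finite_Lim_measure_decseq) auto
  then have "cut_bound \<le> prob (\<Inter>m. ?A m)"
    using prob_lcut by (intro LIMSEQ_le_const) blast+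
  also have "(\<Inter>m. ?A m) = {\<omega> \<in> space M. is_cut k (walk0 \<omega>) n}"
  proof -
    have "(\<forall>N>n. lcut k (incr x N) n) \<longleftrightarrow> (\<forall>m. lcut k (incr x (n + Suc m)) n)" for x :: "nat \<Rightarrow> int ^ 'd"
      by (metis less_add_Suc1 less_imp_Suc_add add_Suc_right)
    then show ?thesis unfolding is_cut_lcut by blast
  qed
  finally show ?thesis .
qed

section \<open>Infinitely many cut times by the zero-one law\<close>

abbreviation jump_algebra :: "nat \<Rightarrow> 'a set set" where
  "jump_algebra n \<equiv> sets (vimage_algebra (space M) (\<lambda>\<omega>. X 0 (Suc n) \<omega> - X 0 n \<omega>) (count_space UNIV))"

lemma jump_measurable [measurable]: "(\<lambda>\<omega>. X 0 (Suc n) \<omega> - X 0 n \<omega>) \<in> measurable M (count_space UNIV)"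
  by (rule measurable_countable_fun2[OF X_measurable X_measurable, where h = "\<lambda>a b. a - b"])

lemma jump_algebra_eq:
  "jump_algebra n = {{\<omega> \<in> space M. X 0 (Suc n) \<omega> - X 0 n \<omega> \<in> S} | S. True}"
  by (subst sets_vimage_algebra2) (auto intro!: Collect_cong)

text \<open>An event about finitely many jumps is an event about one word of increments; its
  indicator is a product over the positions, which \<open>avg_prod\<close> factorises.\<close>

lemma indep_jumps: "indep_sets jump_algebra UNIV"
  unfolding indep_sets_def
proof (intro conjI ballI allI impI)
  show "jump_algebra n \<subseteq> events" for n
    unfolding jump_algebra_eq by auto
  fix J :: "nat set" and A assume J: "J \<subseteq> UNIV" "J \<noteq> {}" "finite J" and A: "A \<in> Pi J jump_algebra"
  have "\<exists>S. \<forall>j\<in>J. A j = {\<omega> \<in> space M. X 0 (Suc j) \<omega> - X 0 j \<omega> \<in> S j}"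
    using A unfolding jump_algebra_eq by (intro bchoice) blast
  then obtain S where S: "\<And>j. j \<in> J \<Longrightarrow> A j = {\<omega> \<in> space M. X 0 (Suc j) \<omega> - X 0 j \<omega> \<in> S j}" by blast
  obtain n where n: "J \<subseteq> {..<n}" using finite_nat_iff_bounded J(3) by blast
  define g where "g = (\<lambda>j e. if j \<in> J \<longrightarrow> e \<in> S j then 1 else 0 :: real)"
  have one: "(\<Sum>e\<in>directions. pmf (p 0) e * g j e) = 1" if "j \<notin> J" for j
    using that by (simp add: g_def sum_pmf_directions[OF steps])
  have single: "prob (A j) = (\<Sum>e\<in>directions. pmf (p 0) e * g j e)" if j: "j \<in> J" for j
  proof -
    have "prob (A j) = prob {\<omega> \<in> space M. (\<lambda>w. w ! j \<in> S j) (incr (walk0 \<omega>) (Suc j))}"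
      using S[OF j] by simp
    also have "\<dots> = avg (p 0) (Suc j) (\<lambda>w. if w ! j \<in> S j then 1 else 0)"
      by (rule prob_incr_pred)
    also have "\<dots> = avg (p 0) (Suc j) (\<lambda>w. \<Prod>i<Suc j. (if i = j then g j (w ! i) else 1))"
      by (intro avg_cong) (simp add: g_def j)
    also have "\<dots> = (\<Prod>i<Suc j. \<Sum>e\<in>directions. pmf (p 0) e * (if i = j then g j e else 1))"
      by (rule p0.avg_prod)
    also have "\<dots> = (\<Sum>e\<in>directions. pmf (p 0) e * g j e)"
      by (simp add: sum_pmf_directions[OF steps])
    finally show ?thesis .
  qed
  have "prob (\<Inter>j\<in>J. A j) = prob {\<omega> \<in> space M. (\<lambda>w. \<forall>j\<in>J. w ! j \<in> S j) (incr (walk0 \<omega>) n)}"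
  proof -
    have "(\<Inter>j\<in>J. A j) = {\<omega> \<in> space M. \<forall>j\<in>J. X 0 (Suc j) \<omega> - X 0 j \<omega> \<in> S j}"
      using S J(2) by auto
    also have "\<dots> = {\<omega> \<in> space M. (\<lambda>w. \<forall>j\<in>J. w ! j \<in> S j) (incr (walk0 \<omega>) n)}"
      using n by (intro Collect_cong conj_cong ball_cong refl) auto
    finally show ?thesis by simp
  qed
  also have "\<dots> = avg (p 0) n (\<lambda>w. if \<forall>j\<in>J. w ! j \<in> S j then 1 else 0)"
    by (rule prob_incr_pred)
  also have "\<dots> = avg (p 0) n (\<lambda>w. \<Prod>j<n. g j (w ! j))"
  proof (rule avg_cong)
    fix w :: "(int ^ 'd) list"
    show "(if \<forall>j\<in>J. w ! j \<in> S j then 1 else 0) = (\<Prod>j<n. g j (w ! j))"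
    proof (cases "\<forall>j\<in>J. w ! j \<in> S j")
      case False
      then obtain j where "j \<in> J" "w ! j \<notin> S j" by blast
      then have "j \<in> {..<n}" "g j (w ! j) = 0" using n by (auto simp: g_def)
      then show ?thesis using False by (subst prod_zero) auto
    qed (simp add: g_def)
  qed
  also have "\<dots> = (\<Prod>j<n. \<Sum>e\<in>directions. pmf (p 0) e * g j e)"
    by (rule p0.avg_prod)
  also have "\<dots> = (\<Prod>j\<in>J. \<Sum>e\<in>directions. pmf (p 0) e * g j e)"
    using n one by (intro prod.mono_neutral_right) auto
  also have "\<dots> = (\<Prod>j\<in>J. prob (A j))"
    by (simp add: single)
  finally show "prob (\<Inter>j\<in>J. A j) = (\<Prod>j\<in>J. prob (A j))" .
qed

text \<open>A cut of the walk restarted at time \<open>m\<close>: this depends only on the increments after \<open>m\<close>, and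
  almost surely the late cuts of the restarted walk are those of the walk itself.\<close>

definition restart_cut :: "nat \<Rightarrow> (nat \<Rightarrow> int ^ 'd) \<Rightarrow> nat \<Rightarrow> bool" where
  "restart_cut m x n \<longleftrightarrow> m \<le> n \<and> (\<forall>j\<in>{m..n}. x j $ k \<le> x n $ k) \<and> (\<forall>j\<in>{n<..}. x n $ k < x j $ k)"

definition tail_cuts :: "nat \<Rightarrow> 'a set" where
  "tail_cuts m = {\<omega> \<in> space M. \<forall>n0. \<exists>n\<ge>n0. restart_cut m (walk0 \<omega>) n}"

lemma tail_cuts_mono: "m \<le> m' \<Longrightarrow> tail_cuts m \<subseteq> tail_cuts m'"
proof
  fix \<omega> assume "m \<le> m'" "\<omega> \<in> tail_cuts m"
  then have "\<exists>n\<ge>n0. restart_cut m' (walk0 \<omega>) n" for n0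
  proof -
    obtain n where "n \<ge> max n0 m'" "restart_cut m (walk0 \<omega>) n"
      using \<open>\<omega> \<in> tail_cuts m\<close> unfolding tail_cuts_def by blast
    then show ?thesis using \<open>m \<le> m'\<close> unfolding restart_cut_def by (intro exI[of _ n]) auto
  qed
  then show "\<omega> \<in> tail_cuts m'" using \<open>\<omega> \<in> tail_cuts m\<close> unfolding tail_cuts_def by blast
qed

text \<open>\<open>tail_cuts m\<close> involves only the increments from \<open>m\<close> on and
  grows with \<open>m\<close>, so the union may start at any \<open>n\<close>.\<close>

lemma tail_cuts_tail: "(\<Union>m. tail_cuts m) \<in> tail_events jump_algebra"
  unfolding tail_events_def
proof
  fix n
  let ?U = "\<Union> (jump_algebra ` {n..})"
  define N where "N = sigma (space M) ?U"
  have U: "?U \<subseteq> Pow (space M)"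
    unfolding jump_algebra_eq by auto
  have sets_N: "sets N = sigma_sets (space M) ?U" and space_N [simp]: "space N = space M"
    using U by (simp_all add: N_def space_measure_of_conv)
  have jump: "(\<lambda>\<omega>. X 0 (Suc j) \<omega> - X 0 j \<omega>) \<in> measurable N (count_space UNIV)" if "n \<le> j" for j
  proof (rule measurableI)
    fix S assume "S \<in> sets (count_space (UNIV :: (int ^ 'd) set))"
    have "(\<lambda>\<omega>. X 0 (Suc j) \<omega> - X 0 j \<omega>) -` S \<inter> space N \<in> jump_algebra j"
      unfolding jump_algebra_eq by auto
    then show "(\<lambda>\<omega>. X 0 (Suc j) \<omega> - X 0 j \<omega>) -` S \<inter> space N \<in> sets N"
      unfolding sets_N using that by (intro sigma_sets.Basic) auto
  qed simp
  \<comment> \<open>Levels are compared through displacements from time \<open>n\<close>, because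
    the positions themselves also involve earlier increments.\<close>
  have disp: "(\<lambda>\<omega>. X 0 j \<omega> - X 0 n \<omega>) \<in> measurable N (count_space UNIV)" if "n \<le> j" for j
    using that
  proof (induction j rule: dec_induct)
    case (step j)
    have "(\<lambda>\<omega>. (X 0 j \<omega> - X 0 n \<omega>) + (X 0 (Suc j) \<omega> - X 0 j \<omega>)) \<in> measurable N (count_space UNIV)"
      using step by (intro measurable_countable_fun2[where h = "\<lambda>a b. a + b"] jump) auto
    then show ?case by simp
  qed simp
  have pred: "Measurable.pred N (\<lambda>\<omega>. X 0 i \<omega> $ k \<le> X 0 j \<omega> $ k)"
     "Measurable.pred N (\<lambda>\<omega>. X 0 i \<omega> $ k < X 0 j \<omega> $ k)" if "n \<le> i" "n \<le> j" for i j
    using measurable_countable_fun2[OF disp[OF that(1)] disp[OF that(2)], where h = "\<lambda>a b. a $ k \<le> b $ k"]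
      measurable_countable_fun2[OF disp[OF that(1)] disp[OF that(2)], where h = "\<lambda>a b. a $ k < b $ k"]
    by auto
  have "tail_cuts m \<in> sets N" if m: "n \<le> m" for m
  proof -
    have cut: "Measurable.pred N (\<lambda>\<omega>. restart_cut m (walk0 \<omega>) l)" for l
    proof (cases "m \<le> l")
      case True
      have "Measurable.pred N (\<lambda>\<omega>. (\<forall>j\<in>{m..l}. X 0 j \<omega> $ k \<le> X 0 l \<omega> $ k) \<and> (\<forall>j\<in>{l<..}. X 0 l \<omega> $ k < X 0 j \<omega> $ k))"
        using m True by (intro pred_intros_logic pred_intros_countable pred_intros_countable_bounded pred) auto
      then show ?thesis using True by (simp add: restart_cut_def)
    qed (simp add: restart_cut_def)
    have "{\<omega> \<in> space N. \<forall>n0. \<exists>l. l \<ge> n0 \<and> restart_cut m (walk0 \<omega>) l} \<in> sets N"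
      using cut by measurable
    then show ?thesis unfolding space_N tail_cuts_def .
  qed
  then have "(\<Union>m\<in>{n..}. tail_cuts m) \<in> sets N"
    by (intro sets.countable_UN'') (simp, blast)
  moreover have "(\<Union>m. tail_cuts m) = (\<Union>m\<in>{n..}. tail_cuts m)"
  proof (intro equalityI UN_least)
    show "tail_cuts m \<subseteq> (\<Union>m\<in>{n..}. tail_cuts m)" for m
      using tail_cuts_mono[of m "max m n"] by (intro subset_trans[OF _ UN_upper[of "max m n"]]) auto
  qed blast
  ultimately show "(\<Union>m. tail_cuts m) \<in> sigma_sets (space M) ?U"
    by (simp only: sets_N)
qed

text \<open>Each time is a cut with probability at least \<open>cut_bound\<close>, so by continuity
  from above infinitely many cuts occur with at least this probability; the zero-one law raises it
  to 1 for the restarted walk.\<close>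

lemma AE_infinite_cuts: "AE \<omega> in M. infinite {n. is_cut k (walk0 \<omega>) n}"
proof -
  let ?C = "\<lambda>n. {\<omega> \<in> space M. is_cut k (walk0 \<omega>) n}"
  let ?T = "\<Union>m. tail_cuts m"
  have tail0: "tail_cuts 0 = {\<omega> \<in> space M. \<forall>n0. \<exists>n\<ge>n0. is_cut k (walk0 \<omega>) n}"
  proof -
    have "restart_cut 0 x n = is_cut k x n" for x n
      unfolding restart_cut_def is_cut_def by (simp add: Ball_def)
    then show ?thesis unfolding tail_cuts_def by simp
  qed
  have meas0: "tail_cuts 0 \<in> sets M" unfolding tail0 by measurable
  have T: "?T \<in> sets M"
    using tail_events_sets[of jump_algebra] tail_cuts_tail indep_jumps unfolding indep_sets_def by blast
  have "prob ?T = 0 \<or> prob ?T = 1"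
  proof (rule kolmogorov_0_1_law[OF _ indep_jumps tail_cuts_tail])
    show "sigma_algebra (space M) (jump_algebra i)" for i
      using sets.sigma_algebra_axioms[of "vimage_algebra (space M) (\<lambda>\<omega>. X 0 (Suc i) \<omega> - X 0 i \<omega>) (count_space UNIV)"]
      by simp
  qed
  moreover have "0 < prob ?T"
  proof -
    have "(\<lambda>n0. prob (\<Union>n\<in>{n0..}. ?C n)) \<longlonglongrightarrow> prob (\<Inter>n0. \<Union>n\<in>{n0..}. ?C n)"
    proof (rule finite_Lim_measure_decseq)
      show "decseq (\<lambda>n0. \<Union>n\<in>{n0..}. ?C n)"
        unfolding decseq_def by (intro allI impI UN_mono) auto
    qed auto
    moreover have "cut_bound \<le> prob (\<Union>n\<in>{n0..}. ?C n)" for n0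
    proof -
      have "cut_bound \<le> prob (?C n0)" by (rule prob_is_cut)
      also have "\<dots> \<le> prob (\<Union>n\<in>{n0..}. ?C n)"
        by (intro finite_measure_mono) auto
      finally show ?thesis .
    qed
    ultimately have "cut_bound \<le> prob (\<Inter>n0. \<Union>n\<in>{n0..}. ?C n)"
      by (intro LIMSEQ_le_const) blast+
    also have "(\<Inter>n0. \<Union>n\<in>{n0..}. ?C n) = tail_cuts 0"
      unfolding tail0 by auto
    also have "prob (tail_cuts 0) \<le> prob ?T"
      using T by (intro finite_measure_mono) auto
    finally show ?thesis using cut_bound_pos by simp
  qed
  ultimately have "AE \<omega> in M. \<omega> \<in> ?T"
    using T by (intro AE_prob_1) auto
  then show ?thesis
    using AE_level_at_top
  proof eventually_elim
    case (elim \<omega>)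
    then obtain m where m: "\<And>n0. \<exists>n\<ge>n0. restart_cut m (walk0 \<omega>) n"
      unfolding tail_cuts_def by blast
    \<comment> \<open>Once the level has passed its maximum over the first \<open>m\<close> times,
      every cut of the restarted walk is a cut of the walk itself.\<close>
    define c where "c = Max (insert 0 ((\<lambda>j. X 0 j \<omega> $ k) ` {..<m}))"
    have c: "X 0 j \<omega> $ k \<le> c" if "j < m" for j
      unfolding c_def using that by (intro Max_ge) auto
    obtain N where N: "\<And>n. n \<ge> N \<Longrightarrow> real_of_int c \<le> real_of_int (X 0 n \<omega> $ k)"
      using elim(2) unfolding filterlim_at_top eventually_sequentially by blast
    show ?case
      unfolding infinite_nat_iff_unbounded_le
    proof
      fix n0
      obtain n where n: "n \<ge> max n0 N" "restart_cut m (walk0 \<omega>) n" using m by blast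
      have "X 0 j \<omega> $ k \<le> X 0 n \<omega> $ k" if "j \<le> n" for j
      proof (cases "j < m")
        case True
        then show ?thesis using c[OF True] N[of n] n(1) by simp
      next
        case False
        then show ?thesis using n(2) that unfolding restart_cut_def by simp
      qed
      then have "is_cut k (walk0 \<omega>) n"
        using n(2) unfolding is_cut_def restart_cut_def by simp
      then show "\<exists>n\<ge>n0. n \<in> {n. is_cut k (walk0 \<omega>) n}" using n(1) by auto
    qed
  qed
qed

end

section \<open>Bare segments\<close>

text \<open>The edges are prescribed as soon as they touch \<open>B\<close>, not only inside
  \<open>B\<close>. This makes segments belonging to different sets comparable.\<close>

definition segment :: "('d::finite) graph \<Rightarrow> (int ^ 'd) set \<Rightarrow> (int ^ 'd) list \<Rightarrow> bool" where
  "segment Z B g \<longleftrightarrow> distinct g \<and> g \<noteq> [] \<and> g ! 0 = 0 \<and> (\<forall>k. Suc k < length g \<longrightarrow> g ! k \<in> B) \<and>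
     (\<forall>f. f \<inter> B \<noteq> {} \<longrightarrow> (f \<in> snd Z \<longleftrightarrow> (\<exists>k. Suc k < length g \<and> f = {g ! k, g ! Suc k}))) \<and>
     fst Z \<inter> B \<subseteq> set g \<and> set g \<subseteq> fst Z"

lemma segmentD:
  assumes "segment Z B g"
  shows "distinct g" "g ! 0 = 0" "Suc k < length g \<Longrightarrow> g ! k \<in> B"
    "Suc k < length g \<Longrightarrow> {g ! k, g ! Suc k} \<in> snd Z"
    "f \<in> snd Z \<Longrightarrow> f \<inter> B \<noteq> {} \<Longrightarrow> \<exists>k. Suc k < length g \<and> f = {g ! k, g ! Suc k}"
    "a \<in> fst Z \<Longrightarrow> a \<in> B \<Longrightarrow> a \<in> set g" "k < length g \<Longrightarrow> g ! k \<in> fst Z"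
proof -
  have *: "\<forall>f. f \<inter> B \<noteq> {} \<longrightarrow> (f \<in> snd Z \<longleftrightarrow> (\<exists>k. Suc k < length g \<and> f = {g ! k, g ! Suc k}))"
    "\<forall>k. Suc k < length g \<longrightarrow> g ! k \<in> B"
    using assms unfolding segment_def by blast+
  show "distinct g" "g ! 0 = 0" "Suc k < length g \<Longrightarrow> g ! k \<in> B"
    "f \<in> snd Z \<Longrightarrow> f \<inter> B \<noteq> {} \<Longrightarrow> \<exists>k. Suc k < length g \<and> f = {g ! k, g ! Suc k}"
    "a \<in> fst Z \<Longrightarrow> a \<in> B \<Longrightarrow> a \<in> set g" 
    using assms unfolding segment_def by blast+
  show "{g ! k, g ! Suc k} \<in> snd Z" if "Suc k < length g"
  proof -
    have "{g ! k, g ! Suc k} \<inter> B \<noteq> {}" using *(2) that by blast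
    then show ?thesis using *(1) that by blast
  qed
  show "k < length g \<Longrightarrow> g ! k \<in> fst Z"
    using assms nth_mem[of k g] unfolding segment_def by blast
qed

text \<open>Both lists start at 0. At a common vertex the next edge of \<open>g2\<close> must also
  be an edge of \<open>g1\<close>, and it cannot lead back to the predecessor because
  \<open>g2\<close> is distinct.\<close>

lemma segments_agree:
  assumes 1: "segment Z B1 g1" and 2: "segment Z B2 g2"
  shows "k < length g1 \<Longrightarrow> k < length g2 \<Longrightarrow> g1 ! k = g2 ! k"
proof (induction k rule: less_induct)
  case (less k)
  show ?case
  proof (cases k)
    case 0
    then show ?thesis using segmentD(2)[OF 1] segmentD(2)[OF 2] by simp
  next
    case (Suc j)
    have j: "Suc j < length g1" "Suc j < length g2" using less Suc by auto
    have eq: "g1 ! j = g2 ! j" using less Suc by auto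
    have "{g2 ! j, g2 ! Suc j} \<in> snd Z" by (rule segmentD(4)[OF 2 j(2)])
    moreover have "{g2 ! j, g2 ! Suc j} \<inter> B1 \<noteq> {}"
      using segmentD(3)[OF 1 j(1)] eq by auto
    ultimately obtain a where a: "Suc a < length g1" "{g2 ! j, g2 ! Suc j} = {g1 ! a, g1 ! Suc a}"
      using segmentD(5)[OF 1] by blast
    then consider "g1 ! j = g1 ! a" "g2 ! Suc j = g1 ! Suc a" | "g1 ! j = g1 ! Suc a" "g2 ! Suc j = g1 ! a"
      unfolding eq doubleton_eq_iff by blast
    then show ?thesis
    proof cases
      case 1
      then have "j = a" using nth_eq_iff_index_eq[OF segmentD(1)[OF assms(1)], of j a] j a(1) by simp
      then show ?thesis using 1 Suc by simp
    next
      case 2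
      then have "j = Suc a" using nth_eq_iff_index_eq[OF segmentD(1)[OF assms(1)], of j "Suc a"] j a(1) by simp
      then have "g1 ! a = g2 ! a" "a < length g2" using less Suc a j by auto
      then have "Suc j = a" using 2(2) nth_eq_iff_index_eq[OF segmentD(1)[OF assms(2)], of "Suc j" a] j by simp
      then show ?thesis using \<open>j = Suc a\<close> by simp
    qed
  qed
qed

text \<open>All segments are initial pieces of one path, which is read off along the diagonal
  \<open>g n ! n\<close>; it is infinite because there are arbitrarily long segments.\<close>

lemma is_simple_path_segments:
  assumes lattice: "is_lattice Z"
    and S: "\<And>B g. (B, g) \<in> S \<Longrightarrow> segment Z B g"
    and long: "\<And>n. \<exists>B g. (B, g) \<in> S \<and> n < length g"
    and vert: "\<And>a. a \<in> fst Z \<Longrightarrow> \<exists>B g. (B, g) \<in> S \<and> a \<in> B"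
    and edge: "\<And>f. f \<in> snd Z \<Longrightarrow> \<exists>B g. (B, g) \<in> S \<and> f \<inter> B \<noteq> {}"
  shows "is_simple_path Z"
proof -
  obtain B g where Bg: "\<And>n. (B n, g n) \<in> S" "\<And>n. n < length (g n)"
    using long by metis
  define \<pi> where "\<pi> = (\<lambda>n. g n ! n)"
  have \<pi>: "\<pi> n = h ! n" if "(C, h) \<in> S" "n < length h" for n C h
    unfolding \<pi>_def by (rule segments_agree[OF S[OF Bg(1)] S[OF that(1)] Bg(2) that(2)])
  have edge\<pi>: "{\<pi> n, \<pi> (Suc n)} \<in> snd Z" for n
    using segmentD(4)[OF S[OF Bg(1)] Bg(2)[of "Suc n"]] 
      \<pi>[OF Bg(1)[of "Suc n"] Suc_lessD[OF Bg(2)[of "Suc n"]]] by (simp add: \<pi>_def)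
  show ?thesis
    unfolding is_simple_path_def
  proof (intro exI[of _ \<pi>] conjI allI)
    show "inj \<pi>"
    proof (rule linorder_injI)
      fix m n :: nat assume "m < n"
      then have "m < length (g n)" "n < length (g n)" using Bg(2)[of n] by auto
      then have "\<pi> m = g n ! m" "\<pi> n = g n ! n" using \<pi>[OF Bg(1)] by auto
      then show "\<pi> m \<noteq> \<pi> n"
        using nth_eq_iff_index_eq[OF segmentD(1)[OF S[OF Bg(1)]], of m n n] \<open>m < length (g n)\<close> \<open>n < length (g n)\<close> \<open>m < n\<close>
        by simp
    qed
    show "\<pi> 0 = 0" unfolding \<pi>_def by (rule segmentD(2)[OF S[OF Bg(1)]])
    show "\<pi> (Suc n) - \<pi> n \<in> directions" for n
      using edge\<pi> lattice unfolding is_lattice_def by blast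
    have "fst Z = range \<pi>"
    proof (intro equalityI subsetI)
      fix a assume a: "a \<in> fst Z"
      then obtain C h where Ch: "(C, h) \<in> S" "a \<in> C" using vert by blast
      then have "a \<in> set h" using segmentD(6)[OF S] a by blast
      then obtain n where "n < length h" "h ! n = a" by (auto simp: in_set_conv_nth)
      then show "a \<in> range \<pi>" using \<pi>[OF Ch(1)] by (metis rangeI)
    next
      fix a assume "a \<in> range \<pi>"
      then obtain n where "a = g n ! n" by (auto simp: \<pi>_def)
      then show "a \<in> fst Z" using segmentD(7)[OF S[OF Bg(1)] Bg(2)[of n]] by simp
    qed
    moreover have "snd Z = range (\<lambda>n. {\<pi> n, \<pi> (Suc n)})"
    proof (intro equalityI subsetI)
      fix f assume f: "f \<in> snd Z"
      then obtain C h where Ch: "(C, h) \<in> S" "f \<inter> C \<noteq> {}" using edge by blast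
      then obtain n where n: "Suc n < length h" "f = {h ! n, h ! Suc n}"
        using segmentD(5)[OF S[OF Ch(1)] f] by blast
      then have "f = {\<pi> n, \<pi> (Suc n)}" using \<pi>[OF Ch(1), of n] \<pi>[OF Ch(1), of "Suc n"] by simp
      then show "f \<in> range (\<lambda>n. {\<pi> n, \<pi> (Suc n)})" by blast
    next
      fix f assume "f \<in> range (\<lambda>n. {\<pi> n, \<pi> (Suc n)})"
      then show "f \<in> snd Z" using edge\<pi> by blast
    qed
    ultimately show "Z = trace_graph \<pi>" by (simp add: trace_graph_def prod_eq_iff)
  qed
qed

lemma direction_le_1: "e \<in> directions \<Longrightarrow> e $ k \<le> 1"
  by (auto simp: directions_def axis_def)

section \<open>Bare segments fix the limit graph\<close>

context directed_walks
begin

lemma regular_graph: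
  assumes "regular \<omega>" "{a, b} \<in> snd (walk_graph X i \<omega>)"
  shows "a \<in> fst (walk_graph X i \<omega>)" "b \<in> fst (walk_graph X i \<omega>)"
proof -
  show "a \<in> fst (walk_graph X i \<omega>)" "b \<in> fst (walk_graph X i \<omega>)"
    using assms(2) by (cases i; auto simp: lattice_graph_def trace_graph_def doubleton_eq_iff)+
qed

text \<open>Levels separate the sites visited up to time \<open>n\<close> from those visited
  afterwards, so membership in the image of \<open>{..n}\<close> can be read off the time. Later
  graphs inherit the property as subgraphs.\<close>

lemma cut_boundary_edge:
  assumes cut: "is_cut k (walk0 \<omega>) n" and i: "regular \<omega>" "1 \<le> i"
  shows "boundary_edge (walk_graph X i \<omega>) (walk0 \<omega> ` {..n}) (X 0 n \<omega>) (X 0 (Suc n) \<omega>)"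
  unfolding boundary_edge_def
proof (intro conjI allI impI)
  have low: "X 0 j \<omega> $ k \<le> X 0 n \<omega> $ k" if "j \<le> n" for j
    using cut that unfolding is_cut_def by blast
  have high: "X 0 n \<omega> $ k < X 0 j \<omega> $ k" if "n < j" for j
    using cut that unfolding is_cut_def by blast
  have B: "X 0 j \<omega> \<in> walk0 \<omega> ` {..n} \<longleftrightarrow> j \<le> n" for j
  proof
    assume "X 0 j \<omega> \<in> walk0 \<omega> ` {..n}"
    then obtain l where "l \<le> n" "X 0 j \<omega> = X 0 l \<omega>" by auto
    then show "j \<le> n" using low[of l] high[of j] by (cases "n < j") auto
  qed auto
  show "X 0 n \<omega> \<in> walk0 \<omega> ` {..n}" "X 0 (Suc n) \<omega> \<notin> walk0 \<omega> ` {..n}"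
    unfolding B by simp_all
  fix a b assume ab: "{a, b} \<in> snd (walk_graph X i \<omega>)" "a \<in> walk0 \<omega> ` {..n}" "b \<notin> walk0 \<omega> ` {..n}"
  then have "{a, b} \<in> snd (walk_graph X (Suc 0) \<omega>)"
    using regularD(6)[OF i(1), of "Suc 0" i] i(2) by auto
  then obtain j where "{a, b} = {X 0 j \<omega>, X 0 (Suc j) \<omega>}"
    by (auto simp: trace_graph_def)
  then consider "a = X 0 j \<omega>" "b = X 0 (Suc j) \<omega>" | "a = X 0 (Suc j) \<omega>" "b = X 0 j \<omega>"
    unfolding doubleton_eq_iff by blast
  then have "a = X 0 n \<omega> \<and> b = X 0 (Suc n) \<omega>"
  proof cases
    case 1
    then have "j \<le> n" "\<not> Suc j \<le> n" using ab(2,3) unfolding 1 B by simp_all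
    then have "j = n" by simp
    then show ?thesis using 1 by simp
  next
    case 2
    then have "Suc j \<le> n" "\<not> j \<le> n" using ab(2,3) unfolding 2 B by simp_all
    then show ?thesis by simp
  qed
  then show "a = X 0 n \<omega>" "b = X 0 (Suc n) \<omega>" by simp_all
qed

text \<open>The \<open>i\<close>-th walk crosses \<open>B\<close> along the self-avoiding path \<open>g\<close> and does not come back.\<close>

definition bare :: "(int ^ 'd) set \<Rightarrow> int ^ 'd \<Rightarrow> (int ^ 'd) list \<Rightarrow> nat \<Rightarrow> 'a \<Rightarrow> bool" where
  "bare B u g i \<omega> \<longleftrightarrow> distinct g \<and> 2 \<le> length g \<and> (\<forall>j. Suc j < length g \<longrightarrow> g ! j \<in> B) \<and> last g \<notin> B \<and>
     (\<forall>j<length g. X i j \<omega> = g ! j) \<and> (\<forall>j\<ge>length g - 1. X i j \<omega> \<noteq> u)"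

text \<open>The trace of walk \<open>i\<close> has no edge at \<open>B\<close> except those of
  \<open>g\<close>, since the walk does not return. All later walks are confined to this path near
  0, and being infinite they must traverse every edge of it.\<close>

lemma bare_segment:
  assumes reg: "regular \<omega>" and bd: "boundary_edge (walk_graph X i \<omega>) B u v"
    and bare: "bare B u g i \<omega>"
  shows "segment (limit_graph X \<omega>) B g"
proof -
  define m where "m = length g - 1"
  have g: "distinct g" "length g = Suc m" "0 < m" "\<And>j. j < m \<Longrightarrow> g ! j \<in> B" "g ! m \<notin> B"
    "\<And>j. j \<le> m \<Longrightarrow> X i j \<omega> = g ! j" "\<And>j. m \<le> j \<Longrightarrow> X i j \<omega> \<noteq> u"
  proof -
    have "g \<noteq> []" "2 \<le> length g" using bare unfolding bare_def by auto
    then show "distinct g" "length g = Suc m" "0 < m" "\<And>j. j < m \<Longrightarrow> g ! j \<in> B" "g ! m \<notin> B"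
        "\<And>j. j \<le> m \<Longrightarrow> X i j \<omega> = g ! j" "\<And>j. m \<le> j \<Longrightarrow> X i j \<omega> \<noteq> u"
      using bare unfolding bare_def m_def by (auto simp: last_conv_nth)
  qed
  have g0: "g ! 0 = 0" using g(6)[of 0] regularD(1)[OF reg, of i] by simp
  \<comment> \<open>A return to \<open>B\<close> would use the boundary edge backwards and hence hit
    \<open>u\<close>.\<close>
  have late: "X i j \<omega> \<notin> B" if "m \<le> j" for j
    using that
  proof (induction j rule: dec_induct)
    case base
    then show ?case using g(5,6) by simp
  next
    case (step j)
    show ?case
    proof
      assume "X i (Suc j) \<omega> \<in> B"
      moreover have "{X i (Suc j) \<omega>, X i j \<omega>} \<in> snd (walk_graph X i \<omega>)"
        using regularD(2)[OF reg, of i j] by (simp add: insert_commute)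
      ultimately have "X i (Suc j) \<omega> = u"
        using bd step unfolding boundary_edge_def by blast
      then show False using g(7)[of "Suc j"] step by simp
    qed
  qed
  have sub: "\<exists>j<m. f = {g ! j, g ! Suc j}" if f: "f \<in> snd (walk_graph X (Suc i) \<omega>)" "f \<inter> B \<noteq> {}" for f
  proof -
    obtain j where j: "f = {X i j \<omega>, X i (Suc j) \<omega>}" using f(1) by (auto simp: trace_graph_def)
    have "j < m" using late[of j] late[of "Suc j"] f(2) unfolding j by (cases "m \<le> j") auto
    then have "f = {g ! j, g ! Suc j}" using g(6)[of j] g(6)[of "Suc j"] j by simp
    then show ?thesis using \<open>j < m\<close> by blast
  qed
  have sup: "{g ! j, g ! Suc j} \<in> snd (walk_graph X l \<omega>)" if j: "j < m" and l: "Suc i \<le> l" for j l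
  proof (rule ccontr)
    assume no: "{g ! j, g ! Suc j} \<notin> snd (walk_graph X l \<omega>)"
    \<comment> \<open>A missing edge would hold walk \<open>l\<close> among the first
      \<open>Suc j\<close> vertices of \<open>g\<close>, contradicting its infinite range.\<close>
    have "X l t \<omega> \<in> (\<lambda>a. g ! a) ` {..j}" for t
    proof (induction t)
      case 0
      then show ?case using regularD(1)[OF reg, of l] g0 by force
    next
      case (Suc t)
      then obtain a where a: "a \<le> j" "X l t \<omega> = g ! a" by auto
      have e: "{X l t \<omega>, X l (Suc t) \<omega>} \<in> snd (walk_graph X l \<omega>)" by (rule regularD(2)[OF reg])
      then have "{X l t \<omega>, X l (Suc t) \<omega>} \<in> snd (walk_graph X (Suc i) \<omega>)"
        using regularD(6)[OF reg l] by blast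
      moreover have "{X l t \<omega>, X l (Suc t) \<omega>} \<inter> B \<noteq> {}" using a g(4)[of a] j by auto
      ultimately obtain b where b: "b < m" "{X l t \<omega>, X l (Suc t) \<omega>} = {g ! b, g ! Suc b}" using sub by blast
      then consider "X l t \<omega> = g ! b" "X l (Suc t) \<omega> = g ! Suc b" | "X l t \<omega> = g ! Suc b" "X l (Suc t) \<omega> = g ! b"
        unfolding doubleton_eq_iff by blast
      then show ?case
      proof cases
        case 1
        then have "a = b" using a b(1) j nth_eq_iff_index_eq[OF g(1), of a b] g(2) by simp
        moreover have "b \<noteq> j" using no e b(2) by auto
        ultimately show ?thesis using 1 a by auto
      next
        case 2
        then have "a = Suc b" using a b(1) j nth_eq_iff_index_eq[OF g(1), of a "Suc b"] g(2) by simp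
        then show ?thesis using 2 a by auto
      qed
    qed
    then have "range (\<lambda>t. X l t \<omega>) \<subseteq> (\<lambda>a. g ! a) ` {..j}" by blast
    then show False using regularD(3)[OF reg, of l] finite_subset by blast
  qed
  have sup': "{g ! j, g ! Suc j} \<in> snd (walk_graph X l \<omega>)" if j: "j < m" for j l
    using sup[OF j max.cobounded1[of "Suc i" l]] regularD(6)[OF reg max.cobounded2[of l "Suc i"]] by blast
  have lim: "snd (limit_graph X \<omega>) = (\<Inter>i. snd (walk_graph X i \<omega>))" "fst (limit_graph X \<omega>) = (\<Inter>i. fst (walk_graph X i \<omega>))"
    by (simp_all add: limit_graph_def)
  show ?thesis
    unfolding segment_def
  proof (intro conjI allI impI)
    show "distinct g" "g \<noteq> []" "g ! 0 = 0" using g g0 by auto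
    show "g ! j \<in> B" if "Suc j < length g" for j using that g by simp
    show "f \<in> snd (limit_graph X \<omega>) \<longleftrightarrow> (\<exists>j. Suc j < length g \<and> f = {g ! j, g ! Suc j})" if "f \<inter> B \<noteq> {}" for f
    proof
      assume "f \<in> snd (limit_graph X \<omega>)"
      then have "f \<in> snd (walk_graph X (Suc i) \<omega>)" unfolding lim by blast
      then show "\<exists>j. Suc j < length g \<and> f = {g ! j, g ! Suc j}"
        using sub[OF _ that] g(2) by auto
    next
      assume "\<exists>j. Suc j < length g \<and> f = {g ! j, g ! Suc j}"
      then show "f \<in> snd (limit_graph X \<omega>)" unfolding lim using sup' g(2) by auto
    qed
    show "fst (limit_graph X \<omega>) \<inter> B \<subseteq> set g"
    proof
      fix a assume a: "a \<in> fst (limit_graph X \<omega>) \<inter> B"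
      then have "a \<in> fst (walk_graph X (Suc i) \<omega>)" unfolding lim by blast
      then obtain j where j: "a = X i j \<omega>" by (auto simp: trace_graph_def)
      then have "j < m" using late[of j] a by (cases "m \<le> j") auto
      then show "a \<in> set g" using j g(6)[of j] g(2) by auto
    qed
    show "set g \<subseteq> fst (limit_graph X \<omega>)"
    proof
      fix a assume "a \<in> set g"
      then obtain j where j: "j \<le> m" "a = g ! j" using g(2) by (metis in_set_conv_nth less_Suc_eq_le)
      have "a \<in> fst (walk_graph X l \<omega>)" for l
      proof (cases "j < m")
        case True
        then show ?thesis using regular_graph(1)[OF reg sup'] j by blast
      next
        case False
        then have "Suc (m - 1) = j" using j g(3) by simp
        then show ?thesis using regular_graph(2)[OF reg sup'[of "m - 1" l]] g(3) j by simp
      qed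
      then show "a \<in> fst (limit_graph X \<omega>)" unfolding lim by blast
    qed
  qed
qed

lemma is_simple_path_limit:
  assumes reg: "regular \<omega>"
    and cuts: "\<And>c. \<exists>n. is_cut k (walk0 \<omega>) n \<and> c < X 0 n \<omega> $ k"
    and bare: "\<And>n. is_cut k (walk0 \<omega>) n \<Longrightarrow> \<exists>i g. 1 \<le> i \<and> bare (walk0 \<omega> ` {..n}) (X 0 n \<omega>) g i \<omega>"
  shows "is_simple_path (limit_graph X \<omega>)"
proof -
  let ?Z = "limit_graph X \<omega>"
  define S where "S = {(walk0 \<omega> ` {..n}, g) | n g. is_cut k (walk0 \<omega>) n \<and> segment ?Z (walk0 \<omega> ` {..n}) g}"
  have ex: "\<exists>i g. bare (walk0 \<omega> ` {..n}) (X 0 n \<omega>) g i \<omega> \<and> (walk0 \<omega> ` {..n}, g) \<in> S" if n: "is_cut k (walk0 \<omega>) n" for n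
  proof -
    obtain i g where ig: "1 \<le> i" "bare (walk0 \<omega> ` {..n}) (X 0 n \<omega>) g i \<omega>" using bare[OF n] by blast
    have "segment ?Z (walk0 \<omega> ` {..n}) g"
      by (rule bare_segment[OF reg cut_boundary_edge[OF n reg ig(1)] ig(2)])
    then show ?thesis using n ig(2) unfolding S_def by blast
  qed
  have segS: "segment ?Z B g" if "(B, g) \<in> S" for B g using that unfolding S_def by blast
  have big: "\<exists>n. is_cut k (walk0 \<omega>) n \<and> t \<le> n" for t
  proof -
    define c where "c = Max ((\<lambda>j. X 0 j \<omega> $ k) ` {..t})"
    obtain n where n: "is_cut k (walk0 \<omega>) n" "c < X 0 n \<omega> $ k" using cuts by blast
    have "t \<le> n"
    proof (rule ccontr)
      assume "\<not> t \<le> n"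
      then have "X 0 n \<omega> $ k \<le> c" unfolding c_def by (intro Max_ge) auto
      then show False using n by simp
    qed
    then show ?thesis using n by blast
  qed
  have lim: "snd ?Z = (\<Inter>i. snd (walk_graph X i \<omega>))" "fst ?Z = (\<Inter>i. fst (walk_graph X i \<omega>))"
    by (simp_all add: limit_graph_def)
  show ?thesis
  proof (rule is_simple_path_segments)
    show "is_lattice ?Z"
      using regularD(4)[OF reg, of 0] unfolding is_lattice_def lim by blast
    show "segment ?Z B g" if "(B, g) \<in> S" for B g by (rule segS[OF that])
    show "\<exists>B g. (B, g) \<in> S \<and> n < length g" for n
    proof -
      obtain t where t: "is_cut k (walk0 \<omega>) t" "int n < X 0 t \<omega> $ k" using cuts by blast
      obtain i g where i: "bare (walk0 \<omega> ` {..t}) (X 0 t \<omega>) g i \<omega>" and g: "(walk0 \<omega> ` {..t}, g) \<in> S"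
        using ex[OF t(1)] by blast
      \<comment> \<open>One step raises the level by at most 1, so a crossing that ends at a cut of
        level above \<open>n\<close> has more than \<open>n\<close> vertices.\<close>
      have lev: "j < length g \<Longrightarrow> (g ! j) $ k \<le> int j" for j
      proof (induction j)
        case 0
        then show ?case using i regularD(1)[OF reg, of i] unfolding bare_def by force
      next
        case (Suc j)
        have "X i (Suc j) \<omega> - X i j \<omega> \<in> directions" by (rule regularD(5)[OF reg])
        then have "(X i (Suc j) \<omega> - X i j \<omega>) $ k \<le> 1" by (rule direction_le_1)
        moreover have "X i (Suc j) \<omega> = g ! Suc j" "X i j \<omega> = g ! j" using i Suc.prems unfolding bare_def by auto
        ultimately show ?case using Suc by simp
      qed
      have "last g \<notin> walk0 \<omega> ` {..t}" "2 \<le> length g" using i unfolding bare_def by auto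
      define m where "m = length g - 2"
      have m: "length g = Suc (Suc m)" using \<open>2 \<le> length g\<close> by (simp add: m_def)
      have e: "{g ! m, g ! Suc m} \<in> snd (walk_graph X (Suc 0) \<omega>)"
      proof -
        have "segment ?Z (walk0 \<omega> ` {..t}) g" by (rule segS[OF g])
        then have "{g ! m, g ! Suc m} \<in> snd ?Z" by (rule segmentD(4)) (simp add: m)
        then show ?thesis unfolding lim by (rule INT_D) simp
      qed
      have gm: "g ! m \<in> walk0 \<omega> ` {..t}" "g ! Suc m \<notin> walk0 \<omega> ` {..t}"
      proof -
        have "g \<noteq> []" using m by auto
        then have "last g = g ! Suc m" using m by (simp add: last_conv_nth)
        then show "g ! m \<in> walk0 \<omega> ` {..t}" "g ! Suc m \<notin> walk0 \<omega> ` {..t}"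
          using i m unfolding bare_def by simp_all
      qed
      have "g ! m = X 0 t \<omega>"
      proof -
        have "boundary_edge (walk_graph X (Suc 0) \<omega>) (walk0 \<omega> ` {..t}) (X 0 t \<omega>) (X 0 (Suc t) \<omega>)"
          by (rule cut_boundary_edge[OF t(1) reg]) simp
        then show ?thesis using e gm unfolding boundary_edge_def by blast
      qed
      then have "int n < int m" using lev[of m] t(2) m by simp
      then show ?thesis using g m by (intro exI[of _ "walk0 \<omega> ` {..t}"] exI[of _ g]) simp
    qed
    show "\<exists>B g. (B, g) \<in> S \<and> a \<in> B" if a: "a \<in> fst ?Z" for a
    proof -
      have "a \<in> fst (walk_graph X (Suc 0) \<omega>)" using a unfolding lim by blast
      then obtain t where t: "a = X 0 t \<omega>" by (auto simp: trace_graph_def)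
      obtain n where n: "is_cut k (walk0 \<omega>) n" "t \<le> n" using big by blast
      then show ?thesis using ex[OF n(1)] t by blast
    qed
    show "\<exists>B g. (B, g) \<in> S \<and> f \<inter> B \<noteq> {}" if f: "f \<in> snd ?Z" for f
    proof -
      have "f \<in> snd (walk_graph X (Suc 0) \<omega>)" using f unfolding lim by blast
      then obtain t where t: "f = {X 0 t \<omega>, X 0 (Suc t) \<omega>}" by (auto simp: trace_graph_def)
      obtain n where n: "is_cut k (walk0 \<omega>) n" "t \<le> n" using big by blast
      then show ?thesis using ex[OF n(1)] t by blast
    qed
  qed
qed

end

section \<open>Bare segments occur almost surely\<close>

lemma borel_measurable_countable_fun2:
  fixes f :: "'a \<Rightarrow> 'b::countable" and g :: "'a \<Rightarrow> 'c::countable" and h :: "'b \<Rightarrow> 'c \<Rightarrow> real"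
  assumes "f \<in> measurable N (count_space UNIV)" and "g \<in> measurable N (count_space UNIV)"
  shows "(\<lambda>\<omega>. h (f \<omega>) (g \<omega>)) \<in> borel_measurable N"
  by (rule measurable_compose_countable[OF _ assms(1)], rule measurable_compose[OF assms(2)]) simp

lemma pred_le_const: "f \<in> borel_measurable N \<Longrightarrow> Measurable.pred N (\<lambda>\<omega>. f \<omega> \<le> (c :: real))"
  by measurable

context step_law
begin

definition pmin :: real where
  "pmin = Min (pmf q ` directions)"

lemma pmin: "0 < pmin" "pmin \<le> 1" "e \<in> directions \<Longrightarrow> pmin \<le> pmf q e"
proof -
  have ne: "(directions :: (int ^ 'd) set) \<noteq> {}" by (auto simp: directions_def)
  have "pmin \<in> pmf q ` directions" unfolding pmin_def using ne by (intro Min_in) auto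
  then obtain d where "d \<in> directions" "pmin = pmf q d" by blast
  then show "0 < pmin" "pmin \<le> 1" using pos pmf_le_1 by auto
  show "e \<in> directions \<Longrightarrow> pmin \<le> pmf q e"
    unfolding pmin_def by (intro Min_le) auto
qed

text \<open>On a subgraph the normalising sum is at most 1, so restricting the graph can only
  increase the probability of a step that is still allowed.\<close>

lemma step_prob_ge:
  assumes "is_lattice G" "{x, y} \<in> snd G"
  shows "pmin \<le> step_prob q G x y"
proof -
  let ?D = "{e. e \<in> directions \<and> {x, x + e} \<in> snd G}"
  have d: "y - x \<in> directions" using assms unfolding is_lattice_def by blast
  have "y - x \<in> ?D" using d assms(2) by simp
  then have 1: "0 < (\<Sum>e\<in>?D. pmf q e)"
    using pos by (intro sum_pos2[of ?D "y - x"]) simp_all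
  have 2: "(\<Sum>e\<in>?D. pmf q e) \<le> (\<Sum>e\<in>directions. pmf q e)"
    by (intro sum_mono2) auto
  have "pmf q (y - x) \<le> pmf q (y - x) / (\<Sum>e\<in>?D. pmf q e)"
    using 1 2 sum_pmf_directions[OF supp] by (simp add: le_divide_eq mult_left_le)
  then show ?thesis using pmin(3)[OF d] assms(2) by (simp add: step_prob_def)
qed

end

context directed_walks
begin

text \<open>Walk \<open>i - 1\<close> has infinite range and so leaves the finite set
  \<open>B\<close>, necessarily along \<open>{u, v}\<close>. Loop erasure of its path up to the
  first exit gives \<open>g\<close>.\<close>

lemma crossing_path:
  assumes reg: "regular \<omega>" and i: "1 \<le> i" and B: "finite B" "0 \<in> B"
    and bd: "boundary_edge (walk_graph X i \<omega>) B u v"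
  shows "{u, v} \<in> snd (walk_graph X i \<omega>)"
    and "\<exists>g. distinct g \<and> g \<noteq> [] \<and> g ! 0 = 0 \<and> last g = u \<and> set g \<subseteq> B \<and>
      (\<forall>j. Suc j < length g \<longrightarrow> {g ! j, g ! Suc j} \<in> snd (walk_graph X i \<omega>))"
proof -
  obtain i' where i': "i = Suc i'" using i by (cases i) auto
  let ?Y = "\<lambda>n. X i' n \<omega>"
  let ?E = "snd (walk_graph X i \<omega>)"
  have edge: "{?Y n, ?Y (Suc n)} \<in> ?E" for n by (auto simp: i' trace_graph_def)
  have ex: "\<exists>t. ?Y t \<notin> B"
    using regularD(3)[OF reg, of i'] B(1) finite_subset[of "range ?Y" B] by blast
  define t where "t = (LEAST t. ?Y t \<notin> B)"
  have t: "?Y t \<notin> B" unfolding t_def by (rule LeastI_ex[OF ex])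
  have less: "?Y j \<in> B" if "j < t" for j
    using not_less_Least[of j "\<lambda>t. ?Y t \<notin> B"] that unfolding t_def by blast
  have "t \<noteq> 0"
  proof
    assume "t = 0"
    then have "X i' 0 \<omega> \<notin> B" using t by simp
    then show False using regularD(1)[OF reg, of i'] B(2) by simp
  qed
  then obtain s where s: "t = Suc s" by (cases t) auto
  have uv: "?Y s = u" "?Y t = v"
    using bd edge[of s] less[of s] t unfolding boundary_edge_def s by blast+
  show "{u, v} \<in> ?E" using edge[of s] uv s by simp
  let ?r = "\<lambda>a b. {a, b} \<in> ?E \<and> b \<in> B"
  have "j \<le> s \<Longrightarrow> ?r\<^sup>*\<^sup>* 0 (?Y j)" for j
  proof (induction j)
    case 0
    then show ?case using regularD(1)[OF reg, of i'] by simp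
  next
    case (Suc j)
    then have "?r (?Y j) (?Y (Suc j))" using edge[of j] less[of "Suc j"] s by simp
    then show ?case using Suc by (simp add: rtranclp.rtrancl_into_rtrancl)
  qed
  from this[of s] have "?r\<^sup>*\<^sup>* 0 u" using uv by simp
  then obtain zs where zs: "zs \<noteq> []" "hd zs = 0" "last zs = u" "distinct zs"
    "\<And>k. Suc k < length zs \<Longrightarrow> ?r (zs ! k) (zs ! Suc k)"
    by (rule rtranclp_distinct_list) blast
  have "set zs \<subseteq> B"
  proof
    fix a assume "a \<in> set zs"
    then obtain j where j: "j < length zs" "a = zs ! j" by (metis in_set_conv_nth)
    show "a \<in> B"
    proof (cases j)
      case 0
      then show ?thesis using zs(1,2) j B(2) by (simp add: hd_conv_nth)
    next
      case (Suc l)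
      then show ?thesis using zs(5)[of l] j by blast
    qed
  qed
  then show "\<exists>g. distinct g \<and> g \<noteq> [] \<and> g ! 0 = 0 \<and> last g = u \<and> set g \<subseteq> B \<and>
      (\<forall>j. Suc j < length g \<longrightarrow> {g ! j, g ! Suc j} \<in> ?E)"
    using zs by (intro exI[of _ zs]) (simp add: hd_conv_nth)
qed

text \<open>A single edge leaves \<open>B\<close> in the trace of the first walk, and the total resistance of that trace
  for the law \<open>q\<close> is at most \<open>K\<close>. Fixing \<open>B\<close> and \<open>K\<close> makes the lower bound for the probability of
  a bare segment deterministic.\<close>

definition tame :: "(int ^ 'd) pmf \<Rightarrow> (int ^ 'd) set \<Rightarrow> int ^ 'd \<Rightarrow> int ^ 'd \<Rightarrow> real \<Rightarrow> 'a \<Rightarrow> bool" where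
  "tame q B u v K \<omega> \<longleftrightarrow> boundary_edge (walk_graph X 1 \<omega>) B u v \<and>
     (\<forall>N. (\<Sum>n<N. 1 / cc q (X 0 n \<omega>) (X 0 (Suc n) \<omega>)) \<le> K)"

lemma bare_measurable:
  assumes X: "\<And>n. X i n \<in> measurable N (count_space UNIV)"
  shows "Measurable.pred N (\<lambda>\<omega>. \<exists>g. bare B u g i \<omega>)"
proof -
  note X [measurable]
  show ?thesis unfolding bare_def by measurable
qed

lemma tame_measurable:
  assumes X: "\<And>n. X 0 n \<in> measurable N (count_space UNIV)"
  shows "Measurable.pred N (\<lambda>\<omega>. tame q B u v K \<omega>)"
proof -
  have E: "Measurable.pred N (\<lambda>\<omega>. f \<in> snd (walk_graph X 1 \<omega>))" for f
    using sets_snd_walk_graph[of 1 X N f] X by (simp add: pred_def)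
  have R: "(\<lambda>\<omega>. 1 / cc q (X 0 n \<omega>) (X 0 (Suc n) \<omega>)) \<in> borel_measurable N" for n
    by (rule borel_measurable_countable_fun2[OF X X, where h = "\<lambda>a b. 1 / cc q a b"])
  have S: "Measurable.pred N (\<lambda>\<omega>. \<forall>m. (\<Sum>n<m. 1 / cc q (X 0 n \<omega>) (X 0 (Suc n) \<omega>)) \<le> K)"
    by (intro pred_intros_countable(1) pred_le_const borel_measurable_sum R)
  have "Measurable.pred N (\<lambda>\<omega>. {a, b} \<in> snd (walk_graph X 1 \<omega>) \<longrightarrow> a \<in> B \<longrightarrow> b \<notin> B \<longrightarrow> a = u \<and> b = v)" for a b
  proof (cases "a \<in> B \<longrightarrow> b \<notin> B \<longrightarrow> a = u \<and> b = v")
    case False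
    then have "({a, b} \<in> snd (walk_graph X 1 \<omega>) \<longrightarrow> a \<in> B \<longrightarrow> b \<notin> B \<longrightarrow> a = u \<and> b = v) \<longleftrightarrow>
        {a, b} \<notin> snd (walk_graph X 1 \<omega>)" for \<omega> by blast
    then show ?thesis using pred_intros_logic(2)[OF E] by (simp only:)
  next
    case True
    then have "({a, b} \<in> snd (walk_graph X 1 \<omega>) \<longrightarrow> a \<in> B \<longrightarrow> b \<notin> B \<longrightarrow> a = u \<and> b = v) = True" for \<omega> by blast
    then show ?thesis by (simp only: measurable_const UNIV_I space_count_space)
  qed
  then have "Measurable.pred N (\<lambda>\<omega>. \<forall>a b. {a, b} \<in> snd (walk_graph X 1 \<omega>) \<longrightarrow> a \<in> B \<longrightarrow> b \<notin> B \<longrightarrow> a = u \<and> b = v)"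
    by (intro pred_intros_countable(1))
  from pred_intros_logic(3)[OF this S]
  have *: "Measurable.pred N (\<lambda>\<omega>. (\<forall>a b. {a, b} \<in> snd (walk_graph X 1 \<omega>) \<longrightarrow> a \<in> B \<longrightarrow> b \<notin> B \<longrightarrow> a = u \<and> b = v) \<and>
     (\<forall>m. (\<Sum>n<m. 1 / cc q (X 0 n \<omega>) (X 0 (Suc n) \<omega>)) \<le> K))" .
  show ?thesis
  proof (cases "u \<in> B \<and> v \<notin> B")
    case True
    then show ?thesis unfolding tame_def boundary_edge_def using * by (simp only: simp_thms)
  next
    case False
    then have "tame q B u v K \<omega> = False" for \<omega> unfolding tame_def boundary_edge_def by blast
    then show ?thesis by (simp only: measurable_const UNIV_I space_count_space)
  qed
qed

text \<open>Follow a crossing of \<open>B\<close>, step to \<open>v\<close>, then escape from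
  \<open>u\<close>. It is essential that \<open>\<epsilon>\<close> is chosen before the stage
  \<open>i\<close> and the past event \<open>b\<close>.\<close>

lemma prob_bare_ge:
  assumes B: "finite B" "0 \<in> B" and K: "0 < K" and q: "set_pmf q \<subseteq> directions" "\<And>e. e \<in> directions \<Longrightarrow> 0 < pmf q e"
    and uv: "v - u \<in> directions"
  shows "\<exists>\<epsilon>>0. \<epsilon> \<le> 1 \<and> (\<forall>i b. 1 \<le> i \<longrightarrow> p (enat i) = q \<longrightarrow> b \<in> sets (past i) \<longrightarrow> (\<forall>\<omega>\<in>b. tame q B u v K \<omega>) \<longrightarrow>
     \<epsilon> * prob b \<le> prob (b \<inter> {\<omega> \<in> space M. \<exists>g. bare B u g i \<omega>}))"
proof -
  interpret q: step_law q using q by unfold_locales auto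
  define \<Gamma> where "\<Gamma> = {g. distinct g \<and> g \<noteq> [] \<and> g ! 0 = 0 \<and> last g = u \<and> set g \<subseteq> B}"
  have len: "length g \<le> card B" if "g \<in> \<Gamma>" for g
    using that B card_mono[of B "set g"] distinct_card[of g] unfolding \<Gamma>_def by auto
  then have "\<Gamma> \<subseteq> {g. set g \<subseteq> B \<and> length g \<le> card B}" unfolding \<Gamma>_def by blast
  then have fin: "finite \<Gamma>" using finite_lists_length_le[OF B(1)] finite_subset by blast
  \<comment> \<open>A path in \<open>B\<close> extended by \<open>v\<close> has at most
    \<open>card B\<close> steps, each of probability at least \<open>q.pmin\<close>; the second
    factor is the bound of \<open>esc_lower_bound\<close>.\<close>
  define c where "c = q.pmin ^ card B * (1 / (K * cc q u v))"
  have c: "0 < c" unfolding c_def using q.pmin(1) K q.cc_pos[OF uv] by simp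
  define N where "N = real (Suc (card \<Gamma>))"
  have N: "0 < N" "real (card \<Gamma>) \<le> N" by (simp_all add: N_def)
  have main: "c * prob b \<le> N * prob (b \<inter> {\<omega> \<in> space M. \<exists>g. bare B u g i \<omega>})"
    if i: "1 \<le> i" "p (enat i) = q" and b: "b \<in> sets (past i)" and tame: "\<And>\<omega>. \<omega> \<in> b \<Longrightarrow> tame q B u v K \<omega>" for i b
  proof -
    have [measurable]: "b \<in> sets M" by (rule past_sets[OF b])
    have [measurable]: "Measurable.pred M (\<lambda>\<omega>. \<exists>g. bare B u g i \<omega>)" by (rule bare_measurable) measurable
    let ?y = "\<lambda>g j. (g @ [v]) ! j"
    let ?ok = "\<lambda>g. {\<omega> \<in> space M. \<forall>j<length g. {?y g j, ?y g (Suc j)} \<in> snd (walk_graph X i \<omega>)}"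
    let ?E = "\<lambda>g n. {\<omega> \<in> space M. (\<forall>j\<le>length g. X i j \<omega> = ?y g j) \<and> (\<forall>j\<in>{length g..length g + n}. X i j \<omega> \<notin> {u})}"
    have bd: "boundary_edge (walk_graph X i \<omega>) B u v" if "\<omega> \<in> b" "regular \<omega>" for \<omega>
      using tame[OF that(1)] regularD(6)[OF that(2) i(1)] unfolding tame_def boundary_edge_def by blast
    have esc: "1 / (K * cc q u v) \<le> esc q (walk_graph X i \<omega>) UNIV {u} n v" if \<omega>: "\<omega> \<in> b" "regular \<omega>" for \<omega> n
    proof -
      obtain i' where i': "i = Suc i'" using i by (cases i) auto
      have pos_terms: "0 \<le> 1 / cc q (X 0 n \<omega>) (X 0 (Suc n) \<omega>)" for n by (simp add: q.cc_nonneg)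
      have bound: "(\<Sum>n<N. 1 / cc q (X 0 n \<omega>) (X 0 (Suc n) \<omega>)) \<le> K" for N
        using tame[OF \<omega>(1)] unfolding tame_def by blast
      have summable: "summable (\<lambda>n. 1 / cc q (X 0 n \<omega>) (X 0 (Suc n) \<omega>))"
        by (rule summableI_nonneg_bounded[OF pos_terms bound])
      show ?thesis
      proof (rule q.esc_lower_bound[where B = B and Y = "\<lambda>n. X i' n \<omega>" and x = "walk0 \<omega>"])
        show "is_lattice (walk_graph X i \<omega>)" by (rule regularD(4)[OF \<omega>(2)])
        show "finite B" by (rule B)
        show "boundary_edge (walk_graph X i \<omega>) B u v" by (rule bd[OF \<omega>])
        show "{u, v} \<in> snd (walk_graph X i \<omega>)" by (rule crossing_path(1)[OF \<omega>(2) i(1) B bd[OF \<omega>]])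
        show "{X i' n \<omega>, X i' (Suc n) \<omega>} \<in> snd (walk_graph X i \<omega>)" for n
          by (auto simp: i' trace_graph_def)
        show "X i' 0 \<omega> \<in> B" using regularD(1)[OF \<omega>(2), of i'] B by simp
        show "infinite (range (\<lambda>n. X i' n \<omega>))" by (rule regularD(3)[OF \<omega>(2)])
        show "snd (walk_graph X i \<omega>) \<subseteq> range (\<lambda>n. {X 0 n \<omega>, X 0 (Suc n) \<omega>})"
          using regularD(6)[OF \<omega>(2) i(1)] by (simp add: trace_graph_def)
        show "X 0 (Suc n) \<omega> - X 0 n \<omega> \<in> directions" for n by (rule regularD(5)[OF \<omega>(2)])
        show "summable (\<lambda>n. 1 / cc q (X 0 n \<omega>) (X 0 (Suc n) \<omega>))" by (rule summable)
        show "(\<Sum>n. 1 / cc q (X 0 n \<omega>) (X 0 (Suc n) \<omega>)) \<le> K" by (rule suminf_le_const[OF summable bound])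
      qed
    qed
    have one: "c * prob (b \<inter> ?ok g) \<le> prob (b \<inter> {\<omega> \<in> space M. \<exists>g. bare B u g i \<omega>})" if g: "g \<in> \<Gamma>" for g
    proof -
      have y0: "?y g 0 = 0" using g unfolding \<Gamma>_def by (simp add: nth_append)
      have finite_n: "c * prob (b \<inter> ?ok g) \<le> prob (b \<inter> ?E g n)" for n
      proof -
        have "c * prob (b \<inter> ?ok g) = (\<integral>\<omega>. c * indicator (b \<inter> ?ok g) \<omega> \<partial>M)" by simp
        also have "\<dots> \<le> (\<integral>\<omega>. path_weight q (walk_graph X i \<omega>) (?y g) (length g) * esc q (walk_graph X i \<omega>) UNIV {u} n (?y g (length g)) * indicator b \<omega> \<partial>M)"
        proof (rule integral_mono_AE)
          show "integrable M (\<lambda>\<omega>. c * indicator (b \<inter> ?ok g) \<omega> :: real)"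
            by (intro integrable_mult_right integrable_real_indicator) (auto simp: emeasure_eq_measure)
          show "integrable M (\<lambda>\<omega>. path_weight q (walk_graph X i \<omega>) (?y g) (length g) * esc q (walk_graph X i \<omega>) UNIV {u} n (?y g (length g)) * indicator b \<omega>)"
            by (rule integrable_const_bound[of _ 1])
              (auto simp: abs_mult path_weight_nonneg esc_nonneg intro!: mult_le_one path_weight_le_1[OF q(1)] esc_le_1 mult_nonneg_nonneg)
          show "AE \<omega> in M. c * indicator (b \<inter> ?ok g) \<omega> \<le>
              path_weight q (walk_graph X i \<omega>) (?y g) (length g) * esc q (walk_graph X i \<omega>) UNIV {u} n (?y g (length g)) * indicator b \<omega>"
            using AE_reg
          proof eventually_elim
            case (elim \<omega>)
            show ?case
            proof (cases "\<omega> \<in> b \<inter> ?ok g")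
              case True
              have "q.pmin ^ card B \<le> q.pmin ^ length g"
                using q.pmin len[OF g] by (intro power_decreasing) auto
              also have "\<dots> = (\<Prod>j<length g. q.pmin)" by simp
              also have "\<dots> \<le> path_weight q (walk_graph X i \<omega>) (?y g) (length g)"
                unfolding path_weight_def using True regularD(4)[OF elim, of i] q.pmin(1)
                by (intro prod_mono) (auto intro!: q.step_prob_ge)
              finally have "c \<le> path_weight q (walk_graph X i \<omega>) (?y g) (length g) * esc q (walk_graph X i \<omega>) UNIV {u} n v"
                unfolding c_def using esc[of \<omega> n] True elim K q.cc_nonneg
                by (intro mult_mono) (auto simp: path_weight_nonneg)
              then show ?thesis using True by simp
            next
              case False
              then have "indicator (b \<inter> ?ok g) \<omega> = (0 :: real)" by (rule indicator_simps(2))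
              then show ?thesis
                by (simp only: mult_zero_right) (intro mult_nonneg_nonneg path_weight_nonneg esc_nonneg indicator_pos_le)
            qed
          qed
        qed
        also have "\<dots> = prob (b \<inter> ?E g n)"
          using prob_follow_avoid[OF b, where y = "?y g" and m = "length g" and n = n and U = "{u}"] y0 i(2) by simp
        finally show ?thesis .
      qed
      have "(\<lambda>n. prob (b \<inter> ?E g n)) \<longlonglongrightarrow> prob (\<Inter>n. b \<inter> ?E g n)"
      proof (rule finite_Lim_measure_decseq)
        show "decseq (\<lambda>n. b \<inter> ?E g n)" unfolding decseq_Suc_iff by auto
      qed auto
      then have "c * prob (b \<inter> ?ok g) \<le> prob (\<Inter>n. b \<inter> ?E g n)"
        using finite_n by (intro LIMSEQ_le_const) blast+
      also have "\<dots> \<le> prob (b \<inter> {\<omega> \<in> space M. \<exists>g. bare B u g i \<omega>})"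
      proof (rule finite_measure_mono)
        show "(\<Inter>n. b \<inter> ?E g n) \<subseteq> b \<inter> {\<omega> \<in> space M. \<exists>g. bare B u g i \<omega>}"
        proof
          fix \<omega> assume \<omega>: "\<omega> \<in> (\<Inter>n. b \<inter> ?E g n)"
          then have 1: "\<omega> \<in> b" "\<omega> \<in> space M" "\<forall>j\<le>length g. X i j \<omega> = ?y g j" by auto
          have 2: "X i j \<omega> \<noteq> u" if "length g \<le> j" for j
          proof -
            have "\<omega> \<in> ?E g (j - length g)" using \<omega> by blast
            then show ?thesis using that by simp
          qed
          have v: "v \<notin> B"
            using tame[OF 1(1)] unfolding tame_def boundary_edge_def by blast
          have "bare B u (g @ [v]) i \<omega>"
            unfolding bare_def
          proof (intro conjI allI impI)
            show "distinct (g @ [v])" "2 \<le> length (g @ [v])" "last (g @ [v]) \<notin> B"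
              using g v by (auto simp: \<Gamma>_def Suc_le_eq)
            show "(g @ [v]) ! j \<in> B" if "Suc j < length (g @ [v])" for j
              using g that by (auto simp: \<Gamma>_def nth_append)
            show "X i j \<omega> = (g @ [v]) ! j" if "j < length (g @ [v])" for j
              using 1(3) that by simp
            show "X i j \<omega> \<noteq> u" if "length (g @ [v]) - 1 \<le> j" for j
              using 2[of j] that by simp
          qed
          then show "\<omega> \<in> b \<inter> {\<omega> \<in> space M. \<exists>g. bare B u g i \<omega>}" using 1 by blast
        qed
      qed measurable
      finally show ?thesis .
    qed
    have ok [measurable]: "?ok g \<in> sets M" for g by measurable
    \<comment> \<open>A crossing exists almost surely on \<open>b\<close>, but which one depends on
      the graph; hence the union over all candidates and the loss of the factor
      \<open>card \<Gamma>\<close>.\<close>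
    have "prob b \<le> prob (\<Union>g\<in>\<Gamma>. b \<inter> ?ok g)"
    proof (rule finite_measure_mono_AE)
      show "AE \<omega> in M. \<omega> \<in> b \<longrightarrow> \<omega> \<in> (\<Union>g\<in>\<Gamma>. b \<inter> ?ok g)"
        using AE_conjI[OF AE_reg AE_space]
      proof (eventually_elim, intro impI)
        fix \<omega> assume "regular \<omega> \<and> \<omega> \<in> space M" "\<omega> \<in> b"
        then have elim: "regular \<omega>" "\<omega> \<in> space M" "\<omega> \<in> b" by auto
        obtain g where g: "distinct g" "g \<noteq> []" "g ! 0 = 0" "last g = u" "set g \<subseteq> B"
          "\<And>j. Suc j < length g \<Longrightarrow> {g ! j, g ! Suc j} \<in> snd (walk_graph X i \<omega>)"
          using crossing_path(2)[OF elim(1) i(1) B bd[OF elim(3,1)]] by blast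
        have "{?y g j, ?y g (Suc j)} \<in> snd (walk_graph X i \<omega>)" if "j < length g" for j
        proof (cases "Suc j < length g")
          case True
          then show ?thesis using g(6) by (simp add: nth_append)
        next
          case False
          then have "j = length g - 1" "Suc j = length g" using that by auto
          then show ?thesis using g(2,4) crossing_path(1)[OF elim(1) i(1) B bd[OF elim(3,1)]]
            by (simp add: nth_append last_conv_nth)
        qed
        then show "\<omega> \<in> (\<Union>g\<in>\<Gamma>. b \<inter> ?ok g)" using g elim by (auto simp: \<Gamma>_def)
      qed
      show "(\<Union>g\<in>\<Gamma>. b \<inter> ?ok g) \<in> sets M" using fin by (intro sets.finite_UN) auto
    qed
    also have "\<dots> \<le> (\<Sum>g\<in>\<Gamma>. prob (b \<inter> ?ok g))"
      using fin by (intro finite_measure_subadditive_finite) auto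
    finally have "c * prob b \<le> c * (\<Sum>g\<in>\<Gamma>. prob (b \<inter> ?ok g))"
      using c by (intro mult_left_mono) auto
    also have "\<dots> = (\<Sum>g\<in>\<Gamma>. c * prob (b \<inter> ?ok g))" by (rule sum_distrib_left)
    also have "\<dots> \<le> (\<Sum>g\<in>\<Gamma>. prob (b \<inter> {\<omega> \<in> space M. \<exists>g. bare B u g i \<omega>}))"
      by (intro sum_mono one)
    also have "\<dots> = real (card \<Gamma>) * prob (b \<inter> {\<omega> \<in> space M. \<exists>g. bare B u g i \<omega>})" by simp
    also have "\<dots> \<le> N * prob (b \<inter> {\<omega> \<in> space M. \<exists>g. bare B u g i \<omega>})"
      using N by (intro mult_right_mono) auto
    finally show ?thesis .
  qed
  show ?thesis
  proof (intro exI[of _ "min 1 (c / N)"] conjI allI impI)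
    show "0 < min 1 (c / N)" using c N by simp
    fix i b assume *: "1 \<le> i" "p (enat i) = q" "b \<in> sets (past i)" "\<forall>\<omega>\<in>b. tame q B u v K \<omega>"
    have "min 1 (c / N) * prob b \<le> c / N * prob b" by (intro mult_right_mono) auto
    also have "\<dots> \<le> prob (b \<inter> {\<omega> \<in> space M. \<exists>g. bare B u g i \<omega>})"
      using main[OF *(1-3)] *(4) N by (simp add: divide_le_eq mult.commute)
    finally show "min 1 (c / N) * prob b \<le> prob (b \<inter> {\<omega> \<in> space M. \<exists>g. bare B u g i \<omega>})" .
  qed simp
qed

text \<open>\<open>bad n\<close> belongs to the past of stage \<open>n\<close>, so every stage with
  law \<open>q\<close> multiplies its probability by at most \<open>1 - \<epsilon>\<close>; there
  are infinitely many such stages.\<close>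

lemma AE_bare:
  assumes inf: "infinite {i. 1 \<le> i \<and> p (enat i) = q}" and B: "finite B" "0 \<in> B" and uv: "v - u \<in> directions"
  shows "AE \<omega> in M. tame q B u v K \<omega> \<longrightarrow> (\<exists>i g. 1 \<le> i \<and> bare B u g i \<omega>)"
proof -
  let ?I = "{i. 1 \<le> i \<and> p (enat i) = q}"
  obtain i0 where i0: "p (enat i0) = q" using inf by (metis (mono_tags, lifting) Collect_empty_eq finite.emptyI)
  have q: "set_pmf q \<subseteq> directions" "\<And>e. e \<in> directions \<Longrightarrow> 0 < pmf q e"
    using steps[of "enat i0"] pos[of _ "enat i0"] unfolding i0 by auto
  \<comment> \<open>\<open>prob_bare_ge\<close> asks for a positive bound, and enlarging
    \<open>K\<close> only weakens \<open>tame\<close>.\<close>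
  let ?Kp = "max K 1"
  obtain \<epsilon> where \<epsilon>: "0 < \<epsilon>" "\<epsilon> \<le> 1"
    "\<And>i b. 1 \<le> i \<Longrightarrow> p (enat i) = q \<Longrightarrow> b \<in> sets (past i) \<Longrightarrow> (\<forall>\<omega>\<in>b. tame q B u v ?Kp \<omega>) \<Longrightarrow>
       \<epsilon> * prob b \<le> prob (b \<inter> {\<omega> \<in> space M. \<exists>g. bare B u g i \<omega>})"
  proof -
    have "0 < ?Kp" by simp
    from prob_bare_ge[OF B this q uv] that show thesis by blast
  qed
  define bad where "bad = (\<lambda>n. {\<omega> \<in> space M. tame q B u v ?Kp \<omega> \<and> (\<forall>i\<in>{1..<n}. \<not> (\<exists>g. bare B u g i \<omega>))})"
  have bad_past: "bad n \<in> sets (past n)" if "1 \<le> n" for n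
  proof -
    have [measurable]: "Measurable.pred (past n) (\<lambda>\<omega>. tame q B u v ?Kp \<omega>)"
      using that by (intro tame_measurable past_X) simp
    have [measurable]: "Measurable.pred (past n) (\<lambda>\<omega>. \<exists>g. bare B u g i \<omega>)" if "i < n" for i
      using that by (intro bare_measurable past_X)
    have "Measurable.pred (past n) (\<lambda>\<omega>. tame q B u v ?Kp \<omega> \<and> (\<forall>i\<in>{1..<n}. \<not> (\<exists>g. bare B u g i \<omega>)))"
      by (intro pred_intros_logic pred_intros_countable_bounded) auto
    then show ?thesis unfolding bad_def pred_def by simp
  qed
  have bad_M: "bad n \<in> sets M" if "1 \<le> n" for n using past_sets[OF bad_past[OF that]] .
  have bad_mono: "bad n \<subseteq> bad m" if "m \<le> n" for m n using that unfolding bad_def by auto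
  have step: "prob (bad (Suc n)) \<le> (1 - \<epsilon>) * prob (bad n)" if n: "n \<in> ?I" for n
  proof -
    have [measurable]: "Measurable.pred M (\<lambda>\<omega>. \<exists>g. bare B u g n \<omega>)" by (rule bare_measurable) measurable
    let ?G = "{\<omega> \<in> space M. \<exists>g. bare B u g n \<omega>}"
    have "bad (Suc n) = bad n - bad n \<inter> ?G"
    proof -
      have "{1..<Suc n} = insert n {1..<n}" using n by auto
      then show ?thesis unfolding bad_def by auto
    qed
    then have "prob (bad (Suc n)) = prob (bad n) - prob (bad n \<inter> ?G)"
      using n bad_M by (subst finite_measure_Diff[symmetric]) auto
    moreover have "\<epsilon> * prob (bad n) \<le> prob (bad n \<inter> ?G)"
      using n by (intro \<epsilon>(3) bad_past) (auto simp: bad_def)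
    ultimately show ?thesis by (simp add: left_diff_distrib)
  qed
  have "prob (bad (enumerate ?I j)) \<le> (1 - \<epsilon>) ^ j" for j
  proof (induction j)
    case (Suc j)
    have "Suc (enumerate ?I j) \<le> enumerate ?I (Suc j)" using enumerate_step[OF inf, of j] by simp
    then have "prob (bad (enumerate ?I (Suc j))) \<le> prob (bad (Suc (enumerate ?I j)))"
      by (intro finite_measure_mono bad_mono bad_M) auto
    also have "\<dots> \<le> (1 - \<epsilon>) * prob (bad (enumerate ?I j))"
      by (rule step[OF enumerate_in_set[OF inf]])
    also have "\<dots> \<le> (1 - \<epsilon>) * (1 - \<epsilon>) ^ j"
      using Suc \<epsilon> by (intro mult_left_mono) auto
    finally show ?case by simp
  qed simp
  moreover have "prob (\<Inter>n\<in>{1..}. bad n) \<le> prob (bad (enumerate ?I j))" for j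
  proof (rule finite_measure_mono)
    have "1 \<le> enumerate ?I j" using enumerate_in_set[OF inf, of j] by simp
    then show "(\<Inter>n\<in>{1..}. bad n) \<subseteq> bad (enumerate ?I j)" "bad (enumerate ?I j) \<in> sets M"
      using bad_M by auto
  qed
  ultimately have le: "prob (\<Inter>n\<in>{1..}. bad n) \<le> (1 - \<epsilon>) ^ j" for j
    using order_trans by blast
  have "(\<lambda>j. (1 - \<epsilon>) ^ j) \<longlonglongrightarrow> 0" using \<epsilon> by (intro LIMSEQ_realpow_zero) auto
  then have "prob (\<Inter>n\<in>{1..}. bad n) \<le> 0"
    using le by (intro LIMSEQ_le_const) blast+
  then have "prob (\<Inter>n\<in>{1..}. bad n) = 0" using measure_nonneg[of M] by (simp add: order_antisym)
  moreover have "(\<Inter>n\<in>{1..}. bad n) \<in> sets M" using bad_M by (intro sets.countable_INT') auto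
  ultimately have "AE \<omega> in M. \<omega> \<notin> (\<Inter>n\<in>{1..}. bad n)" using prob_eq_0 by blast
  then have "AE \<omega> in M. \<omega> \<notin> (\<Inter>n\<in>{1..}. bad n) \<and> \<omega> \<in> space M"
    by (rule AE_conjI[OF _ AE_space])
  then show ?thesis
  proof (eventually_elim, intro impI)
    fix \<omega> assume "\<omega> \<notin> (\<Inter>n\<in>{1..}. bad n) \<and> \<omega> \<in> space M" "tame q B u v K \<omega>"
    then have elim: "\<omega> \<notin> (\<Inter>n\<in>{1..}. bad n)" "\<omega> \<in> space M" "tame q B u v K \<omega>" by auto
    have "tame q B u v ?Kp \<omega>" using elim(3) unfolding tame_def by (auto intro: order_trans)
    then have "\<exists>n\<ge>1. \<not> (\<forall>i\<in>{1..<n}. \<not> (\<exists>g. bare B u g i \<omega>))"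
      using elim(1,2) unfolding bad_def by auto
    then show "\<exists>i g. 1 \<le> i \<and> bare B u g i \<omega>" by fastforce
  qed
qed

theorem AE_simple_path:
  assumes inf: "infinite {i. 1 \<le> i \<and> p (enat i) = q}"
  shows "AE \<omega> in M. is_simple_path (limit_graph X \<omega>)"
proof -
  obtain i0 where i0: "1 \<le> i0" "p (enat i0) = q"
    using inf by (metis (mono_tags, lifting) Collect_empty_eq finite.emptyI)
  interpret q: step_law q using step_law[of "enat i0"] i0 by simp
  have mean: "0 < p0.mean (ell_hat q)"
    using mean_ell_hat[of "enat i0"] i0 by (simp add: zero_enat_def)
  \<comment> \<open>The cut set and the total resistance are random. Finite sets are listed and the
    resistance is bounded by a natural number, so countably many parameters cover all cases.\<close>
  have "AE \<omega> in M. \<forall>l u v K. 0 \<in> set l \<longrightarrow> v - u \<in> directions \<longrightarrow> tame q (set l) u v (real K) \<omega> \<longrightarrow>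
      (\<exists>i g. 1 \<le> i \<and> bare (set l) u g i \<omega>)"
    unfolding AE_all_countable
  proof (intro allI)
    fix l u v and K :: nat
    show "AE \<omega> in M. 0 \<in> set l \<longrightarrow> v - u \<in> directions \<longrightarrow> tame q (set l) u v (real K) \<omega> \<longrightarrow>
      (\<exists>i g. 1 \<le> i \<and> bare (set l) u g i \<omega>)"
    proof (cases "0 \<in> set l \<and> v - u \<in> directions")
      case True
      then show ?thesis using AE_bare[OF inf finite_set, of l v u "real K"] by simp
    qed simp
  qed
  then show ?thesis
    using AE_reg AE_infinite_cuts AE_level_at_top AE_summable_exp[OF mean]
  proof eventually_elim
    case (elim \<omega>)
    note reg = elim(2)
    have cc_ge: "q.pmin * exp (ip (ell_hat q) (X 0 n \<omega>)) \<le> cc q (X 0 n \<omega>) (X 0 (Suc n) \<omega>)" for n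
      unfolding cc_def by (intro mult_right_mono q.pmin(3) regularD(5)[OF reg]) auto
    have inv_le: "1 / cc q (X 0 n \<omega>) (X 0 (Suc n) \<omega>) \<le> (1 / q.pmin) * exp (- ip (ell_hat q) (X 0 n \<omega>))" for n
    proof -
      have "1 / cc q (X 0 n \<omega>) (X 0 (Suc n) \<omega>) \<le> 1 / (q.pmin * exp (ip (ell_hat q) (X 0 n \<omega>)))"
      proof (intro divide_left_mono cc_ge mult_pos_pos q.pmin(1) exp_gt_zero)
        have "0 < q.pmin * exp (ip (ell_hat q) (X 0 n \<omega>))" using q.pmin(1) by simp
        then show "0 < cc q (X 0 n \<omega>) (X 0 (Suc n) \<omega>)" using cc_ge[of n] by (rule less_le_trans)
      qed simp
      then show ?thesis by (simp add: exp_minus inverse_eq_divide)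
    qed
    let ?T = "\<Sum>n. (1 / q.pmin) * exp (- ip (ell_hat q) (X 0 n \<omega>))"
    have sum: "summable (\<lambda>n. (1 / q.pmin) * exp (- ip (ell_hat q) (X 0 n \<omega>)))"
      by (rule summable_mult[OF elim(5)])
    obtain K where K: "?T \<le> real K" using real_arch_simple by blast
    have bound: "(\<Sum>n<N. 1 / cc q (X 0 n \<omega>) (X 0 (Suc n) \<omega>)) \<le> real K" for N
    proof -
      have "(\<Sum>n<N. 1 / cc q (X 0 n \<omega>) (X 0 (Suc n) \<omega>)) \<le> (\<Sum>n<N. (1 / q.pmin) * exp (- ip (ell_hat q) (X 0 n \<omega>)))"
        by (intro sum_mono inv_le)
      also have "\<dots> \<le> ?T"
        using q.pmin(1) by (intro sum_le_suminf sum) auto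
      finally show ?thesis using K by simp
    qed
    show ?case
    proof (rule is_simple_path_limit[OF reg])
      fix c
      obtain N where N: "\<And>n. n \<ge> N \<Longrightarrow> real_of_int c + 1 \<le> real_of_int (X 0 n \<omega> $ k)"
        using elim(4) unfolding filterlim_at_top eventually_sequentially by blast
      obtain n where "n \<ge> N" "is_cut k (walk0 \<omega>) n"
        using elim(3) unfolding infinite_nat_iff_unbounded_le by blast
      then show "\<exists>n. is_cut k (walk0 \<omega>) n \<and> c < X 0 n \<omega> $ k"
        using N[of n] by (intro exI[of _ n]) auto
    next
      fix n assume n: "is_cut k (walk0 \<omega>) n"
      obtain l where l: "set l = walk0 \<omega> ` {..n}" using finite_list[of "walk0 \<omega> ` {..n}"] by auto
      have "tame q (set l) (X 0 n \<omega>) (X 0 (Suc n) \<omega>) (real K) \<omega>"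
        unfolding tame_def l using bound cut_boundary_edge[OF n reg order_refl] by blast
      moreover have "0 \<in> set l" unfolding l using regularD(1)[OF reg, of 0] by (intro image_eqI[of _ _ 0]) auto
      ultimately show "\<exists>i g. 1 \<le> i \<and> bare (walk0 \<omega> ` {..n}) (X 0 n \<omega>) g i \<omega>"
        using elim(1)[rule_format, of l "X 0 (Suc n) \<omega>" "X 0 n \<omega>" K] regularD(5)[OF reg, of 0 n] unfolding l by blast
    qed
  qed
qed

end

section \<open>Measurability of the set of simple paths\<close>

definition self_avoiding :: "('d::finite) graph \<Rightarrow> (int ^ 'd) list \<Rightarrow> bool" where
  "self_avoiding Z w \<longleftrightarrow> w \<noteq> [] \<and> distinct w \<and> w ! 0 = 0 \<and> (\<forall>j\<in>{..<length w - 1}. {w ! j, w ! Suc j} \<in> snd Z)"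

lemma self_avoidingD:
  assumes "self_avoiding Z w"
  shows "distinct w" "w ! 0 = 0" "0 < length w" "Suc j < length w \<Longrightarrow> {w ! j, w ! Suc j} \<in> snd Z"
  using assms by (auto simp: self_avoiding_def)

lemma self_avoiding_take:
  assumes "self_avoiding Z w" "0 < n"
  shows "self_avoiding Z (take n w)"
  using assms by (auto simp: self_avoiding_def)

text \<open>A characterisation of simple paths in which all quantifiers range over countable types:
  finite self-avoiding lists, vertices and lengths take the place of an infinite path.\<close>

definition path_like :: "('d::finite) graph \<Rightarrow> bool" where
  "path_like Z \<longleftrightarrow> (\<forall>n. \<exists>w. (length w = Suc n \<and> self_avoiding Z w) \<and> (\<forall>w'. length w' = Suc n \<and> self_avoiding Z w' \<longrightarrow> w' = w)) \<and>
     (\<forall>x. x \<in> fst Z \<longleftrightarrow> (\<exists>w. self_avoiding Z w \<and> x \<in> set w)) \<and>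
     (\<forall>x y. {x, y} \<in> snd Z \<longrightarrow> (\<exists>w. self_avoiding Z w \<and> (\<exists>j\<in>{..<length w - 1}. {x, y} = {w ! j, w ! Suc j})))"

lemma self_avoiding_trace:
  assumes inj: "inj \<pi>" and 0: "\<pi> 0 = 0" and w: "self_avoiding (trace_graph \<pi>) w"
  shows "j < length w \<Longrightarrow> w ! j = \<pi> j"
proof (induction j rule: less_induct)
  case (less j)
  show ?case
  proof (cases j)
    case 0
    then show ?thesis using assms(2) self_avoidingD(2)[OF w] by simp
  next
    case (Suc i)
    have i: "w ! i = \<pi> i" using less Suc by simp
    have "{w ! i, w ! Suc i} \<in> snd (trace_graph \<pi>)" by (rule self_avoidingD(4)[OF w]) (use less Suc in simp)
    then obtain a where "{\<pi> i, w ! Suc i} = {\<pi> a, \<pi> (Suc a)}" unfolding trace_graph_def i by auto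
    then consider "\<pi> i = \<pi> a" "w ! Suc i = \<pi> (Suc a)" | "\<pi> i = \<pi> (Suc a)" "w ! Suc i = \<pi> a"
      unfolding doubleton_eq_iff by blast
    then show ?thesis
    proof cases
      case 1
      then show ?thesis using injD[OF inj 1(1)] Suc by simp
    next
      case 2
      then have "i = Suc a" using injD[OF inj 2(1)] by simp
      then have "w ! a = w ! Suc i" using less.IH[of a] less.prems Suc 2 by simp
      then show ?thesis
        using nth_eq_iff_index_eq[OF self_avoidingD(1)[OF w], of a "Suc i"] less.prems Suc \<open>i = Suc a\<close> by simp
    qed
  qed
qed

text \<open>Uniqueness of the self-avoiding list of each length makes these lists prefixes of one
  another, and their diagonal is the path. Conversely, a self-avoiding list in a simple path cannot
  turn back.\<close>

lemma is_simple_path_iff: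
  assumes lattice: "snd Z \<subseteq> snd lattice_graph"
  shows "is_simple_path Z \<longleftrightarrow> path_like Z"
proof
  assume "is_simple_path Z"
  then obtain \<pi> where \<pi>: "inj \<pi>" "\<pi> 0 = 0" and Z: "Z = trace_graph \<pi>"
    unfolding is_simple_path_def by blast
  define W where "W = (\<lambda>n. map \<pi> [0..<Suc n])"
  have W: "length (W n) = Suc n" "j \<le> n \<Longrightarrow> W n ! j = \<pi> j" for n j
    by (simp_all add: W_def del: upt_Suc)
  have sa: "self_avoiding Z (W n)" for n
    unfolding self_avoiding_def
  proof (intro conjI ballI)
    show "W n \<noteq> []" using W(1)[of n] by auto
    show "distinct (W n)" unfolding W_def distinct_map using \<pi>(1) by (simp add: inj_on_def inj_def del: upt_Suc)
    show "W n ! 0 = 0" using W(2)[of 0 n] \<pi>(2) by simp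
    show "{W n ! j, W n ! Suc j} \<in> snd Z" if "j \<in> {..<length (W n) - 1}" for j
      using that W by (auto simp: Z trace_graph_def)
  qed
  have uniq: "w = W n" if "length w = Suc n" "self_avoiding Z w" for w n
    using self_avoiding_trace[OF \<pi> that(2)[unfolded Z]] that(1) W by (intro nth_equalityI) auto
  show "path_like Z"
    unfolding path_like_def
  proof (intro conjI allI impI)
    show "\<exists>w. (length w = Suc n \<and> self_avoiding Z w) \<and> (\<forall>w'. length w' = Suc n \<and> self_avoiding Z w' \<longrightarrow> w' = w)" for n
      using W(1) sa uniq by blast
    show "x \<in> fst Z \<longleftrightarrow> (\<exists>w. self_avoiding Z w \<and> x \<in> set w)" for x
    proof
      assume "x \<in> fst Z"
      then obtain n where "x = \<pi> n" by (auto simp: Z trace_graph_def)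
      then have "x \<in> set (W n)" by (simp add: W_def)
      then show "\<exists>w. self_avoiding Z w \<and> x \<in> set w" using sa by blast
    next
      assume "\<exists>w. self_avoiding Z w \<and> x \<in> set w"
      then obtain w where w: "self_avoiding Z w" "x \<in> set w" by blast
      then obtain j where "j < length w" "x = w ! j" by (metis in_set_conv_nth)
      then have "x = \<pi> j" using self_avoiding_trace[OF \<pi> w(1)[unfolded Z]] by simp
      then show "x \<in> fst Z" by (simp add: Z trace_graph_def)
    qed
    fix x y assume "{x, y} \<in> snd Z"
    then obtain n where "{x, y} = {\<pi> n, \<pi> (Suc n)}" by (auto simp: Z trace_graph_def)
    then have "{x, y} = {W (Suc n) ! n, W (Suc n) ! Suc n}" using W(2) by simp
    then show "\<exists>w. self_avoiding Z w \<and> (\<exists>j\<in>{..<length w - 1}. {x, y} = {w ! j, w ! Suc j})"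
      using sa[of "Suc n"] W(1)[of "Suc n"] by (intro exI[of _ "W (Suc n)"] conjI bexI[of _ n]) simp_all
  qed
next
  assume *: "path_like Z"
  then obtain W where W: "\<And>n. length (W n) = Suc n" "\<And>n. self_avoiding Z (W n)"
    and uniq: "\<And>n w. length w = Suc n \<Longrightarrow> self_avoiding Z w \<Longrightarrow> w = W n"
    unfolding path_like_def by metis
  have vert: "x \<in> fst Z \<longleftrightarrow> (\<exists>w. self_avoiding Z w \<and> x \<in> set w)" for x
    using * unfolding path_like_def by blast
  have edge: "\<exists>w. self_avoiding Z w \<and> (\<exists>j\<in>{..<length w - 1}. {x, y} = {w ! j, w ! Suc j})" if "{x, y} \<in> snd Z" for x y
    using * that unfolding path_like_def by blast
  define \<pi> where "\<pi> = (\<lambda>n. W n ! n)"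
  have \<pi>: "w ! j = \<pi> j" if w: "self_avoiding Z w" "j < length w" for w j
  proof -
    have "take (Suc j) w = W j"
      using w by (intro uniq self_avoiding_take) auto
    then have "take (Suc j) w ! j = \<pi> j" by (simp only: \<pi>_def)
    then show ?thesis by simp
  qed
  have \<pi>W: "W n ! j = \<pi> j" if "j \<le> n" for n j
    using \<pi>[OF W(2)[of n], of j] that W(1)[of n] by simp
  have edge\<pi>: "{\<pi> n, \<pi> (Suc n)} \<in> snd Z" for n
    using self_avoidingD(4)[OF W(2)[of "Suc n"], of n] \<pi>W[of n "Suc n"] \<pi>W[of "Suc n" "Suc n"] W(1)[of "Suc n"] by simp
  show "is_simple_path Z"
    unfolding is_simple_path_def
  proof (intro exI[of _ \<pi>] conjI allI)
    show "inj \<pi>"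
    proof (rule linorder_injI)
      fix m n :: nat assume "m < n"
      then have "W n ! m \<noteq> W n ! n"
        using nth_eq_iff_index_eq[OF self_avoidingD(1)[OF W(2)[of n]], of m n] W(1)[of n] by simp
      then show "\<pi> m \<noteq> \<pi> n" using \<pi>W \<open>m < n\<close> by simp
    qed
    show "\<pi> 0 = 0" unfolding \<pi>_def by (rule self_avoidingD(2)[OF W(2)])
    show "\<pi> (Suc n) - \<pi> n \<in> directions" for n
    proof -
      have "{\<pi> n, \<pi> (Suc n)} \<in> snd lattice_graph" using edge\<pi> lattice by blast
      then show ?thesis using is_lattice_lattice_graph unfolding is_lattice_def by blast
    qed
    have "fst Z = range \<pi>"
    proof (intro equalityI subsetI)
      fix x assume "x \<in> fst Z"
      then obtain w where w: "self_avoiding Z w" "x \<in> set w" using vert by blast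
      then obtain j where "j < length w" "x = w ! j" by (metis in_set_conv_nth)
      then show "x \<in> range \<pi>" using \<pi>[OF w(1)] by simp
    next
      fix x assume "x \<in> range \<pi>"
      then obtain n where "x = W n ! n" by (auto simp: \<pi>_def)
      then have "x \<in> set (W n)" using W(1)[of n] by simp
      then show "x \<in> fst Z" using vert W(2) by blast
    qed
    moreover have "snd Z = range (\<lambda>n. {\<pi> n, \<pi> (Suc n)})"
    proof (intro equalityI subsetI)
      fix f assume f: "f \<in> snd Z"
      then have "f \<in> snd lattice_graph" using lattice by blast
      then obtain x y where xy: "f = {x, y}" by (auto simp: lattice_graph_def)
      then obtain w j where w: "self_avoiding Z w" "j \<in> {..<length w - 1}" "{x, y} = {w ! j, w ! Suc j}"
        using edge[of x y] f by blast
      then have "f = {\<pi> j, \<pi> (Suc j)}" using \<pi>[OF w(1), of j] \<pi>[OF w(1), of "Suc j"] xy by simp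
      then show "f \<in> range (\<lambda>n. {\<pi> n, \<pi> (Suc n)})" by blast
    next
      fix f assume "f \<in> range (\<lambda>n. {\<pi> n, \<pi> (Suc n)})"
      then show "f \<in> snd Z" using edge\<pi> by blast
    qed
    ultimately show "Z = trace_graph \<pi>" by (simp add: trace_graph_def prod_eq_iff)
  qed
qed

text \<open>The starting point of a simple path has only one neighbour.\<close>

lemma not_simple_path_branch:
  assumes "{0, a} \<in> snd Z" "{0, b} \<in> snd Z" "a \<noteq> b" "a \<noteq> 0" "b \<noteq> 0"
  shows "\<not> is_simple_path Z"
proof
  assume "is_simple_path Z"
  then obtain \<pi> where \<pi>: "inj \<pi>" "\<pi> 0 = 0" and Z: "Z = trace_graph \<pi>"
    unfolding is_simple_path_def by blast
  have "c = \<pi> (Suc 0)" if c: "{0, c} \<in> snd Z" for c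
  proof -
    obtain n where "{0, c} = {\<pi> n, \<pi> (Suc n)}" using c by (auto simp: Z trace_graph_def)
    then consider "\<pi> 0 = \<pi> n" "c = \<pi> (Suc n)" | "\<pi> 0 = \<pi> (Suc n)"
      unfolding doubleton_eq_iff \<pi>(2) by fastforce
    then show ?thesis
    proof cases
      case 1
      then show ?thesis using injD[OF \<pi>(1) 1(1)] by simp
    next
      case 2
      then show ?thesis using injD[OF \<pi>(1) 2] by simp
    qed
  qed
  then show False using assms(1-3) by blast
qed

context nested_walks
begin

text \<open>The measure of a set outside the sigma-algebra is 0 by convention, so a positive lower
  bound for this event presupposes its measurability.\<close>

lemma simple_path_measurable: "{\<omega> \<in> space M. \<not> is_simple_path (limit_graph X \<omega>)} \<in> sets M"
proof -
  have E: "Measurable.pred M (\<lambda>\<omega>. f \<in> snd (limit_graph X \<omega>))" for f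
  proof -
    have "Measurable.pred M (\<lambda>\<omega>. \<forall>i. f \<in> snd (walk_graph X i \<omega>))"
      by (intro pred_intros_countable(1) snd_walk_graph_measurable)
    then show ?thesis by (simp add: limit_graph_def)
  qed
  have V: "Measurable.pred M (\<lambda>\<omega>. x \<in> fst (limit_graph X \<omega>))" for x
  proof -
    have "Measurable.pred M (\<lambda>\<omega>. x \<in> fst (walk_graph X i \<omega>))" for i
      using sets_fst_walk_graph[of i X M x] by (simp add: pred_def)
    then have "Measurable.pred M (\<lambda>\<omega>. \<forall>i. x \<in> fst (walk_graph X i \<omega>))"
      by (intro pred_intros_countable(1))
    then show ?thesis by (simp add: limit_graph_def)
  qed
  have const: "Measurable.pred M (\<lambda>\<omega>. c)" for c :: bool
    by simp
  have S: "Measurable.pred M (\<lambda>\<omega>. self_avoiding (limit_graph X \<omega>) w)" for w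
    unfolding self_avoiding_def
    by (intro pred_intros_logic(3) const pred_intros_countable_bounded(3) E)
  have "Measurable.pred M (\<lambda>\<omega>. path_like (limit_graph X \<omega>))"
    unfolding path_like_def
    by (intro pred_intros_logic(3,4,6) pred_intros_countable(1,2) pred_intros_countable_bounded(4) const E V S)
  moreover have "snd (limit_graph X \<omega>) \<subseteq> snd lattice_graph" for \<omega>
    unfolding limit_graph_def snd_conv
    using INT_lower[of 0 UNIV "\<lambda>i. snd (walk_graph X i \<omega>)"] by simp
  ultimately have "Measurable.pred M (\<lambda>\<omega>. is_simple_path (limit_graph X \<omega>))"
    by (simp add: is_simple_path_iff)
  from pred_intros_logic(2)[OF this] show ?thesis by (simp add: pred_def)
qed

end

section \<open>Persistence of a dead end\<close>

lemma direction_level: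
  fixes e :: "int ^ 'a::finite"
  assumes "e \<in> directions"
  shows "e $ k = 1 \<longleftrightarrow> e = axis k 1" "e \<noteq> axis k 1 \<Longrightarrow> e $ k \<le> 0"
proof -
  from assms consider j where "e = axis j 1" | j where "e = - axis j 1"
    unfolding directions_def by blast
  then have "(e $ k = 1 \<longleftrightarrow> e = axis k 1) \<and> (e \<noteq> axis k 1 \<longrightarrow> e $ k \<le> 0)"
  proof cases
    case (1 j)
    moreover have "(axis j 1 :: int ^ 'a) $ k = (if j = k then 1 else 0)" by (simp add: axis_def)
    ultimately show ?thesis by (auto simp: axis_eq_axis)
  next
    case (2 j)
    then have "e $ k \<le> 0" by (simp add: axis_def)
    moreover have "(axis k 1 :: int ^ 'a) $ k = 1" by (simp add: axis_def)
    ultimately show ?thesis by auto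
  qed
  then show "e $ k = 1 \<longleftrightarrow> e = axis k 1" "e \<noteq> axis k 1 \<Longrightarrow> e $ k \<le> 0" by blast+
qed

context step_law
begin

lemma avg_two_steps:
  assumes e: "e \<in> directions"
  shows "avg q (Suc (Suc n)) (\<lambda>w. if w ! 0 = e \<and> w ! 1 = - e then f (drop 2 w) else 0) =
    pmf q e * (pmf q (- e) * avg q n f)"
proof -
  have e': "- e \<in> directions" using e by simp
  have inner: "avg q n (\<lambda>w. if a = e \<and> b = - e then f w else 0) = (if a = e \<and> b = - e then avg q n f else 0)" for a b
  proof (cases "a = e \<and> b = - e")
    case False
    then have "(\<lambda>w. if a = e \<and> b = - e then f w else 0) = (\<lambda>_. 0)" by auto
    then show ?thesis using False by (simp only: avg_const[OF supp] if_False)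
  qed simp
  have "avg q (Suc (Suc n)) (\<lambda>w. if w ! 0 = e \<and> w ! 1 = - e then f (drop 2 w) else 0) =
      (\<Sum>a\<in>directions. pmf q a * (\<Sum>b\<in>directions. pmf q b * (if a = e \<and> b = - e then avg q n f else 0)))"
  proof -
    have "(if (a # b # w) ! 0 = e \<and> (a # b # w) ! 1 = - e then f (drop 2 (a # b # w)) else 0) =
        (if a = e \<and> b = - e then f w else 0)" for a b w
      by simp
    then show ?thesis unfolding avg.simps by (simp only: inner)
  qed
  also have "\<dots> = (\<Sum>a\<in>directions. if a = e then pmf q e * (pmf q (- e) * avg q n f) else 0)"
  proof (rule sum.cong[OF refl])
    fix a
    have "(\<Sum>b\<in>directions. pmf q b * (if a = e \<and> b = - e then avg q n f else 0)) =
        (\<Sum>b\<in>directions. if b = - e then (if a = e then pmf q (- e) * avg q n f else 0) else 0)"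
      by (intro sum.cong) auto
    also have "\<dots> = (if a = e then pmf q (- e) * avg q n f else 0)"
      using e' by (subst sum.delta) auto
    finally show "pmf q a * (\<Sum>b\<in>directions. pmf q b * (if a = e \<and> b = - e then avg q n f else 0)) =
        (if a = e then pmf q e * (pmf q (- e) * avg q n f) else 0)" by simp
  qed
  also have "\<dots> = pmf q e * (pmf q (- e) * avg q n f)"
    using e by (subst sum.delta) auto
  finally show ?thesis .
qed

end

text \<open>The trace has a dead end at the neighbour \<open>e\<close> of the origin, and the walk leaves the origin
  for good at time \<open>2\<close>.\<close>

definition spike :: "'d::finite \<Rightarrow> int ^ 'd \<Rightarrow> (nat \<Rightarrow> int ^ 'd) \<Rightarrow> bool" where
  "spike k e x \<longleftrightarrow> x 1 - x 0 = e \<and> x 2 - x 1 = - e \<and> is_cut k x 2"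

text \<open>The summands are proportional to the resistances of the cut edges, and the escape
  probability is at most proportional to the inverse of their sum.\<close>

definition cut_series :: "'d::finite \<Rightarrow> real ^ 'd \<Rightarrow> (nat \<Rightarrow> int ^ 'd) \<Rightarrow> nat \<Rightarrow> real" where
  "cut_series k l x n = (if 2 \<le> n \<and> is_cut k x n then exp (- ip l (x n)) else 0)"

definition inverse_resistance :: "'d::finite \<Rightarrow> int ^ 'd \<Rightarrow> real ^ 'd \<Rightarrow> (nat \<Rightarrow> int ^ 'd) \<Rightarrow> real" where
  "inverse_resistance k e l x = (if spike k e x then 1 / (\<Sum>n. cut_series k l x n) else 0)"

lemma cut_series_nonneg: "0 \<le> cut_series k l x n"
  by (simp add: cut_series_def)

lemma summable_cut_series:
  assumes "summable (\<lambda>n. exp (- ip l (x n)))"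
  shows "summable (cut_series k l x)"
  by (rule summable_comparison_test'[OF assms, of 0]) (simp add: cut_series_def)

text \<open>A spike has a cut at time 2, when the walk is back at the origin, and this term is
  \<open>exp 0\<close>.\<close>

lemma cut_series_ge_1:
  assumes "summable (\<lambda>n. exp (- ip l (x n)))" "spike k e x" "x 0 = 0"
  shows "1 \<le> (\<Sum>n. cut_series k l x n)"
proof -
  have "x 2 = 0" using assms(2,3) by (auto simp: spike_def)
  then have "1 = (\<Sum>n\<in>{2}. cut_series k l x n)" using assms(2) by (simp add: cut_series_def spike_def)
  also have "\<dots> \<le> (\<Sum>n. cut_series k l x n)"
    by (intro sum_le_suminf summable_cut_series assms(1) cut_series_nonneg) auto
  finally show ?thesis .
qed

lemma inverse_resistance_bounds:
  assumes "summable (\<lambda>n. exp (- ip l (x n)))" "x 0 = 0"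
  shows "0 \<le> inverse_resistance k e l x" "inverse_resistance k e l x \<le> 1"
  using cut_series_ge_1[OF assms(1) _ assms(2), of k e] by (auto simp: inverse_resistance_def)

text \<open>The excursion returns to the origin without reaching a positive level, so deleting it
  neither creates nor destroys cuts.\<close>

lemma is_cut_shift:
  assumes "x 0 = 0" "x 1 $ k \<le> 0" "x 2 = 0"
  shows "is_cut k (\<lambda>j. x (2 + j)) n \<longleftrightarrow> is_cut k x (2 + n)"
proof
  assume c: "is_cut k (\<lambda>j. x (2 + j)) n"
  have low: "x (2 + j) $ k \<le> x (2 + n) $ k" if "j \<le> n" for j using c that unfolding is_cut_def by blast
  have high: "x (2 + n) $ k < x (2 + j) $ k" if "n < j" for j using c that unfolding is_cut_def by blast
  have n0: "0 \<le> x (2 + n) $ k" using low[of 0] assms(3) by simp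
  show "is_cut k x (2 + n)"
    unfolding is_cut_def
  proof (intro conjI allI impI)
    fix j assume "j \<le> 2 + n"
    then consider "j = 0" | "j = 1" | "j = 2 + (j - 2)" "j - 2 \<le> n" by fastforce
    then show "x j $ k \<le> x (2 + n) $ k"
    proof cases
      case 1
      then show ?thesis using n0 assms(1) by simp
    next
      case 2
      then show ?thesis using n0 assms(2) by simp
    next
      case 3
      then show ?thesis using low[of "j - 2"] by simp
    qed
  next
    fix j assume "2 + n < j"
    then have "j = 2 + (j - 2)" "n < j - 2" by auto
    then show "x (2 + n) $ k < x j $ k" using high[of "j - 2"] by simp
  qed
next
  assume c: "is_cut k x (2 + n)"
  show "is_cut k (\<lambda>j. x (2 + j)) n"
    unfolding is_cut_def
  proof (intro conjI allI impI)
    show "x (2 + j) $ k \<le> x (2 + n) $ k" if "j \<le> n" for j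
      using c that unfolding is_cut_def by simp
    show "x (2 + n) $ k < x (2 + j) $ k" if "n < j" for j
      using c that unfolding is_cut_def by simp
  qed
qed

text \<open>Tannery's theorem: for fixed \<open>m\<close> the local cut condition stabilises as the
  horizon grows, the full exponential series dominates, and the additional end term of
  \<open>ztot\<close> tends to 0.\<close>

lemma ztot_tendsto:
  assumes sum: "summable (\<lambda>n. exp (- ip l (x n)))" and x0: "x 0 = 0"
  shows "(\<lambda>N. ztot l k (incr x (Suc N)) 0) \<longlonglongrightarrow> (\<Sum>m. if is_cut k x m then exp (- ip l (x m)) else 0)"
proof -
  let ?a = "\<lambda>m N. if m < Suc N \<and> lcut k (incr x (Suc N)) m then exp (- ip l (x m)) else 0"
  let ?b = "\<lambda>m. if is_cut k x m then exp (- ip l (x m)) else 0"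
  have "(\<lambda>N. \<Sum>m. ?a m N) \<longlonglongrightarrow> (\<Sum>m. ?b m)"
  proof (rule tannerys_theorem[THEN conjunct2, THEN conjunct2])
    show "summable (\<lambda>n. exp (- ip l (x n)))" by (rule sum)
    show "(\<lambda>N. ?a m N) \<longlonglongrightarrow> ?b m" for m
    proof (rule tendsto_eventually)
      show "eventually (\<lambda>N. ?a m N = ?b m) sequentially"
      proof (cases "is_cut k x m")
        case True
        then have "?a m N = ?b m" if "m \<le> N" for N
          using that unfolding is_cut_lcut by simp
        then show ?thesis unfolding eventually_sequentially by blast
      next
        case False
        then obtain N0 where N0: "m < N0" "\<not> lcut k (incr x N0) m" unfolding is_cut_lcut by blast
        have "\<not> lcut k (incr x N) m" if "N0 \<le> N" for N
          using N0 that unfolding lcut_incr by auto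
        then have "?a m N = ?b m" if "N0 \<le> N" for N
          using that False by simp
        then show ?thesis unfolding eventually_sequentially by blast
      qed
    qed
    show "eventually (\<lambda>(m, N). norm (?a m N) \<le> exp (- ip l (x m))) (sequentially \<times>\<^sub>F sequentially)"
      by (intro always_eventually) (auto split: if_splits)
  qed simp
  moreover have "(\<Sum>m. ?a m N) = (\<Sum>m\<in>{0..<Suc N}. if lcut k (incr x (Suc N)) m then exp (- ip l (sum_list (take m (incr x (Suc N))))) else 0)" for N
  proof -
    have "(\<Sum>m. ?a m N) = (\<Sum>m\<in>{0..<Suc N}. ?a m N)"
      by (rule suminf_finite) auto
    also have "\<dots> = (\<Sum>m\<in>{0..<Suc N}. if lcut k (incr x (Suc N)) m then exp (- ip l (sum_list (take m (incr x (Suc N))))) else 0)"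
      using x0 by (intro sum.cong refl) auto
    finally show ?thesis .
  qed
  moreover have "(\<lambda>N. exp (- ip l (x (Suc N)))) \<longlonglongrightarrow> 0"
    using summable_LIMSEQ_zero[OF sum] by (rule LIMSEQ_Suc)
  ultimately have "(\<lambda>N. (\<Sum>m\<in>{0..<Suc N}. if lcut k (incr x (Suc N)) m then exp (- ip l (sum_list (take m (incr x (Suc N))))) else 0) + exp (- ip l (x (Suc N)))) \<longlonglongrightarrow> (\<Sum>m. ?b m) + 0"
    by (intro tendsto_add) simp_all
  then show ?thesis using x0 by (simp add: ztot_def)
qed

text \<open>The analogue of \<open>inverse_resistance\<close> for a finite list of increments, whose expectation
  \<open>sum_avg_zinv_le\<close> controls on average.\<close>

definition finite_inverse_resistance :: "'d::finite \<Rightarrow> int ^ 'd \<Rightarrow> real ^ 'd \<Rightarrow> (int ^ 'd) list \<Rightarrow> real" where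
  "finite_inverse_resistance k e l w = (if w ! 0 = e \<and> w ! 1 = - e then zinv l k (drop 2 w) else 0)"

lemma fwd_cut_2:
  assumes x: "x 0 = 0" "x 1 - x 0 = e" "x 2 - x 1 = - e" and e: "e $ k \<le> 0"
  shows "is_cut k x 2 \<longleftrightarrow> (\<forall>N. fwd k (incr (\<lambda>j. x (2 + j)) (Suc N)))"
proof -
  have x2: "x 1 = e" "x 2 = 0" using x by auto
  have "is_cut k x 2 \<longleftrightarrow> (\<forall>j>2. 0 < x j $ k)"
  proof -
    have "x j $ k \<le> x 2 $ k" if "j \<le> 2" for j
    proof -
      have "j = 0 \<or> j = 1 \<or> j = 2" using that by auto
      then show ?thesis using x(1) x2 e by auto
    qed
    then show ?thesis unfolding is_cut_def using x2 by auto
  qed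
  also have "\<dots> \<longleftrightarrow> (\<forall>N. fwd k (incr (\<lambda>j. x (2 + j)) (Suc N)))"
  proof
    assume *: "\<forall>j>2. 0 < x j $ k"
    show "\<forall>N. fwd k (incr (\<lambda>j. x (2 + j)) (Suc N))"
      unfolding fwd_incr using * x2 by simp
  next
    assume *: "\<forall>N. fwd k (incr (\<lambda>j. x (2 + j)) (Suc N))"
    show "\<forall>j>2. 0 < x j $ k"
    proof (intro allI impI)
      fix j :: nat assume j: "2 < j"
      have "fwd k (incr (\<lambda>j. x (2 + j)) (Suc (j - 2)))" using * by blast
      then have "x (2 + 0) $ k < x (2 + (j - 2)) $ k"
        unfolding fwd_incr using j by (elim conjE) (drule bspec[of _ _ "j - 2"], auto)
      moreover have "2 + (j - 2) = j" using j by simp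
      ultimately show "0 < x j $ k" using x2 by (simp only: add_0_right zero_index)
    qed
  qed
  finally show ?thesis .
qed

lemma drop_2_incr: "drop 2 (incr x (Suc (Suc (Suc N)))) = incr (\<lambda>j. x (2 + j)) (Suc N)"
  by (subst drop_incr) simp_all

lemma incr_0_1: "incr x (Suc (Suc n)) ! 0 = x 1 - x 0" "incr x (Suc (Suc n)) ! 1 = x 2 - x 1"
  by (simp_all add: numeral_2_eq_2)

text \<open>On a spike both sides are reciprocals of convergent sums. If time 2 is not a cut, some
  finite horizon detects it and the approximants are 0 from then on.\<close>

lemma finite_inverse_resistance_tendsto:
  assumes sum: "summable (\<lambda>n. exp (- ip l (x n)))" and x0: "x 0 = 0" and e: "e $ k \<le> 0"
  shows "(\<lambda>N. finite_inverse_resistance k e l (incr x (Suc (Suc (Suc N))))) \<longlonglongrightarrow> inverse_resistance k e l x"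
proof (cases "x 1 - x 0 = e \<and> x 2 - x 1 = - e")
  case False
  then show ?thesis
    unfolding finite_inverse_resistance_def incr_0_1 inverse_resistance_def spike_def by auto
next
  case True
  then have x2: "x 1 = e" "x 2 = 0" using x0 by auto
  let ?x = "\<lambda>j. x (2 + j)"
  have fin: "finite_inverse_resistance k e l (incr x (Suc (Suc (Suc N)))) = zinv l k (incr ?x (Suc N))" for N
    unfolding finite_inverse_resistance_def incr_0_1 drop_2_incr using True by simp
  show ?thesis
  proof (cases "is_cut k x 2")
    case cut: True
    then have fwd: "fwd k (incr ?x (Suc N))" for N using fwd_cut_2[where x = x and e = e and k = k] x0 e True by blast
    have s': "summable (\<lambda>n. exp (- ip l (?x n)))"
      using summable_ignore_initial_segment[OF sum, of 2] by (simp add: add.commute)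
    have "(\<Sum>m. if is_cut k ?x m then exp (- ip l (?x m)) else 0) = (\<Sum>n. cut_series k l x n)"
    proof -
      have "(\<Sum>m. if is_cut k ?x m then exp (- ip l (?x m)) else 0) = (\<Sum>m. cut_series k l x (m + 2))"
        using is_cut_shift[OF x0 _ x2(2), of k] x2 e by (intro suminf_cong) (simp add: cut_series_def add.commute)
      also have "\<dots> = (\<Sum>n. cut_series k l x n) - (\<Sum>n<2. cut_series k l x n)"
        by (rule suminf_minus_initial_segment[OF summable_cut_series[OF sum]])
      also have "(\<Sum>n<2. cut_series k l x n) = 0" by (simp add: cut_series_def)
      finally show ?thesis by simp
    qed
    then have "(\<lambda>N. ztot l k (incr ?x (Suc N)) 0) \<longlonglongrightarrow> (\<Sum>n. cut_series k l x n)"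
      using ztot_tendsto[OF s', of k] x2 by simp
    moreover have spike: "spike k e x" using True cut by (simp add: spike_def)
    moreover have "(\<Sum>n. cut_series k l x n) \<noteq> 0" using cut_series_ge_1[OF sum spike x0] by simp
    ultimately have "(\<lambda>N. 1 / ztot l k (incr ?x (Suc N)) 0) \<longlonglongrightarrow> 1 / (\<Sum>n. cut_series k l x n)"
      by (intro tendsto_divide tendsto_const)
    then show ?thesis unfolding fin zinv_def inverse_resistance_def using fwd spike by simp
  next
    case False
    then obtain N0 where N0: "\<not> fwd k (incr ?x (Suc N0))" using fwd_cut_2[where x = x and e = e and k = k] x0 e True by blast
    have "\<not> fwd k (incr ?x (Suc N))" if "N0 \<le> N" for N
      using N0 that unfolding fwd_incr by auto
    then have "zinv l k (incr ?x (Suc N)) = 0" if "N0 \<le> N" for N using that by (simp add: zinv_def)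
    then have "(\<lambda>N. zinv l k (incr ?x (Suc N))) \<longlonglongrightarrow> 0"
      by (intro tendsto_eventually) (auto simp: eventually_sequentially)
    then show ?thesis unfolding fin inverse_resistance_def using False by (simp add: spike_def)
  qed
qed

lemma zinv_bounds: "0 \<le> zinv l k v" "zinv l k v \<le> 1"
proof -
  show "0 \<le> zinv l k v" using ztot_pos[of l k v 0] by (simp add: zinv_def)
  show "zinv l k v \<le> 1"
  proof (cases "fwd k v")
    case True
    then have "lcut k v 0" "0 < length v" by (auto simp: lcut_def bwd_def fwd_def)
    then have "1 = (\<Sum>m\<in>{0}. if lcut k v m then exp (- ip l (sum_list (take m v))) else 0)" by simp
    also have "\<dots> \<le> (\<Sum>m\<in>{0..<length v}. if lcut k v m then exp (- ip l (sum_list (take m v))) else 0)"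
      using \<open>0 < length v\<close> by (intro sum_mono2) auto
    also have "\<dots> \<le> ztot l k v 0" by (simp add: ztot_def)
    finally show ?thesis by (simp add: zinv_def)
  qed (simp add: zinv_def)
qed

section \<open>Spikes and the mean inverse resistance\<close>

context directed_walks
begin

lemma spike_measurable:
  assumes X: "\<And>n. X 0 n \<in> measurable N (count_space UNIV)"
  shows "Measurable.pred N (\<lambda>\<omega>. spike k e (walk0 \<omega>))"
  unfolding spike_def
  by (intro pred_intros_logic(3) is_cut_pred X
    measurable_countable_fun2[OF X X, where h = "\<lambda>a b. a - b = e"]
    measurable_countable_fun2[OF X X, where h = "\<lambda>a b. a - b = - e"])

lemma inverse_resistance_measurable:
  assumes X: "\<And>n. X 0 n \<in> measurable N (count_space UNIV)"
  shows "(\<lambda>\<omega>. inverse_resistance k e l (walk0 \<omega>)) \<in> borel_measurable N"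
proof -
  have C: "{\<omega> \<in> space N. is_cut k (walk0 \<omega>) n} \<in> sets N" for n
    using is_cut_pred[OF X] by (simp add: pred_def)
  have E: "(\<lambda>\<omega>. exp (- ip l (X 0 n \<omega>))) \<in> borel_measurable N" for n
    by (rule borel_measurable_countable_fun2[OF X X, where h = "\<lambda>a b. exp (- ip l a)"])
  have "(\<lambda>\<omega>. cut_series k l (walk0 \<omega>) n) \<in> borel_measurable N" for n
  proof (cases "2 \<le> n")
    case True
    then have "(\<lambda>\<omega>. cut_series k l (walk0 \<omega>) n) = (\<lambda>\<omega>. if is_cut k (walk0 \<omega>) n then exp (- ip l (X 0 n \<omega>)) else 0)"
      by (simp add: cut_series_def)
    then show ?thesis by (simp only: measurable_If[OF E _ C] measurable_const UNIV_I space_borel)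
  qed (simp add: cut_series_def)
  then have "(\<lambda>\<omega>. \<Sum>n. cut_series k l (walk0 \<omega>) n) \<in> borel_measurable N"
    by (rule borel_measurable_suminf)
  then have "(\<lambda>\<omega>. 1 / (\<Sum>n. cut_series k l (walk0 \<omega>) n)) \<in> borel_measurable N"
    by (rule borel_measurable_divide[OF borel_measurable_const])
  moreover have "{\<omega> \<in> space N. spike k e (walk0 \<omega>)} \<in> sets N"
    using spike_measurable[OF X] by (simp add: pred_def)
  ultimately show ?thesis
    unfolding inverse_resistance_def by (rule measurable_If[OF _ borel_measurable_const])
qed

text \<open>Two prescribed steps followed by survival above the starting level. The bound is the
  same for all horizons and passes to the intersection of the decreasing events.\<close>

lemma prob_spike_pos:
  assumes e: "e \<in> directions" "e \<noteq> axis k 1"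
  shows "0 < prob {\<omega> \<in> space M. spike k e (walk0 \<omega>)}"
proof -
  let ?A = "\<lambda>N. {\<omega> \<in> space M. (\<lambda>w. w ! 0 = e \<and> w ! 1 = - e \<and> fwd k (drop 2 w)) (incr (walk0 \<omega>) (Suc (Suc (Suc N))))}"
  let ?\<eta> = "pmf (p 0) e * (pmf (p 0) (- e) * (pmf (p 0) (axis k 1) * (1 - pmf (p 0) (- axis k 1) / pmf (p 0) (axis k 1))))"
  have e': "- e \<in> directions" "e $ k \<le> 0" using e direction_level(2) by auto
  have "?\<eta> \<le> prob (?A N)" for N
  proof -
    have "?\<eta> \<le> pmf (p 0) e * (pmf (p 0) (- e) * avg (p 0) (Suc N) (\<lambda>w. if fwd k w then 1 else 0))"
      by (intro mult_left_mono p0.avg_fwd_ge k_bias) auto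
    also have "\<dots> = avg (p 0) (Suc (Suc (Suc N))) (\<lambda>w. if w ! 0 = e \<and> w ! 1 = - e then (if fwd k (drop 2 w) then 1 else 0) else 0)"
      by (rule p0.avg_two_steps[OF e(1), symmetric])
    also have "\<dots> = avg (p 0) (Suc (Suc (Suc N))) (\<lambda>w. if w ! 0 = e \<and> w ! 1 = - e \<and> fwd k (drop 2 w) then 1 else 0)"
      by (rule avg_cong) simp
    also have "\<dots> = prob (?A N)" by (rule prob_incr_pred[symmetric])
    finally show ?thesis .
  qed
  moreover have "(\<lambda>N. prob (?A N)) \<longlonglongrightarrow> prob (\<Inter>N. ?A N)"
  proof (rule finite_Lim_measure_decseq)
    show "range ?A \<subseteq> events"
      using measurable_compose[OF incr_measurable, of _ "count_space UNIV"] by auto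
    show "decseq ?A"
      unfolding decseq_Suc_iff incr_0_1 drop_2_incr fwd_incr by auto
  qed
  ultimately have "?\<eta> \<le> prob (\<Inter>N. ?A N)"
    by (intro LIMSEQ_le_const) blast+
  also have "\<dots> = prob {\<omega> \<in> space M. spike k e (walk0 \<omega>)}"
  proof (rule finite_measure_eq_AE)
    show "AE \<omega> in M. \<omega> \<in> (\<Inter>N. ?A N) \<longleftrightarrow> \<omega> \<in> {\<omega> \<in> space M. spike k e (walk0 \<omega>)}"
      using AE_walk_0
    proof eventually_elim
      case (elim \<omega>)
      show ?case
        unfolding incr_0_1 drop_2_incr spike_def using fwd_cut_2[of "walk0 \<omega>" e k] elim e' by auto
    qed
    show "(\<Inter>N. ?A N) \<in> events"
      using measurable_compose[OF incr_measurable, of _ "count_space UNIV"] by (intro sets.countable_INT') auto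
    show "{\<omega> \<in> space M. spike k e (walk0 \<omega>)} \<in> events"
      using spike_measurable[OF X_measurable] by (simp add: pred_def)
  qed
  finally have "?\<eta> \<le> prob {\<omega> \<in> space M. spike k e (walk0 \<omega>)}" .
  moreover have "0 < ?\<eta>"
    using e e' by (intro mult_pos_pos pos bias_pos axis_direction)
  ultimately show ?thesis by simp
qed

text \<open>Dominated convergence passes from finite words to the walk. The probability of the two
  prescribed steps is bounded by 1, which leaves \<open>\<psi>\<close>; of this only the averages
  are controlled, by \<open>sum_avg_zinv_le\<close>.\<close>

lemma expectation_inverse_resistance:
  assumes e: "e \<in> directions" "e \<noteq> axis k 1" and l: "0 < p0.mean l"
  shows "integrable M (\<lambda>\<omega>. inverse_resistance k e l (walk0 \<omega>))"
    and "(1 - pmf (p 0) (- axis k 1) / pmf (p 0) (axis k 1)) * expectation (\<lambda>\<omega>. inverse_resistance k e l (walk0 \<omega>)) \<le> p0.mean l"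
    and "expectation (\<lambda>\<omega>. inverse_resistance k e l (walk0 \<omega>)) \<le> 1"
proof -
  let ?J = "\<lambda>\<omega>. inverse_resistance k e l (walk0 \<omega>)"
  let ?F = "\<lambda>N \<omega>. finite_inverse_resistance k e l (incr (walk0 \<omega>) (Suc (Suc (Suc N))))"
  let ?\<rho> = "1 - pmf (p 0) (- axis k 1) / pmf (p 0) (axis k 1)"
  have ek: "e $ k \<le> 0" using e direction_level(2) by auto
  have J [measurable]: "?J \<in> borel_measurable M" by (rule inverse_resistance_measurable[OF X_measurable])
  have bounds: "AE \<omega> in M. norm (?J \<omega>) \<le> 1" "AE \<omega> in M. ?J \<omega> \<le> 1"
  proof -
    have "AE \<omega> in M. 0 \<le> ?J \<omega> \<and> ?J \<omega> \<le> 1"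
      using AE_summable_exp[OF l] AE_walk_0
    proof eventually_elim
      case (elim \<omega>)
      then show ?case using inverse_resistance_bounds[OF elim(1)] by simp
    qed
    then show "AE \<omega> in M. norm (?J \<omega>) \<le> 1" "AE \<omega> in M. ?J \<omega> \<le> 1"
      by (eventually_elim, simp)+
  qed
  show int: "integrable M ?J"
    by (rule integrable_const_bound[OF bounds(1) J])
  have "expectation ?J \<le> expectation (\<lambda>_. 1)"
    by (rule integral_mono_AE[OF int _ bounds(2)]) simp
  then show "expectation ?J \<le> 1" by (simp add: prob_space)
  have lim: "(\<lambda>N. expectation (?F N)) \<longlonglongrightarrow> expectation ?J"
  proof (rule integral_dominated_convergence[where w = "\<lambda>_. 1"])
    show "AE \<omega> in M. (\<lambda>N. ?F N \<omega>) \<longlonglongrightarrow> ?J \<omega>"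
      using AE_summable_exp[OF l] AE_walk_0
    proof eventually_elim
      case (elim \<omega>)
      show ?case by (rule finite_inverse_resistance_tendsto[OF elim(1) _ ek]) (simp add: elim)
    qed
    show "AE \<omega> in M. norm (?F N \<omega>) \<le> 1" for N
      by (intro AE_I2) (simp add: finite_inverse_resistance_def zinv_bounds)
  qed (use J in simp_all)
  define \<psi> where "\<psi> = (\<lambda>N. avg (p 0) (Suc N) (zinv l k))"
  have \<psi>0: "0 \<le> \<psi> N" for N
    unfolding \<psi>_def avg_eq_sum by (intro sum_nonneg mult_nonneg_nonneg prod_list_pmf_nonneg zinv_bounds)
  have F\<psi>: "expectation (?F N) \<le> \<psi> N" for N
  proof -
    have "expectation (?F N) = avg (p 0) (Suc (Suc (Suc N))) (finite_inverse_resistance k e l)"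
      by (rule expectation_incr(2))
    also have "\<dots> = pmf (p 0) e * (pmf (p 0) (- e) * \<psi> N)"
      unfolding finite_inverse_resistance_def \<psi>_def by (rule p0.avg_two_steps[OF e(1)])
    also have "\<dots> \<le> 1 * (1 * \<psi> N)"
      by (intro mult_mono pmf_le_1) (auto simp: \<psi>0)
    finally show ?thesis by simp
  qed
  define R where "R = ?\<rho>"
  have R: "0 < R" unfolding R_def by (rule bias_pos)
  obtain K where K: "\<And>n. R * (\<Sum>m<n. \<psi> m) \<le> real n * p0.mean l + K"
    using p0.sum_avg_zinv_le[OF k_bias l] unfolding \<psi>_def R_def by blast
  show "?\<rho> * expectation ?J \<le> p0.mean l"
    unfolding R_def[symmetric]
  proof (rule ccontr)
    \<comment> \<open>Otherwise \<open>\<psi>\<close> would eventually stay above some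
      \<open>c\<close> with \<open>R * c\<close> larger than \<open>p0.mean l\<close>, and its
      partial sums would outgrow the bound, in which \<open>K\<close> is constant.\<close>
    assume "\<not> R * expectation ?J \<le> p0.mean l"
    then have "p0.mean l / R < expectation ?J" using R by (simp add: divide_less_eq mult.commute)
    then obtain c where c: "p0.mean l / R < c" "c < expectation ?J" using dense by blast
    then obtain N0 where N0: "\<And>N. N0 \<le> N \<Longrightarrow> c < expectation (?F N)"
      using order_tendstoD(1)[OF lim c(2)] unfolding eventually_sequentially by blast
    have \<psi>c: "c \<le> \<psi> N" if "N0 \<le> N" for N using N0[OF that] F\<psi>[of N] by simp
    have d: "0 < R * c - p0.mean l" using c(1) R by (simp add: divide_less_eq mult.commute)
    have "real n * (R * c - p0.mean l) \<le> K + real N0 * p0.mean l" for n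
    proof -
      have "real n * c = (\<Sum>m\<in>{N0..<N0 + n}. c)" by simp
      also have "\<dots> \<le> (\<Sum>m\<in>{N0..<N0 + n}. \<psi> m)" by (intro sum_mono \<psi>c) simp
      also have "\<dots> \<le> (\<Sum>m<N0 + n. \<psi> m)" by (intro sum_mono2 \<psi>0) auto
      finally have "R * (real n * c) \<le> R * (\<Sum>m<N0 + n. \<psi> m)" using R by (intro mult_left_mono) auto
      also have "\<dots> \<le> real (N0 + n) * p0.mean l + K" by (rule K)
      finally show ?thesis by (simp add: algebra_simps)
    qed
    moreover obtain n where "K + real N0 * p0.mean l < real n * (R * c - p0.mean l)"
      using reals_Archimedean3[OF d] by blast
    ultimately show False by (meson not_le)
  qed
qed

text \<open>After time 2 the level is positive while that of \<open>e\<close> is not, so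
  \<open>e\<close> is visited only at time 1, between two visits to the origin.\<close>

lemma spike_neighbours:
  assumes reg: "regular \<omega>" and spike: "spike k e (walk0 \<omega>)" and e: "e \<in> directions" "e \<noteq> axis k 1" and i: "1 \<le> i"
    and z: "{e, z} \<in> snd (walk_graph X i \<omega>)"
  shows "z = 0"
proof -
  have x: "X 0 0 \<omega> = 0" "X 0 1 \<omega> = e" "X 0 2 \<omega> = 0"
    using regularD(1)[OF reg, of 0] spike by (auto simp: spike_def)
  have ek: "e $ k \<le> 0" using e direction_level(2) by auto
  have e0: "e \<noteq> 0" using e by auto
  have late: "X 0 j \<omega> \<noteq> e" if "2 \<le> j" for j
  proof (cases "j = 2")
    case True
    then show ?thesis using x e0 by simp
  next
    case False
    then have "0 < X 0 j \<omega> $ k" using spike that x(3) unfolding spike_def is_cut_def by auto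
    then show ?thesis using ek by auto
  qed
  have "{e, z} \<in> snd (walk_graph X (Suc 0) \<omega>)"
    using z regularD(6)[OF reg, of "Suc 0" i] i by auto
  then obtain j where j: "{e, z} = {X 0 j \<omega>, X 0 (Suc j) \<omega>}" by (auto simp: trace_graph_def)
  then consider "X 0 j \<omega> = e" "z = X 0 (Suc j) \<omega>" | "X 0 (Suc j) \<omega> = e" "z = X 0 j \<omega>"
    unfolding doubleton_eq_iff by blast
  then show ?thesis
  proof cases
    case 1
    then have "j < 2" using late[of j] by (cases "2 \<le> j") auto
    then have "j = 0 \<or> j = 1" by auto
    then have "j = 1" using 1 x e0 by auto
    then show ?thesis using 1(2) x by (simp add: numeral_2_eq_2)
  next
    case 2
    then have "Suc j < 2" using late[of "Suc j"] by (cases "2 \<le> Suc j") auto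
    then show ?thesis using 2(2) x by simp
  qed
qed

text \<open>Apply \<open>esc_upper_bound\<close> to the cut edges at the times from 2 up to
  \<open>N\<close>, then let \<open>N\<close> tend to infinity.\<close>

lemma esc_lim_spike:
  assumes reg: "regular \<omega>" and spike: "spike k e (walk0 \<omega>)" and e: "e \<in> directions" "e \<noteq> axis k 1" and i: "1 \<le> i"
    and edge: "{0, e} \<in> snd (walk_graph X i \<omega>)"
    and sum: "summable (\<lambda>n. exp (- ip (ell_hat (p (enat i))) (X 0 n \<omega>)))"
  shows "esc_lim (p (enat i)) (walk_graph X i \<omega>) UNIV {e} 0 \<le>
    pmf (p (enat i)) (axis k 1) / pmf (p (enat i)) e * inverse_resistance k e (ell_hat (p (enat i))) (walk0 \<omega>)"
proof -
  let ?q = "p (enat i)" and ?G = "walk_graph X i \<omega>"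
  let ?l = "ell_hat ?q" and ?x = "walk0 \<omega>"
  interpret q: step_law ?q by (rule step_law)
  have x: "?x 0 = 0" "?x 1 = e" "?x 2 = 0"
    using regularD(1)[OF reg, of 0] spike by (auto simp: spike_def)
  have cut2: "is_cut k ?x 2" using spike by (simp add: spike_def)
  define E where "E = esc_lim ?q ?G UNIV {e} 0"
  have E: "0 \<le> E" unfolding E_def by (rule esc_lim_nonneg)
  have pe: "0 < pmf ?q e" "0 < pmf ?q (axis k 1)" using pos e axis_direction by auto
  \<comment> \<open>A cut edge raises the level, so it points along \<open>axis k 1\<close>; hence
    the cut conductances differ only by their exponential factors.\<close>
  have jump: "?x (Suc n) - ?x n = axis k 1" if "is_cut k ?x n" for n
  proof -
    have d: "?x (Suc n) - ?x n \<in> directions" by (rule regularD(5)[OF reg])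
    have "?x n $ k < ?x (Suc n) $ k" using that unfolding is_cut_def by simp
    then have "(?x (Suc n) - ?x n) $ k = 1" using direction_le_1[OF d, of k] by simp
    then show ?thesis using direction_level(1)[OF d, of k] by blast
  qed
  have mono: "?x n $ k < ?x m $ k" if "is_cut k ?x n" "n < m" for n m
    using that unfolding is_cut_def by blast
  have partial: "E * (\<Sum>n<N. cut_series k ?l ?x n) \<le> pmf ?q (axis k 1) / pmf ?q e" if N: "2 < N" for N
  proof -
    define I where "I = {n. 2 \<le> n \<and> n < N \<and> is_cut k ?x n}"
    have I: "finite I" "2 \<in> I" using N cut2 by (auto simp: I_def)
    define m where "m = Max I"
    have m: "m \<in> I" "\<And>n. n \<in> I \<Longrightarrow> n \<le> m" using I unfolding m_def by (auto intro: Max_in)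
    have "cc ?q 0 e * E \<le> 1 / (\<Sum>n\<in>I. 1 / cc ?q (?x n) (?x (Suc n)))"
      unfolding E_def
    proof (rule q.esc_upper_bound[where B = "\<lambda>n. ?x ` {..n}" and m = m])
      show "is_lattice ?G" by (rule regularD(4)[OF reg])
      show "{e, 0} \<in> snd ?G" using edge by (simp add: insert_commute)
      show "z = 0" if "{e, z} \<in> snd ?G" for z by (rule spike_neighbours[OF reg spike e i that])
      show "finite I" "m \<in> I" using I m by auto
      fix n assume n: "n \<in> I"
      have "e \<in> ?x ` {..n}" using x(2) n by (intro image_eqI[of _ _ 1]) (auto simp: I_def)
      moreover have "boundary_edge ?G (?x ` {..n}) (?x n) (?x (Suc n))"
        using n by (intro cut_boundary_edge reg i) (simp add: I_def)
      ultimately show "finite (?x ` {..n}) \<and> e \<in> ?x ` {..n} \<and> boundary_edge ?G (?x ` {..n}) (?x n) (?x (Suc n)) \<and> ?x (Suc n) - ?x n \<in> directions"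
        using regularD(5)[OF reg, of 0 n] by simp
      show "?x ` {..n} \<subseteq> ?x ` {..m}" using m(2)[OF n] by (intro image_mono) auto
      show "?x (Suc n) \<in> insert (?x (Suc m)) (?x ` {..m})"
        using m(2)[OF n] by (cases "n = m") auto
    next
      show "0 \<in> ?x ` {..m}" using x(1) by (intro image_eqI[of _ _ 0]) auto
      show "inj_on (\<lambda>n. {?x n, ?x (Suc n)}) I"
      proof (rule linorder_inj_onI)
        fix n n' assume nn: "n < n'" "n \<in> I" "n' \<in> I"
        have "?x n $ k < ?x n' $ k" "?x n $ k < ?x (Suc n') $ k"
          using mono[of n] nn by (auto simp: I_def)
        then show "{?x n, ?x (Suc n)} \<noteq> {?x n', ?x (Suc n')}"
          unfolding doubleton_eq_iff by auto
      qed auto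
    qed
    moreover have "cc ?q 0 e = pmf ?q e" by (simp add: cc_def)
    moreover have "(\<Sum>n\<in>I. 1 / cc ?q (?x n) (?x (Suc n))) = (\<Sum>n<N. cut_series k ?l ?x n) / pmf ?q (axis k 1)"
    proof -
      have "(\<Sum>n<N. cut_series k ?l ?x n) = (\<Sum>n\<in>I. exp (- ip ?l (?x n)))"
      proof (rule sum.mono_neutral_cong_right)
        show "\<forall>n\<in>{..<N} - I. cut_series k ?l ?x n = 0" by (auto simp: I_def cut_series_def)
        show "cut_series k ?l ?x n = exp (- ip ?l (?x n))" if "n \<in> I" for n using that by (simp add: I_def cut_series_def)
      qed (auto simp: I_def)
      moreover have "1 / cc ?q (?x n) (?x (Suc n)) = exp (- ip ?l (?x n)) / pmf ?q (axis k 1)" if "n \<in> I" for n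
      proof -
        have "?x (Suc n) - ?x n = axis k 1" using jump that by (simp add: I_def)
        then show ?thesis by (simp add: cc_def exp_minus field_simps)
      qed
      ultimately show ?thesis by (simp add: sum_divide_distrib)
    qed
    ultimately have "pmf ?q e * E \<le> 1 / ((\<Sum>n<N. cut_series k ?l ?x n) / pmf ?q (axis k 1))" by simp
    moreover have "0 < (\<Sum>n<N. cut_series k ?l ?x n)"
      using N cut2 by (intro sum_pos2[of _ 2] cut_series_nonneg) (auto simp: cut_series_def)
    ultimately show ?thesis using pe by (simp add: field_simps)
  qed
  have summable: "summable (cut_series k ?l ?x)" by (rule summable_cut_series[OF sum])
  have "(\<lambda>N. E * (\<Sum>n<N. cut_series k ?l ?x n)) \<longlonglongrightarrow> E * (\<Sum>n. cut_series k ?l ?x n)"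
    by (intro tendsto_mult tendsto_const summable_LIMSEQ summable)
  moreover have "\<exists>N0. \<forall>N\<ge>N0. E * (\<Sum>n<N. cut_series k ?l ?x n) \<le> pmf ?q (axis k 1) / pmf ?q e"
    using partial by (intro exI[of _ 3]) auto
  ultimately have "E * (\<Sum>n. cut_series k ?l ?x n) \<le> pmf ?q (axis k 1) / pmf ?q e"
    by (rule LIMSEQ_le_const2)
  moreover have "1 \<le> (\<Sum>n. cut_series k ?l ?x n)"
    by (rule cut_series_ge_1[OF sum spike x(1)])
  ultimately have "E \<le> pmf ?q (axis k 1) / pmf ?q e / (\<Sum>n. cut_series k ?l ?x n)"
    by (subst pos_le_divide_eq) auto
  then have "E \<le> pmf ?q (axis k 1) / pmf ?q e * (1 / (\<Sum>n. cut_series k ?l ?x n))"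
    by (simp only: times_divide_eq_right mult_1_right)
  then show ?thesis using spike by (simp add: E_def inverse_resistance_def)
qed

end

section \<open>Positive probability of a surviving dead end\<close>

context directed_walks
begin

text \<open>The dead end can be entered only from the origin, so a walk that visits \<open>e\<close>
  traverses the edge and keeps it in its trace.\<close>

lemma spike_edge:
  assumes reg: "regular \<omega>" and spike: "spike k e (walk0 \<omega>)" and e: "e \<in> directions" "e \<noteq> axis k 1"
    and visit: "\<forall>i\<in>{1..<n}. \<exists>t. X i t \<omega> = e" and n: "1 \<le> n"
  shows "{0, e} \<in> snd (walk_graph X n \<omega>)"
proof (cases "n = 1")
  case True
  have "X 0 0 \<omega> = 0" "X 0 (Suc 0) \<omega> = e"
    using regularD(1)[OF reg, of 0] spike by (auto simp: spike_def)
  then have "{0, e} = {X 0 0 \<omega>, X 0 (Suc 0) \<omega>}" by simp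
  then show ?thesis unfolding True One_nat_def walk_graph.simps trace_graph_def snd_conv by blast
next
  case False
  then obtain j where j: "n = Suc j" "1 \<le> j" using n by (cases n) auto
  then obtain t where t: "X j t \<omega> = e" using bspec[OF visit, of j] by auto
  have "e \<noteq> 0" using e by auto
  then have "t \<noteq> 0" using t regularD(1)[OF reg, of j] by (cases t) auto
  then obtain s where s: "t = Suc s" by (cases t) auto
  have "{e, X j s \<omega>} \<in> snd (walk_graph X j \<omega>)"
    using regularD(2)[OF reg, of j s] t s by (simp add: insert_commute)
  then have "X j s \<omega> = 0" by (rule spike_neighbours[OF reg spike e j(2)])
  then have "{0, e} = {X j s \<omega>, X j (Suc s) \<omega>}" using t s by simp
  then show ?thesis unfolding j(1) walk_graph.simps trace_graph_def snd_conv by blast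
qed

text \<open>In the limit the origin has two neighbours: the dead end \<open>e\<close>, and the site
  after the cut at time 2, whose edge every later walk must cross to leave the finite set
  \<open>?B\<close>.\<close>

lemma spike_not_simple:
  assumes reg: "regular \<omega>" and spike: "spike k e (walk0 \<omega>)" and e: "e \<in> directions" "e \<noteq> axis k 1"
    and visit: "\<forall>i\<ge>1. \<exists>t. X i t \<omega> = e"
  shows "\<not> is_simple_path (limit_graph X \<omega>)"
proof (rule not_simple_path_branch)
  have x: "X 0 0 \<omega> = 0" "X 0 1 \<omega> = e" "X 0 2 \<omega> = 0"
    using regularD(1)[OF reg, of 0] spike by (auto simp: spike_def)
  let ?B = "walk0 \<omega> ` {..2}"
  have B: "0 \<in> ?B" "e \<in> ?B" using x by (auto intro: image_eqI[of _ _ 0] image_eqI[of _ _ 1])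
  have bd: "boundary_edge (walk_graph X i \<omega>) ?B 0 (X 0 (Suc 2) \<omega>)" if "1 \<le> i" for i
    using cut_boundary_edge[of \<omega> 2 i] spike reg that x by (simp add: spike_def)
  have lim: "f \<in> snd (limit_graph X \<omega>)" if f: "\<And>i. 1 \<le> i \<Longrightarrow> f \<in> snd (walk_graph X i \<omega>)" for f
  proof -
    have "f \<in> snd (walk_graph X i \<omega>)" for i
      using f[of "Suc i"] regularD(6)[OF reg, of i "Suc i"] by auto
    then show ?thesis by (simp add: limit_graph_def)
  qed
  show "{0, e} \<in> snd (limit_graph X \<omega>)"
    using visit by (intro lim spike_edge[OF reg spike e]) auto
  show "{0, X 0 (Suc 2) \<omega>} \<in> snd (limit_graph X \<omega>)"
    by (intro lim crossing_path(1)[OF reg _ _ B(1) bd]) auto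
  have "X 0 (Suc 2) \<omega> \<notin> ?B" using bd[of 1] by (simp add: boundary_edge_def)
  then show "e \<noteq> X 0 (Suc 2) \<omega>" "X 0 (Suc 2) \<omega> \<noteq> 0" using B by metis+
  show "e \<noteq> 0" using e by auto
qed

text \<open>Already the first step goes to \<open>e\<close> with probability at least
  \<open>pmin\<close>. This serves the early stages, where the resistance bound may exceed
  1.\<close>

lemma esc_lim_le_pmin:
  assumes lattice: "is_lattice (walk_graph X i \<omega>)" and edge: "{0, e} \<in> snd (walk_graph X i \<omega>)"
    and e: "e \<in> directions"
  shows "esc_lim (p (enat i)) (walk_graph X i \<omega>) UNIV {e} 0 \<le> 1 - step_law.pmin (p (enat i))"
proof -
  interpret q: step_law "p (enat i)" by (rule step_law)
  let ?s = "\<lambda>d. step_prob (p (enat i)) (walk_graph X i \<omega>) 0 (0 + d)"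
  have "0 \<noteq> e" using e by auto
  have "esc_lim (p (enat i)) (walk_graph X i \<omega>) UNIV {e} 0 \<le> esc (p (enat i)) (walk_graph X i \<omega>) UNIV {e} (Suc 0) 0"
    by (rule esc_lim_le)
  also have "\<dots> = (\<Sum>d\<in>directions. ?s d * (if 0 + d \<in> {e} then 0 else 1))"
    using \<open>0 \<noteq> e\<close> by (simp only: esc.simps) simp
  also have "\<dots> = (\<Sum>d\<in>directions. ?s d - (if d = e then ?s e else 0))"
    by (intro sum.cong) auto
  also have "\<dots> = (\<Sum>d\<in>directions. ?s d) - ?s e"
    using e by (simp add: sum_subtractf)
  also have "\<dots> \<le> 1 - q.pmin"
    using sum_step_prob_le_1[of "p (enat i)" "walk_graph X i \<omega>" 0] q.step_prob_ge[OF lattice edge] by simp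
  finally show ?thesis .
qed

text \<open>\<open>J n\<close> bounds the probability that walk \<open>Suc n\<close> misses
  \<open>e\<close>, given the first walk, and its expectations are summable. On an event where the
  tail of this series is at most 1/2, at most half of the probability is lost over all stages after
  \<open>I\<close>.\<close>

theorem prob_not_simple_pos:
  assumes e: "e \<in> directions" "e \<noteq> axis k 1"
    and summ: "summable (\<lambda>n. pmf (p (enat (Suc n))) (axis k 1) / pmf (p (enat (Suc n))) e *
      min 1 (p0.mean (ell_hat (p (enat (Suc n))))))"
  shows "0 < prob {\<omega> \<in> space M. \<not> is_simple_path (limit_graph X \<omega>)}"
proof -
  define R where "R = 1 - pmf (p 0) (- axis k 1) / pmf (p 0) (axis k 1)"
  have R: "0 < R" "R \<le> 1"
    using bias_pos pos[OF axis_direction(1)[of k], of 0] by (auto simp: R_def)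
  define r where "r = (\<lambda>n. pmf (p (enat (Suc n))) (axis k 1) / pmf (p (enat (Suc n))) e)"
  define l where "l = (\<lambda>n. ell_hat (p (enat (Suc n))))"
  define J where "J = (\<lambda>n \<omega>. r n * inverse_resistance k e (l n) (walk0 \<omega>))"
  have r: "0 \<le> r n" for n by (simp add: r_def)
  have l: "0 < p0.mean (l n)" for n
    unfolding l_def by (rule mean_ell_hat) (simp add: zero_enat_def)
  have J_meas: "(\<lambda>\<omega>. J n \<omega>) \<in> borel_measurable N" if "\<And>j. X 0 j \<in> measurable N (count_space UNIV)" for n N
    unfolding J_def by (intro borel_measurable_times borel_measurable_const inverse_resistance_measurable that)
  have [measurable]: "(\<lambda>\<omega>. J n \<omega>) \<in> borel_measurable M" for n by (rule J_meas) measurable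
  have J_int: "integrable M (J n)" for n
    unfolding J_def by (intro integrable_mult_right expectation_inverse_resistance(1)[OF e l])
  have AE_sum: "AE \<omega> in M. \<forall>n. summable (\<lambda>j. exp (- ip (l n) (X 0 j \<omega>)))"
    unfolding AE_all_countable using AE_summable_exp[OF l] by blast
  have J_nonneg: "AE \<omega> in M. \<forall>n. 0 \<le> J n \<omega>"
    using AE_sum AE_walk_0
  proof eventually_elim
    case (elim \<omega>)
    then show ?case unfolding J_def
      by (intro allI mult_nonneg_nonneg r inverse_resistance_bounds(1)) blast+
  qed
  have J_exp: "expectation (J n) \<le> (1 / R) * (r n * min 1 (p0.mean (l n)))" for n
  proof -
    let ?E = "expectation (\<lambda>\<omega>. inverse_resistance k e (l n) (walk0 \<omega>))"
    have RE: "R * ?E \<le> R * 1" using expectation_inverse_resistance(3)[OF e l] R by (intro mult_left_mono) auto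
    have "R * ?E \<le> 1" using RE R(2) by linarith
    then have "R * ?E \<le> min 1 (p0.mean (l n))"
      by (rule min.boundedI[OF _ expectation_inverse_resistance(2)[OF e l[of n], folded R_def]])
    then have "?E \<le> (1 / R) * min 1 (p0.mean (l n))"
      using R by (simp add: pos_le_divide_eq mult.commute)
    then have "r n * ?E \<le> r n * ((1 / R) * min 1 (p0.mean (l n)))" using r by (rule mult_left_mono)
    then show ?thesis unfolding J_def by (simp add: mult_ac)
  qed
  have J_exp_nonneg: "0 \<le> expectation (J n)" for n
    using J_nonneg by (intro integral_nonneg_AE) (auto elim!: eventually_mono)
  have J_exp_summable: "summable (\<lambda>n. expectation (J n))"
  proof (rule summable_comparison_test')
    show "summable (\<lambda>n. (1 / R) * (r n * min 1 (p0.mean (l n))))"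
      using summ unfolding r_def l_def by (rule summable_mult)
    show "norm (expectation (J n)) \<le> (1 / R) * (r n * min 1 (p0.mean (l n)))" if "0 \<le> n" for n
      using J_exp[of n] J_exp_nonneg[of n] by simp
  qed
  have J_summable: "AE \<omega> in M. summable (\<lambda>n. J n \<omega>)"
  proof -
    have "(\<integral>\<^sup>+\<omega>. (\<Sum>n. ennreal (J n \<omega>)) \<partial>M) = (\<Sum>n. \<integral>\<^sup>+\<omega>. ennreal (J n \<omega>) \<partial>M)"
      by (rule nn_integral_suminf) measurable
    also have "\<dots> = (\<Sum>n. ennreal (expectation (J n)))"
    proof (rule suminf_cong)
      fix n
      have "AE \<omega> in M. 0 \<le> J n \<omega>" using J_nonneg by eventually_elim blast
      then show "(\<integral>\<^sup>+\<omega>. ennreal (J n \<omega>) \<partial>M) = ennreal (expectation (J n))"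
        by (rule nn_integral_eq_integral[OF J_int])
    qed
    also have "\<dots> < \<infinity>"
      using J_exp_summable J_exp_nonneg by (subst suminf_ennreal2) auto
    finally have "AE \<omega> in M. (\<Sum>n. ennreal (J n \<omega>)) \<noteq> \<infinity>"
      by (intro nn_integral_PInf_AE) auto
    then show ?thesis
      using J_nonneg
    proof eventually_elim
      case (elim \<omega>)
      then show ?case by (intro summable_suminf_not_top) auto
    qed
  qed
  \<comment> \<open>An event of the first walk alone, hence contained in the past of every later
    stage. Any bound below 1 could replace 1/2.\<close>
  define good where "good = (\<lambda>I \<omega>. spike k e (walk0 \<omega>) \<and> (\<forall>m. (\<Sum>j\<in>{I..<I + m}. J j \<omega>) \<le> 1 / 2))"
  have good_pred: "Measurable.pred N (\<lambda>\<omega>. good I \<omega>)" if "\<And>j. X 0 j \<in> measurable N (count_space UNIV)" for I N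
    unfolding good_def
    by (intro pred_intros_logic(3) pred_intros_countable(1) spike_measurable pred_le_const borel_measurable_sum J_meas that)
  have "\<exists>I. 0 < prob {\<omega> \<in> space M. good I \<omega>}"
  proof (rule ccontr)
    assume "\<nexists>I. 0 < prob {\<omega> \<in> space M. good I \<omega>}"
    then have zero: "prob {\<omega> \<in> space M. good I \<omega>} = 0" for I by (meson measure_nonneg not_le order_antisym)
    have "AE \<omega> in M. \<forall>I. \<omega> \<notin> {\<omega> \<in> space M. good I \<omega>}"
      unfolding AE_all_countable
    proof
      fix I
      have "{\<omega> \<in> space M. good I \<omega>} \<in> events" using good_pred[OF X_measurable] by (simp add: pred_def)
      then show "AE \<omega> in M. \<omega> \<notin> {\<omega> \<in> space M. good I \<omega>}" using zero[of I] prob_eq_0 by blast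
    qed
    then have "AE \<omega> in M. \<omega> \<notin> {\<omega> \<in> space M. spike k e (walk0 \<omega>)}"
      using J_summable J_nonneg
    proof eventually_elim
      case (elim \<omega>)
      obtain I where I: "\<And>m n. I \<le> m \<Longrightarrow> norm (\<Sum>j\<in>{m..<n}. J j \<omega>) < 1 / 2"
        using elim(2) unfolding summable_Cauchy by (meson half_gt_zero zero_less_one)
      have "(\<Sum>j\<in>{I..<I + m}. J j \<omega>) \<le> 1 / 2" for m
        using I[of I "I + m"] by simp
      then show ?case using elim(1) unfolding good_def by blast
    qed
    moreover have "{\<omega> \<in> space M. spike k e (walk0 \<omega>)} \<in> events"
      using spike_measurable[OF X_measurable] by (simp add: pred_def)
    ultimately have "prob {\<omega> \<in> space M. spike k e (walk0 \<omega>)} = 0" using prob_eq_0 by blast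
    then show False using prob_spike_pos[OF e] by simp
  qed
  then obtain I where I: "0 < prob {\<omega> \<in> space M. good I \<omega>}" by blast
  define b where "b = (\<lambda>n. {\<omega> \<in> space M. good I \<omega> \<and> (\<forall>i\<in>{1..<n}. \<exists>t. X i t \<omega> = e)})"
  have b_past: "b n \<in> sets (past n)" if n: "1 \<le> n" for n
  proof -
    have g: "Measurable.pred (past n) (\<lambda>\<omega>. good I \<omega>)" using n by (intro good_pred past_X) simp
    have v: "Measurable.pred (past n) (\<lambda>\<omega>. \<exists>t. X i t \<omega> = e)" if "i \<in> {1..<n}" for i
    proof -
      have "Measurable.pred (past n) (\<lambda>\<omega>. X i t \<omega> = e)" for t
        using that by (intro measurable_countable_fun2[OF past_X past_X, where h = "\<lambda>a b. a = e"]) auto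
      then show ?thesis by (intro pred_intros_countable(2))
    qed
    have "Measurable.pred (past n) (\<lambda>\<omega>. good I \<omega> \<and> (\<forall>i\<in>{1..<n}. \<exists>t. X i t \<omega> = e))"
      by (intro pred_intros_logic(3) pred_intros_countable_bounded(3) g v)
    then show ?thesis unfolding b_def pred_def by simp
  qed
  have b_M [measurable]: "b (Suc n) \<in> events" for n by (rule past_sets[OF b_past]) simp
  have b_mono: "b n \<subseteq> b m" if "m \<le> n" for m n using that unfolding b_def by auto
  have drop: "prob (b (Suc n)) - prob (b (Suc (Suc n))) \<le>
      (\<integral>\<omega>. esc_lim (p (enat (Suc n))) (walk_graph X (Suc n) \<omega>) UNIV {e} 0 * indicator (b (Suc n)) \<omega> \<partial>M)" for n
  proof -
    let ?A = "{\<omega> \<in> space M. \<forall>t. X (Suc n) t \<omega> \<notin> {e}}"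
    have "b (Suc (Suc n)) = b (Suc n) - b (Suc n) \<inter> ?A"
    proof -
      have "{1..<Suc (Suc n)} = insert (Suc n) {1..<Suc n}" by auto
      then show ?thesis unfolding b_def by auto
    qed
    moreover have "?A \<in> events"
    proof -
      have "Measurable.pred M (\<lambda>\<omega>. X (Suc n) t \<omega> \<notin> {e})" for t
        by (intro measurable_countable_fun2[OF X_measurable X_measurable, where h = "\<lambda>a b. a \<notin> {e}"])
      then have "Measurable.pred M (\<lambda>\<omega>. \<forall>t. X (Suc n) t \<omega> \<notin> {e})" by (intro pred_intros_countable(1))
      then show ?thesis by (simp add: pred_def)
    qed
    ultimately have "prob (b (Suc (Suc n))) = prob (b (Suc n)) - prob (b (Suc n) \<inter> ?A)"
      using finite_measure_Diff[of "b (Suc n)" "b (Suc n) \<inter> ?A"] by simp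
    then show ?thesis using prob_avoid_forever[OF b_past, of "Suc n" "{e}"] by simp
  qed
  have esc_int: "integrable M (\<lambda>\<omega>. esc_lim (p (enat i)) (walk_graph X i \<omega>) UNIV {e} 0 * indicator (b (Suc n)) \<omega>)" for i n
    by (rule integrable_const_bound[of _ 1])
      (auto simp: abs_mult esc_lim_nonneg intro!: mult_le_one esc_lim_le_1)
  have edge: "{0, e} \<in> snd (walk_graph X (Suc n) \<omega>)" "spike k e (walk0 \<omega>)" if "\<omega> \<in> b (Suc n)" "regular \<omega>" for n \<omega>
    using that spike_edge[OF that(2) _ e, of "Suc n"] unfolding b_def good_def by auto
  have positive: "0 < prob (b (Suc n))" for n
  proof (induction n)
    case 0
    have "b (Suc 0) = {\<omega> \<in> space M. good I \<omega>}" unfolding b_def by simp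
    then show ?case using I by simp
  next
    case (Suc n)
    interpret q: step_law "p (enat (Suc n))" by (rule step_law)
    have "(\<integral>\<omega>. esc_lim (p (enat (Suc n))) (walk_graph X (Suc n) \<omega>) UNIV {e} 0 * indicator (b (Suc n)) \<omega> \<partial>M) \<le>
        (\<integral>\<omega>. (1 - q.pmin) * indicator (b (Suc n)) \<omega> \<partial>M)"
    proof (rule integral_mono_AE[OF esc_int])
      show "integrable M (\<lambda>\<omega>. (1 - q.pmin) * indicator (b (Suc n)) \<omega>)"
        by (intro integrable_mult_right integrable_real_indicator) (auto simp: emeasure_eq_measure)
      show "AE \<omega> in M. esc_lim (p (enat (Suc n))) (walk_graph X (Suc n) \<omega>) UNIV {e} 0 * indicator (b (Suc n)) \<omega> \<le>
          (1 - q.pmin) * indicator (b (Suc n)) \<omega>"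
        using AE_reg
      proof eventually_elim
        case (elim \<omega>)
        show ?case
        proof (cases "\<omega> \<in> b (Suc n)")
          case True
          then show ?thesis
            using esc_lim_le_pmin[OF regularD(4)[OF elim] edge(1)[OF True elim] e(1)] by simp
        qed simp
      qed
    qed
    also have "\<dots> = (1 - q.pmin) * prob (b (Suc n))" by simp
    finally have "q.pmin * prob (b (Suc n)) \<le> prob (b (Suc (Suc n)))"
      using drop[of n] by (simp add: algebra_simps)
    moreover have "0 < q.pmin * prob (b (Suc n))" using Suc q.pmin(1) by simp
    ultimately show ?case by linarith
  qed
  let ?b = "b (Suc I)"
  have Jb_int: "integrable M (\<lambda>\<omega>. J j \<omega> * indicator ?b \<omega>)" for j
    by (intro integrable_real_mult_indicator J_int) measurable
  \<comment> \<open>The indicator of \<open>b (Suc n)\<close> is replaced by that of the larger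
    fixed event \<open>?b\<close>, so that the losses can be summed under one integral before
    \<open>good\<close> is applied.\<close>
  have drop_J: "prob (b (Suc n)) - prob (b (Suc (Suc n))) \<le> (\<integral>\<omega>. J n \<omega> * indicator ?b \<omega> \<partial>M)" if n: "I \<le> n" for n
  proof -
    note drop[of n]
    also have "(\<integral>\<omega>. esc_lim (p (enat (Suc n))) (walk_graph X (Suc n) \<omega>) UNIV {e} 0 * indicator (b (Suc n)) \<omega> \<partial>M) \<le>
        (\<integral>\<omega>. J n \<omega> * indicator ?b \<omega> \<partial>M)"
    proof (rule integral_mono_AE[OF esc_int Jb_int])
      show "AE \<omega> in M. esc_lim (p (enat (Suc n))) (walk_graph X (Suc n) \<omega>) UNIV {e} 0 * indicator (b (Suc n)) \<omega> \<le>
          J n \<omega> * indicator ?b \<omega>"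
        using AE_reg AE_sum J_nonneg
      proof eventually_elim
        case (elim \<omega>)
        show ?case
        proof (cases "\<omega> \<in> b (Suc n)")
          case True
          then have "\<omega> \<in> ?b" using b_mono[of "Suc I" "Suc n"] n by auto
          moreover have "esc_lim (p (enat (Suc n))) (walk_graph X (Suc n) \<omega>) UNIV {e} 0 \<le> J n \<omega>"
            unfolding J_def r_def l_def
            using elim(2) unfolding l_def
            by (intro esc_lim_spike[OF elim(1) edge(2)[OF True elim(1)] e _ edge(1)[OF True elim(1)]]) auto
          ultimately show ?thesis using True by simp
        next
          case False
          then show ?thesis using elim(3) by (simp add: indicator_def)
        qed
      qed
    qed
    finally show ?thesis .
  qed
  have total: "prob ?b - prob (b (Suc (I + m))) \<le> (\<integral>\<omega>. (\<Sum>j\<in>{I..<I + m}. J j \<omega>) * indicator ?b \<omega> \<partial>M)" for m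
  proof -
    have "prob ?b - prob (b (Suc (I + m))) = (\<Sum>j\<in>{I..<I + m}. prob (b (Suc j)) - prob (b (Suc (Suc j))))"
      by (induction m) auto
    also have "\<dots> \<le> (\<Sum>j\<in>{I..<I + m}. (\<integral>\<omega>. J j \<omega> * indicator ?b \<omega> \<partial>M))"
      by (intro sum_mono drop_J) auto
    also have "\<dots> = (\<integral>\<omega>. (\<Sum>j\<in>{I..<I + m}. J j \<omega> * indicator ?b \<omega>) \<partial>M)"
      by (intro Bochner_Integration.integral_sum[symmetric] Jb_int)
    also have "\<dots> = (\<integral>\<omega>. (\<Sum>j\<in>{I..<I + m}. J j \<omega>) * indicator ?b \<omega> \<partial>M)"
      by (simp only: sum_distrib_right)
    finally show ?thesis .
  qed
  have "prob ?b / 2 \<le> prob (b (Suc (I + m)))" for m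
  proof -
    have "(\<integral>\<omega>. (\<Sum>j\<in>{I..<I + m}. J j \<omega>) * indicator ?b \<omega> \<partial>M) \<le> (\<integral>\<omega>. 1 / 2 * indicator ?b \<omega> \<partial>M)"
    proof (rule integral_mono_AE)
      show "integrable M (\<lambda>\<omega>. (\<Sum>j\<in>{I..<I + m}. J j \<omega>) * indicator ?b \<omega>)"
        unfolding sum_distrib_right by (intro Bochner_Integration.integrable_sum Jb_int)
      show "integrable M (\<lambda>\<omega>. 1 / 2 * indicator ?b \<omega> :: real)"
        by (intro integrable_mult_right integrable_real_indicator) (auto simp: emeasure_eq_measure)
      show "AE \<omega> in M. (\<Sum>j\<in>{I..<I + m}. J j \<omega>) * indicator ?b \<omega> \<le> 1 / 2 * indicator ?b \<omega>"
      proof (rule AE_I2)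
        fix \<omega>
        show "(\<Sum>j\<in>{I..<I + m}. J j \<omega>) * indicator ?b \<omega> \<le> 1 / 2 * indicator ?b \<omega>"
        proof (cases "\<omega> \<in> ?b")
          case True
          then have "(\<Sum>j\<in>{I..<I + m}. J j \<omega>) \<le> 1 / 2" unfolding b_def good_def by blast
          then show ?thesis using True by simp
        qed simp
      qed
    qed
    then show ?thesis using total[of m] by simp
  qed
  moreover have "(\<lambda>m. prob (b (Suc (I + m)))) \<longlonglongrightarrow> prob (\<Inter>m. b (Suc (I + m)))"
  proof (rule finite_Lim_measure_decseq)
    show "range (\<lambda>m. b (Suc (I + m))) \<subseteq> events" using b_M by blast
    show "decseq (\<lambda>m. b (Suc (I + m)))" unfolding decseq_def by (intro allI impI b_mono) simp
  qed
  ultimately have "prob ?b / 2 \<le> prob (\<Inter>m. b (Suc (I + m)))"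
    by (intro LIMSEQ_le_const) blast+
  also have "\<dots> \<le> prob {\<omega> \<in> space M. \<not> is_simple_path (limit_graph X \<omega>)}"
  proof (rule finite_measure_mono_AE[OF _ simple_path_measurable])
    show "AE \<omega> in M. \<omega> \<in> (\<Inter>m. b (Suc (I + m))) \<longrightarrow> \<omega> \<in> {\<omega> \<in> space M. \<not> is_simple_path (limit_graph X \<omega>)}"
      using AE_reg
    proof (eventually_elim, intro impI)
      fix \<omega> assume reg: "regular \<omega>" and b: "\<omega> \<in> (\<Inter>m. b (Suc (I + m)))"
      have "\<exists>t. X i t \<omega> = e" if "1 \<le> i" for i
      proof -
        have "\<omega> \<in> b (Suc (I + i))" using b by blast
        then show ?thesis using that unfolding b_def by auto
      qed
      moreover have "\<omega> \<in> space M" "spike k e (walk0 \<omega>)" using b unfolding b_def good_def by auto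
      ultimately show "\<omega> \<in> {\<omega> \<in> space M. \<not> is_simple_path (limit_graph X \<omega>)}"
        using spike_not_simple[OF reg _ e] by blast
    qed
  qed
  finally show ?thesis using positive[of I] by simp
qed

section \<open>Translation into the conductances of the theorem\<close>

lemma beta_powr:
  assumes "i \<noteq> 0"
  shows "beta (p i) powr (v \<bullet> ell (p i)) = exp (v \<bullet> ell_hat (p i))"
  using norm_ell_hat_pos[OF assms] by (simp add: beta_def ell_def powr_def)

text \<open>For \<open>axis j 1\<close> the exponential factor turns the backward probability into
  the forward one; for \<open>- axis j 1\<close> the maximum with 0 is 0 and the exponential is
  1.\<close>

lemma conductance_0:
  assumes i: "i \<noteq> 0" and e: "e \<in> directions"
  shows "conductance (p i) 0 e = pmf (p i) e"
proof -
  interpret q: step_law "p i" by (rule step_law)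
  from e consider j where "e = axis j 1" | j where "e = - axis j 1"
    unfolding directions_def by blast
  then show ?thesis
  proof cases
    case (1 j)
    have "(\<Prod>l\<in>UNIV. pmf (p i) (- axis l 1) ^ nat \<bar>e $ l - 0 $ l\<bar>) = pmf (p i) (- axis j 1)"
      by (subst prod.remove[of _ j]) (auto simp: 1 axis_def)
    moreover have "(\<chi> l. real_of_int (max (0 $ l) (e $ l))) = axis j 1"
      by (simp add: vec_eq_iff 1 axis_def)
    ultimately have "conductance (p i) 0 e = pmf (p i) (- axis j 1) * exp (ell_hat (p i) $ j)"
      unfolding conductance_def beta_powr[OF i] by (simp add: inner_axis' )
    then show ?thesis using pos[OF axis_direction(2)[of j], of i] by (simp add: q.exp_ell_hat 1)
  next
    case (2 j)
    have "(\<Prod>l\<in>UNIV. pmf (p i) (- axis l 1) ^ nat \<bar>e $ l - 0 $ l\<bar>) = pmf (p i) (- axis j 1)"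
      by (subst prod.remove[of _ j]) (auto simp: 2 axis_def)
    moreover have "(\<chi> l. real_of_int (max (0 $ l) (e $ l))) = (0 :: real ^ 'd)"
      by (simp add: vec_eq_iff 2 axis_def)
    ultimately show ?thesis
      unfolding conductance_def beta_powr[OF i] by (simp add: 2)
  qed
qed

text \<open>The power of \<open>beta\<close> is the exponential of the mean, so this is
  \<open>x \<le> exp x - 1\<close> followed by multiplication with \<open>beta\<close>, which is at
  least 1.\<close>

lemma mean_le_beta_powr:
  assumes i: "i \<noteq> 0"
  shows "p0.mean (ell_hat (p i)) \<le> (beta (p i) powr (1 * (drift (p 0) \<bullet> ell (p i))) - 1) * beta (p i) powr 1"
proof -
  let ?a = "p0.mean (ell_hat (p i))"
  have \<beta>: "1 \<le> beta (p i)" by (simp add: beta_def)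
  have a: "?a \<le> exp ?a - 1" using exp_ge_add_one_self[of ?a] by linarith
  also have "\<dots> = (exp ?a - 1) * 1" by simp
  also have "\<dots> \<le> (exp ?a - 1) * beta (p i)"
    using a mean_ell_hat[OF i] \<beta> by (intro mult_left_mono) auto
  also have "\<dots> = (beta (p i) powr (1 * (drift (p 0) \<bullet> ell (p i))) - 1) * beta (p i) powr 1"
    using \<beta> by (simp only: mult_1 beta_powr[OF i] mean_eq powr_one)
  finally show ?thesis .
qed

end

theorem theorem3:
  fixes M :: "'a measure"
    and p :: "enat \<Rightarrow> (int ^ 'd::finite) pmf"
    and X :: "nat \<Rightarrow> nat \<Rightarrow> 'a \<Rightarrow> int ^ 'd"
    and k :: 'd
  assumes "CARD('d) \<ge> 2"
    and "nested_walks M p X"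
    and "condition1 p k"
  shows "((\<exists>i. infinite {i'. p i' = p i}) \<longrightarrow>
            (AE \<omega> in M. is_simple_path (limit_graph X \<omega>)))
         \<and>
         ((\<exists>e \<in> directions. e \<noteq> axis k 1 \<and>
             (\<forall>c > (0::real). summable (\<lambda>n. let q = p (enat (Suc n)) in
                conductance q 0 (axis k 1) / conductance q 0 e *
                min 1 ((beta q powr (c * (drift (p 0) \<bullet> ell q)) - 1) * beta q powr c)))) \<longrightarrow>
            \<P>(\<omega> in M. \<not> is_simple_path (limit_graph X \<omega>)) > 0)"
proof -
  interpret directed_walks M p X k
    using assms(2,3) by (simp add: directed_walks_def directed_walks_axioms_def)
  show ?thesis
  proof (intro conjI impI)
    assume "\<exists>i. infinite {i'. p i' = p i}"
    then obtain i where i: "infinite {i'. p i' = p i}" by blast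
    \<comment> \<open>The index infinity belongs to no walk and the walk with index 0 does not live
      on a trace; leaving out these two keeps the set infinite.\<close>
    let ?I = "{j. 1 \<le> j \<and> p (enat j) = p i}"
    have "{i'. p i' = p i} \<subseteq> enat ` ?I \<union> {0, \<infinity>}"
    proof
      fix i' assume "i' \<in> {i'. p i' = p i}"
      then show "i' \<in> enat ` ?I \<union> {0, \<infinity>}"
        by (cases i') (auto simp: zero_enat_def Suc_le_eq intro!: image_eqI)
    qed
    then have "infinite ?I" using i finite_subset by blast
    then show "AE \<omega> in M. is_simple_path (limit_graph X \<omega>)" by (rule AE_simple_path)
  next
    assume "\<exists>e \<in> directions. e \<noteq> axis k 1 \<and>
             (\<forall>c > (0::real). summable (\<lambda>n. let q = p (enat (Suc n)) in
                conductance q 0 (axis k 1) / conductance q 0 e *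
                min 1 ((beta q powr (c * (drift (p 0) \<bullet> ell q)) - 1) * beta q powr c)))"
    then obtain e where e: "e \<in> directions" "e \<noteq> axis k 1"
      and s: "summable (\<lambda>n. let q = p (enat (Suc n)) in
                conductance q 0 (axis k 1) / conductance q 0 e *
                min 1 ((beta q powr (1 * (drift (p 0) \<bullet> ell q)) - 1) * beta q powr 1))"
      using zero_less_one by blast
    have "summable (\<lambda>n. pmf (p (enat (Suc n))) (axis k 1) / pmf (p (enat (Suc n))) e *
        min 1 (p0.mean (ell_hat (p (enat (Suc n))))))"
    proof (rule summable_comparison_test'[OF s, where N = 0])
      fix n :: nat
      let ?q = "p (enat (Suc n))"
      have i: "enat (Suc n) \<noteq> 0" by (simp add: zero_enat_def)
      have le: "min 1 (p0.mean (ell_hat ?q)) \<le> min 1 ((beta ?q powr (1 * (drift (p 0) \<bullet> ell ?q)) - 1) * beta ?q powr 1)"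
        by (intro min.mono order_refl mean_le_beta_powr i)
      have eq: "norm (pmf ?q (axis k 1) / pmf ?q e * min 1 (p0.mean (ell_hat ?q))) =
          pmf ?q (axis k 1) / pmf ?q e * min 1 (p0.mean (ell_hat ?q))"
        using mean_ell_hat[OF i] by (simp add: abs_mult)
      show "norm (pmf ?q (axis k 1) / pmf ?q e * min 1 (p0.mean (ell_hat ?q))) \<le>
          (let q = ?q in conductance q 0 (axis k 1) / conductance q 0 e *
                min 1 ((beta q powr (1 * (drift (p 0) \<bullet> ell q)) - 1) * beta q powr 1))"
        unfolding Let_def conductance_0[OF i axis_direction(1)] conductance_0[OF i e(1)] eq
        by (rule mult_left_mono[OF le]) simp
    qed
    then show "\<P>(\<omega> in M. \<not> is_simple_path (limit_graph X \<omega>)) > 0"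
      by (rule prob_not_simple_pos[OF e])
  qed
qed

end
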